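(* Let $0<r<1$. Then $\kappa(\overline{\mathbb{D}}\setminus\{0\})$ is a minimal closed von Neumann set for each of the classes $\kappa(C_\alpha)$, $\kappa(C_\alpha^* )$, $\kappa(C_\alpha\cup C_\alpha^* )$, $\kappa(C_{1,r})$ and $\kappa(C_1)$.
   Context: All operators are bounded linear maps on complex Hilbert spaces; $\overline{\mathbb{D}}$ is the closed unit disk. $\kappa:\mathbb{C}\setminus\{0\}\to\mathbb{C}^2$ is $\kappa(z)=\left(\frac{z}{\sqrt{1+r^2}},\frac{rz^{-1}}{\sqrt{1+r^2}}\right)$; for an invertible operator $T$, $\kappa(T)=\left(\frac{T}{\sqrt{1+r^2}},\frac{rT^{-1}}{\sqrt{1+r^2}}\right)$; for a class $\mathcal{C}$ of invertible operators, $\kappa(\mathcal{C})=\{\kappa(T):T\in\mathcal{C}\}$. $C_\alpha$ is the class of invertible $T$ with $-T^{*2}T^2+(1+r^2)T^*T-r^2I\ge0$; $C_\alpha^*=\{T:T^*\in C_\alpha\}$; $C_{1,r}=\{T: T\text{ invertible},\ \|T\|\le1,\ \|rT^{-1}\|\le1\}$; $C_1=\{T:T\text{ invertible},\ \|T\|\le1\}$. A set $Y\subseteq\mathbb{C}^n$ is a von Neumann set for a commuting $n$-tuple $\underline{T}$ if its Taylor joint spectrum satisfies $\sigma_T(\underline{T})\subseteq Y$ and $\|f(\underline{T})\|\le\sup_{\xi\in Y}|f(\xi)|$ (possibly $+\infty$) for every rational function $f=p/g$ with $p,g\in\mathbb{C}[z_1,\dots,z_n]$ and $g$ having no zeros in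 $Y$, where $f(\underline{T})=p(\underline{T})g(\underline{T})^{-1}$. A closed set $Y\subset\mathbb{C}^n$ is a minimal closed von Neumann set for a class $\mathcal{S}$ of commuting $n$-tuples if $Y$ is a von Neumann set for each member of $\mathcal{S}$ and for every proper closed subset $Y_1$ of $Y$ there is $\underline{S}\in\mathcal{S}$ such that $Y_1$ is not a von Neumann set for $\underline{S}$. *)

theory Defs
  imports "HOL-Analysis.Analysis" "HOL-Library.Poly_Mapping"
begin

text \<open>The inner product is linear in its first argument. Positive definiteness is a
  consequence of the axiom relating it to the norm.\<close>

class complex_hilbert = banach +
  fixes scaleC :: "complex \<Rightarrow> 'a \<Rightarrow> 'a"  (infixr \<open>*\<^sub>C\<close> 75)
    and cinner :: "'a \<Rightarrow> 'a \<Rightarrow> complex"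
  assumes scaleC_add_right: "a *\<^sub>C (x + y) = a *\<^sub>C x + a *\<^sub>C y"
    and scaleC_add_left: "(a + b) *\<^sub>C x = a *\<^sub>C x + b *\<^sub>C x"
    and scaleC_scaleC: "a *\<^sub>C b *\<^sub>C x = (a * b) *\<^sub>C x"
    and scaleR_scaleC: "t *\<^sub>R x = complex_of_real t *\<^sub>C x"
    and cinner_add_left: "cinner (x + y) z = cinner x z + cinner y z"
    and cinner_scaleC_left: "cinner (a *\<^sub>C x) y = a * cinner x y"
    and cinner_commute: "cinner x y = cnj (cinner y x)"
    and cinner_norm: "cinner x x = complex_of_real ((norm x)\<^sup>2)"

text \<open>A class of operators on varying Hilbert spaces is a set of pairs \<open>(H, T)\<close>, where the
  Hilbert space \<open>H\<close> is a closed subspace of an ambient Hilbert space \<open>'h\<close> and \<open>T\<close> is an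
  operator on \<open>H\<close>. Only the values of \<open>T\<close> on \<open>H\<close> matter. Up to unitary equivalence, every
  Hilbert space occurs in this way for a suitable \<open>'h\<close>.\<close>

definition hilbert_subspace :: "'h::complex_hilbert set \<Rightarrow> bool" where
  "hilbert_subspace H \<longleftrightarrow> closed H \<and> 0 \<in> H \<and> (\<forall>x\<in>H. \<forall>y\<in>H. x + y \<in> H) \<and> (\<forall>a. \<forall>x\<in>H. a *\<^sub>C x \<in> H)"

definition operator_on :: "'h::complex_hilbert set \<Rightarrow> ('h \<Rightarrow> 'h) \<Rightarrow> bool" where
  "operator_on H T \<longleftrightarrow> hilbert_subspace H \<and> T ` H \<subseteq> H
     \<and> (\<forall>x\<in>H. \<forall>y\<in>H. T (x + y) = T x + T y) \<and> (\<forall>a. \<forall>x\<in>H. T (a *\<^sub>C x) = a *\<^sub>C T x)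
     \<and> (\<exists>K. \<forall>x\<in>H. norm (T x) \<le> K * norm x)"

definition op_norm :: "'h::complex_hilbert set \<Rightarrow> ('h \<Rightarrow> 'h) \<Rightarrow> ennreal" where
  "op_norm H T = (SUP x\<in>{x\<in>H. norm x \<le> 1}. ennreal (norm (T x)))"

definition adj_on :: "'h::complex_hilbert set \<Rightarrow> ('h \<Rightarrow> 'h) \<Rightarrow> 'h \<Rightarrow> 'h" where
  "adj_on H T y = (THE z. z \<in> H \<and> (\<forall>x\<in>H. cinner (T x) y = cinner x z))"

definition invertible_on :: "'h::complex_hilbert set \<Rightarrow> ('h \<Rightarrow> 'h) \<Rightarrow> bool" where
  "invertible_on H T \<longleftrightarrow> operator_on H T \<and> bij_betw T H H \<and> operator_on H (inv_into H T)"

definition positive_on :: "'h::complex_hilbert set \<Rightarrow> ('h \<Rightarrow> 'h) \<Rightarrow> bool" where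
  "positive_on H A \<longleftrightarrow> (\<forall>x\<in>H. cinner (A x) x \<in> \<real>\<^sub>\<ge>\<^sub>0)"

definition commuting_tuple :: "'h::complex_hilbert set \<Rightarrow> ('h \<Rightarrow> 'h) ^ 'n \<Rightarrow> bool" where
  "commuting_tuple H T \<longleftrightarrow> hilbert_subspace H \<and> (\<forall>i. operator_on H (T $ i))
     \<and> (\<forall>i j. \<forall>x\<in>H. (T $ i) ((T $ j) x) = (T $ j) ((T $ i) x))"

text \<open>An element \<open>\<Sum>S. \<omega> S \<otimes> e\<^sub>S\<close> of \<open>H \<otimes> \<Lambda>(\<complex>\<^sup>n)\<close> is encoded by its coefficient
  function \<open>\<omega>\<close> on the sets \<open>S\<close> of indices. The Koszul map sends \<open>x \<otimes> e\<^sub>S\<close> to the sum over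
  \<open>i\<close> of \<open>T\<^sub>i x \<otimes> (e\<^sub>i \<and> e\<^sub>S)\<close>. Because it is homogeneous of degree one, exactness of the
  Koszul complex at every stage amounts to equality of the total kernel and range.\<close>

definition koszul :: "('h::complex_hilbert \<Rightarrow> 'h) ^ 'n::{finite,linorder} \<Rightarrow> ('n set \<Rightarrow> 'h) \<Rightarrow> 'n set \<Rightarrow> 'h"
  where "koszul T \<omega> S = (\<Sum>i\<in>S. (-1) ^ card {j\<in>S. j < i} *\<^sub>R (T $ i) (\<omega> (S - {i})))"

definition taylor_nonsingular :: "'h::complex_hilbert set \<Rightarrow> ('h \<Rightarrow> 'h) ^ 'n::{finite,linorder} \<Rightarrow> bool"
  where "taylor_nonsingular H T \<longleftrightarrow>
    {\<omega>. range \<omega> \<subseteq> H \<and> koszul T \<omega> = (\<lambda>_. 0)} = koszul T ` {\<eta>. range \<eta> \<subseteq> H}"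

definition taylor_spectrum ::
    "'h::complex_hilbert set \<Rightarrow> ('h \<Rightarrow> 'h) ^ 'n::{finite,linorder} \<Rightarrow> (complex ^ 'n::{finite,linorder}) set"
  where "taylor_spectrum H T =
    {l. \<not> taylor_nonsingular H (\<chi> i. (\<lambda>x. (T $ i) x - (l $ i) *\<^sub>C x))}"

text \<open>The monoid ring of the multi-indices \<open>nat ^ 'n\<close> is the polynomial ring in
  variables indexed by \<open>'n\<close>.\<close>

type_synonym 'n cpoly = "(nat ^ 'n) \<Rightarrow>\<^sub>0 complex"

definition cpoly_eval :: "'n::finite cpoly \<Rightarrow> complex ^ 'n \<Rightarrow> complex" where
  "cpoly_eval p z = (\<Sum>m\<in>Poly_Mapping.keys p. Poly_Mapping.lookup p m * (\<Prod>i\<in>UNIV. (z $ i) ^ (m $ i)))"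

text \<open>The order of the factors is immaterial for commuting tuples.\<close>

definition monom_op :: "('h \<Rightarrow> 'h) ^ 'n::{finite,linorder} \<Rightarrow> nat ^ 'n::{finite,linorder} \<Rightarrow> 'h \<Rightarrow> 'h" where
  "monom_op T m = foldr (\<lambda>i S. ((T $ i) ^^ (m $ i)) \<circ> S) (sorted_list_of_set UNIV) id"

definition cpoly_op ::
    "'n::{finite,linorder} cpoly \<Rightarrow> ('h::complex_hilbert \<Rightarrow> 'h) ^ 'n::{finite,linorder} \<Rightarrow> 'h \<Rightarrow> 'h"
  where "cpoly_op p T x =
    (\<Sum>m\<in>Poly_Mapping.keys p. Poly_Mapping.lookup p m *\<^sub>C monom_op T m x)"

definition rational_op :: "'h::complex_hilbert set \<Rightarrow> 'n::{finite,linorder} cpoly \<Rightarrow> 'n cpoly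
    \<Rightarrow> ('h \<Rightarrow> 'h) ^ 'n::{finite,linorder} \<Rightarrow> 'h \<Rightarrow> 'h"
  where "rational_op H p g T x = cpoly_op p T (inv_into H (cpoly_op g T) x)"

text \<open>If the Taylor spectrum lies in \<open>Y\<close> and \<open>g\<close> has no zeros in \<open>Y\<close>, then \<open>g(T)\<close> is
  invertible on \<open>H\<close> by the spectral mapping theorem, so \<open>inv_into\<close> is its true inverse.\<close>

definition von_Neumann_set ::
    "(complex ^ 'n::{finite,linorder}) set \<Rightarrow> 'h::complex_hilbert set \<Rightarrow> ('h \<Rightarrow> 'h) ^ 'n::{finite,linorder} \<Rightarrow> bool"
  where "von_Neumann_set Y H T \<longleftrightarrow> taylor_spectrum H T \<subseteq> Y
    \<and> (\<forall>p g. g \<noteq> 0 \<and> (\<forall>\<xi>\<in>Y. cpoly_eval g \<xi> \<noteq> 0) \<longrightarrow>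
         op_norm H (rational_op H p g T) \<le> (SUP \<xi>\<in>Y. ennreal (cmod (cpoly_eval p \<xi> / cpoly_eval g \<xi>))))"

definition minimal_closed_von_Neumann_set ::
    "(complex ^ 'n::{finite,linorder}) set \<Rightarrow> ('h::complex_hilbert set \<times> (('h \<Rightarrow> 'h) ^ 'n::{finite,linorder})) set \<Rightarrow> bool"
  where "minimal_closed_von_Neumann_set Y \<S> \<longleftrightarrow>
    (\<forall>(H, T)\<in>\<S>. commuting_tuple H T) \<and> closed Y
    \<and> (\<forall>(H, T)\<in>\<S>. von_Neumann_set Y H T)
    \<and> (\<forall>Y\<^sub>1. closed Y\<^sub>1 \<and> Y\<^sub>1 \<subset> Y \<longrightarrow> (\<exists>(H, T)\<in>\<S>. \<not> von_Neumann_set Y\<^sub>1 H T))"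

definition kappa :: "real \<Rightarrow> complex \<Rightarrow> complex ^ 2" where
  "kappa r z = vector [z / complex_of_real (sqrt (1 + r\<^sup>2)),
                       complex_of_real r * inverse z / complex_of_real (sqrt (1 + r\<^sup>2))]"

definition kappa_op :: "real \<Rightarrow> 'h::complex_hilbert set \<Rightarrow> ('h \<Rightarrow> 'h) \<Rightarrow> ('h \<Rightarrow> 'h) ^ 2" where
  "kappa_op r H T = (\<chi> i. if i = 1 then (\<lambda>x. (1 / sqrt (1 + r\<^sup>2)) *\<^sub>R T x)
                          else (\<lambda>x. (r / sqrt (1 + r\<^sup>2)) *\<^sub>R inv_into H T x))"

definition kappa_class :: "real \<Rightarrow> ('h::complex_hilbert set \<times> ('h \<Rightarrow> 'h)) set
    \<Rightarrow> ('h set \<times> (('h \<Rightarrow> 'h) ^ 2)) set"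
  where "kappa_class r \<C> = (\<lambda>(H, T). (H, kappa_op r H T)) ` \<C>"

definition C_alpha :: "real \<Rightarrow> ('h::complex_hilbert set \<times> ('h \<Rightarrow> 'h)) set" where
  "C_alpha r = {(H, T). invertible_on H T \<and>
     positive_on H (\<lambda>x. - adj_on H T (adj_on H T (T (T x)))
                        + (1 + r\<^sup>2) *\<^sub>R adj_on H T (T x) - r\<^sup>2 *\<^sub>R x)}"

definition C_alpha_star :: "real \<Rightarrow> ('h::complex_hilbert set \<times> ('h \<Rightarrow> 'h)) set" where
  "C_alpha_star r = {(H, T). operator_on H T \<and> (H, adj_on H T) \<in> C_alpha r}"

definition C_1r :: "real \<Rightarrow> ('h::complex_hilbert set \<times> ('h \<Rightarrow> 'h)) set" where
  "C_1r r = {(H, T). invertible_on H T \<and> op_norm H T \<le> 1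
     \<and> op_norm H (\<lambda>x. r *\<^sub>R inv_into H T x) \<le> 1}"

definition C_1 :: "('h::complex_hilbert set \<times> ('h \<Rightarrow> 'h)) set" where
  "C_1 = {(H, T). invertible_on H T \<and> op_norm H T \<le> 1}"

end

theory Submission
  imports Defs "HOL-Computational_Algebra.Fundamental_Theorem_Algebra"
begin

text \<open>Every operator in the five classes is an invertible contraction: for \<open>C_alpha\<close> an expanding
  vector would have a backward orbit with negative squared norms, and \<open>C_alpha_star\<close> follows by
  duality. A rational function of \<open>\<kappa>(T)\<close> that is bounded on \<open>\<kappa>(D - {0})\<close> is a rational function
  of \<open>T\<close> without poles in the closed disc \<open>D\<close>, so the von Neumann property is von Neumann's
  inequality, proved here by averaging an operator-valued Fejer kernel over roots of unity.

  For minimality let \<open>\<kappa>(a)\<close> be missing from the closed subset. If \<open>r \<le> \<bar>a\<bar>\<close>, the scalar operator \<open>a\<close>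
  violates the spectral inclusion. If \<open>\<bar>a\<bar> < r\<close>, consider \<open>f = b\<^sub>a\<^sup>2 / b\<^sub>p\<close> for Blaschke factors with zeros
  \<open>a\<close> and \<open>p\<close>. For \<open>p\<close> close to \<open>a\<close> it is bounded by 1 on the smaller set, and it is unimodular on the
  unit circle. The spaces on which the bilateral shifts with weights \<open>1, r\<close> or \<open>r, 1\<close> are
  modelled carry the \<open>L\<^sup>2\<close> norm of the circle changed by a factor on the coefficients of one sign
  only; as \<open>f\<close> has a pole in the disc, this makes \<open>f\<close> of the shift have norm larger than 1.\<close>

section \<open>Hilbert spaces and adjoints\<close>

text \<open>The square in f creates slack. As b_a and b_p are both unimodular on the circle,
  closeness of p to a alone does not bound b_a / b_p by 1; but 1 - |b_a|^4 is 1 - |b_a|^2 times the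
  factor 1 + |b_a|^2, which stays above 1 away from a and absorbs the displacement of p. For |a| < r
  a function is unavoidable: operators in \<open>C_1r\<close> have no spectrum there, so only a norm
  can notice the missing point. The pole p is kept below r in modulus because the shifts are bounded
  below by r, which makes the denominator injective on them. The test vector comes from truncating
  1/(1 - cnj p z): times the numerator of f this function is (z - a)^2, which stops at degree 2,
  whereas times the denominator it has an infinite expansion. Both products have the same norm on
  the circle, so changing the weights from index 3 on affects essentially the denominator alone. Two
  shifts occur because, with weights 1 and r, the inequality of \<open>C_alpha\<close> dictates
  their order, and passing to the adjoint reverses it.\<close>

lemma scaleC_one [simp]: "1 *\<^sub>C x = (x::'h::complex_hilbert)"
  using scaleR_scaleC[of 1 x] by simp

lemma scaleC_0_left [simp]: "0 *\<^sub>C x = (0::'h::complex_hilbert)"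
  using scaleR_scaleC[of 0 x] by simp

lemma scaleC_0_right [simp]: "a *\<^sub>C 0 = (0::'h::complex_hilbert)"
  using scaleC_add_right[of a 0 0] by simp

lemma scaleC_minus_one [simp]: "(-1) *\<^sub>C x = - (x::'h::complex_hilbert)"
  using scaleR_scaleC[of "-1" x] by simp

lemma scaleC_minus_left: "(- a) *\<^sub>C x = - (a *\<^sub>C (x::'h::complex_hilbert))"
  by (simp add: eq_neg_iff_add_eq_0 flip: scaleC_add_left)

lemma scaleC_minus_right: "a *\<^sub>C (- x) = - (a *\<^sub>C (x::'h::complex_hilbert))"
  by (simp add: eq_neg_iff_add_eq_0 flip: scaleC_add_right)

lemma scaleC_diff_left: "(a - b) *\<^sub>C x = a *\<^sub>C x - b *\<^sub>C (x::'h::complex_hilbert)"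
  by (simp only: diff_conv_add_uminus scaleC_add_left scaleC_minus_left)

lemma scaleC_diff_right: "a *\<^sub>C (x - y) = a *\<^sub>C x - a *\<^sub>C (y::'h::complex_hilbert)"
  by (simp only: diff_conv_add_uminus scaleC_add_right scaleC_minus_right)

lemma scaleC_sum_right: "a *\<^sub>C (\<Sum>i\<in>I. f i) = (\<Sum>i\<in>I. a *\<^sub>C (f i :: 'h::complex_hilbert))"
  by (induction I rule: infinite_finite_induct) (auto simp: scaleC_add_right)

lemma cinner_add_right: "cinner x (y + z) = cinner x y + cinner x (z::'h::complex_hilbert)"
  by (subst (1 2 3) cinner_commute) (simp add: cinner_add_left)

lemma cinner_scaleC_right: "cinner x (a *\<^sub>C y) = cnj a * cinner x (y::'h::complex_hilbert)"
  by (subst (1 2) cinner_commute) (simp add: cinner_scaleC_left)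

lemma cinner_0_left [simp]: "cinner 0 (x::'h::complex_hilbert) = 0"
  using cinner_scaleC_left[of 0 0 x] by simp

lemma cinner_0_right [simp]: "cinner (x::'h::complex_hilbert) 0 = 0"
  using cinner_scaleC_right[of x 0 0] by simp

lemma cinner_minus_left: "cinner (- x) y = - cinner x (y::'h::complex_hilbert)"
  by (simp add: eq_neg_iff_add_eq_0 flip: cinner_add_left)

lemma cinner_minus_right: "cinner x (- y) = - cinner x (y::'h::complex_hilbert)"
  by (simp add: eq_neg_iff_add_eq_0 flip: cinner_add_right)

lemma cinner_diff_left: "cinner (x - y) z = cinner x z - cinner y (z::'h::complex_hilbert)"
  by (simp only: diff_conv_add_uminus cinner_add_left cinner_minus_left)

lemma cinner_diff_right: "cinner x (y - z) = cinner x y - cinner x (z::'h::complex_hilbert)"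
  by (simp only: diff_conv_add_uminus cinner_add_right cinner_minus_right)

lemma cinner_scaleR_left: "cinner (t *\<^sub>R x) y = complex_of_real t * cinner x (y::'h::complex_hilbert)"
  by (simp add: scaleR_scaleC cinner_scaleC_left)

lemma cinner_scaleR_right: "cinner x (t *\<^sub>R y) = complex_of_real t * cinner x (y::'h::complex_hilbert)"
  by (simp add: scaleR_scaleC cinner_scaleC_right)

lemma cinner_sum_left: "cinner (\<Sum>i\<in>I. f i) y = (\<Sum>i\<in>I. cinner (f i) (y::'h::complex_hilbert))"
  by (induction I rule: infinite_finite_induct) (auto simp: cinner_add_left)

lemma cinner_sum_right: "cinner x (\<Sum>i\<in>I. f i) = (\<Sum>i\<in>I. cinner x (f i ::'h::complex_hilbert))"
  by (induction I rule: infinite_finite_induct) (auto simp: cinner_add_right)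

lemmas cinner_simps = cinner_add_left cinner_add_right cinner_diff_left cinner_diff_right
  cinner_minus_left cinner_minus_right cinner_scaleC_left cinner_scaleC_right
  cinner_scaleR_left cinner_scaleR_right

lemma Re_cinner_self: "Re (cinner x x) = (norm (x::'h::complex_hilbert))\<^sup>2"
  by (simp add: cinner_norm)

lemma norm_scaleC [simp]: "norm (a *\<^sub>C x) = cmod a * norm (x::'h::complex_hilbert)"
proof -
  have "complex_of_real ((norm (a *\<^sub>C x))\<^sup>2) = cinner (a *\<^sub>C x) (a *\<^sub>C x)"
    by (simp only: cinner_norm)
  also have "\<dots> = (a * cnj a) * cinner x x"
    by (simp add: cinner_scaleC_left cinner_scaleC_right)
  also have "\<dots> = complex_of_real ((cmod a * norm x)\<^sup>2)"
    by (simp add: cinner_norm power_mult_distrib flip: complex_norm_square)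
  finally have "(norm (a *\<^sub>C x))\<^sup>2 = (cmod a * norm x)\<^sup>2"
    by (simp only: of_real_eq_iff)
  then show ?thesis
    by (simp add: power2_eq_iff_nonneg)
qed

lemma norm_add_square:
  "(norm (x + y))\<^sup>2 = (norm x)\<^sup>2 + (norm (y::'h::complex_hilbert))\<^sup>2 + 2 * Re (cinner x y)"
proof -
  have "Re (cinner y x) = Re (cinner x y)"
    using arg_cong[OF cinner_commute[of y x], of Re] by simp
  then show ?thesis
    unfolding Re_cinner_self[symmetric] by (simp add: cinner_simps)
qed

lemma norm_diff_square:
  "(norm (x - y))\<^sup>2 = (norm x)\<^sup>2 + (norm (y::'h::complex_hilbert))\<^sup>2 - 2 * Re (cinner x y)"
  using norm_add_square[of x "- y"] by (simp add: cinner_minus_right)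

text \<open>Cauchy-Schwarz, by expanding the square of \<open>t *\<^sub>R x - a *\<^sub>C y\<close>,
  a multiple of the projection residue of \<open>x\<close> along \<open>y\<close> that needs no
  division.\<close>

lemma cmod_cinner_le: "cmod (cinner x y) \<le> norm x * norm (y::'h::complex_hilbert)"
proof (cases "y = 0")
  case False
  define a where "a = cinner x y"
  define t where "t = (norm y)\<^sup>2"
  have t: "t > 0"
    using False by (simp add: t_def)
  have "0 \<le> (norm (t *\<^sub>R x - a *\<^sub>C y))\<^sup>2"
    by simp
  also have "\<dots> = t\<^sup>2 * (norm x)\<^sup>2 + (cmod a)\<^sup>2 * t - 2 * (t * (cmod a)\<^sup>2)"
    by (simp add: norm_diff_square cinner_simps power_mult_distrib t_def
        cmod_power2 a_def[symmetric]) (simp add: power2_eq_square algebra_simps)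
  also have "\<dots> = t * (t * (norm x)\<^sup>2 - (cmod a)\<^sup>2)"
    by (simp add: algebra_simps power2_eq_square)
  finally have "(cmod a)\<^sup>2 \<le> (norm x * norm y)\<^sup>2"
    using t by (simp add: zero_le_mult_iff t_def power_mult_distrib mult.commute)
  then show ?thesis
    by (simp add: a_def power_mono_iff)
qed simp

section \<open>Closed subspaces and the Riesz representation\<close>

locale hilbert_space =
  fixes H :: "'h::complex_hilbert set"
  assumes hilbert_subspace: "hilbert_subspace H"
begin

lemma closed_carrier: "closed H"
  and zero_mem [simp]: "0 \<in> H"
  and add_mem: "x \<in> H \<Longrightarrow> y \<in> H \<Longrightarrow> x + y \<in> H"
  and scaleC_mem: "x \<in> H \<Longrightarrow> a *\<^sub>C x \<in> H"
  using hilbert_subspace by (auto simp: hilbert_subspace_def)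

lemma scaleR_mem: "x \<in> H \<Longrightarrow> t *\<^sub>R x \<in> H"
  by (simp add: scaleR_scaleC scaleC_mem)

lemma minus_mem: "x \<in> H \<Longrightarrow> - x \<in> H"
  using scaleC_mem[of x "-1"] by simp

lemma diff_mem: "x \<in> H \<Longrightarrow> y \<in> H \<Longrightarrow> x - y \<in> H"
  using add_mem[of x "- y"] minus_mem by simp

lemma sum_mem: "(\<And>i. i \<in> I \<Longrightarrow> f i \<in> H) \<Longrightarrow> (\<Sum>i\<in>I. f i) \<in> H"
  by (induction I rule: infinite_finite_induct) (auto intro: add_mem)

lemmas mem_intros = zero_mem add_mem scaleC_mem scaleR_mem minus_mem diff_mem sum_mem

lemma complete_carrier: "complete H"
  using closed_carrier by (simp add: complete_eq_closed)

lemma eq_if_cinner_eq: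
  assumes "y \<in> H" "z \<in> H" "\<And>x. x \<in> H \<Longrightarrow> cinner x y = cinner x z"
  shows "y = z"
proof -
  have "cinner (y - z) (y - z) = 0"
    using assms(3)[OF diff_mem[OF assms(1,2)]] by (simp add: cinner_diff_right)
  then show ?thesis
    by (simp add: cinner_norm)
qed

text \<open>The representing vector minimises \<open>\<parallel>x\<parallel>\<^sup>2 - 2 Re (\<phi> x)\<close> over \<open>H\<close>; minimising sequences
  are Cauchy by the parallelogram law.\<close>

lemma riesz_representation:
  assumes add: "\<And>x y. x \<in> H \<Longrightarrow> y \<in> H \<Longrightarrow> \<phi> (x + y) = \<phi> x + \<phi> y"
    and scale: "\<And>a x. x \<in> H \<Longrightarrow> \<phi> (a *\<^sub>C x) = a * \<phi> x"
    and bound: "\<And>x. x \<in> H \<Longrightarrow> cmod (\<phi> x) \<le> K * norm x"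
  shows "\<exists>z\<in>H. \<forall>x\<in>H. \<phi> x = cinner x z"
proof -
  define J where "J = (\<lambda>x. (norm x)\<^sup>2 - 2 * Re (\<phi> x))"
  have diff: "\<phi> (x - y) = \<phi> x - \<phi> y" if "x \<in> H" "y \<in> H" for x y
    using add[of x "(-1) *\<^sub>C y"] scale[of y "-1"] that scaleC_mem[of y "-1"] by simp
  have scaleR: "\<phi> (t *\<^sub>R x) = complex_of_real t * \<phi> x" if "x \<in> H" for t x
    using scale[OF that] by (simp add: scaleR_scaleC)
  have J_lower: "- K\<^sup>2 \<le> J x" if "x \<in> H" for x
  proof -
    have "Re (\<phi> x) \<le> K * norm x"
      using bound[OF that] complex_Re_le_cmod[of "\<phi> x"] by linarith
    moreover have "0 \<le> (norm x - K)\<^sup>2"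
      by simp
    ultimately show ?thesis
      by (simp add: J_def power2_eq_square algebra_simps)
  qed
  define m where "m = (INF x\<in>H. J x)"
  have bdd: "bdd_below (J ` H)"
    using J_lower by (auto intro!: bdd_belowI[of _ "- K\<^sup>2"])
  have m_le: "m \<le> J x" if "x \<in> H" for x
    unfolding m_def using bdd that by (rule cINF_lower)
  have "\<exists>x\<in>H. J x < m + 1 / real (Suc n)" for n
  proof -
    have "(INF x\<in>H. J x) < m + 1 / real (Suc n)"
      by (simp add: m_def)
    then show ?thesis
      using cINF_less_iff[of H J "m + 1 / real (Suc n)"] bdd zero_mem by blast
  qed
  then obtain X where X: "\<And>n. X n \<in> H" "\<And>n. J (X n) < m + 1 / real (Suc n)"
    by metis
  have dist_le: "(norm (x - y))\<^sup>2 \<le> 2 * (J x - m) + 2 * (J y - m)" if "x \<in> H" "y \<in> H" for x y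
  proof -
    have "(norm ((1/2) *\<^sub>R (x + y)))\<^sup>2 = (norm (x + y))\<^sup>2 / 4"
      by (simp add: power_divide)
    moreover have "Re (\<phi> ((1/2) *\<^sub>R (x + y))) = (Re (\<phi> x) + Re (\<phi> y)) / 2"
      by (simp only: scaleR[OF add_mem[OF that]] add[OF that] Re_complex_of_real mult.commute
          plus_complex.sel(1) of_real_divide) (simp add: add_divide_distrib)
    ultimately have "J ((1/2) *\<^sub>R (x + y)) = (norm (x + y))\<^sup>2 / 4 - (Re (\<phi> x) + Re (\<phi> y))"
      unfolding J_def by (simp only:) argo
    moreover have "m \<le> J ((1/2) *\<^sub>R (x + y))"
      using that by (intro m_le mem_intros)
    ultimately show ?thesis
      using J_def norm_add_square[of x y] norm_diff_square[of x y] by simp argo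
  qed
  have "Cauchy X"
  proof (rule metric_CauchyI)
    fix e :: real assume "0 < e"
    then obtain N where N: "4 / e\<^sup>2 < real N"
      using reals_Archimedean2 by blast
    have "dist (X i) (X j) < e" if "i \<ge> N" "j \<ge> N" for i j
    proof -
      have bnd: "J (X i) - m < e\<^sup>2 / 4" if "i \<ge> N" for i
      proof -
        have "4 / e\<^sup>2 < real (Suc i)"
          using N that by simp
        then have "1 / real (Suc i) < e\<^sup>2 / 4"
          using \<open>0 < e\<close> by (simp add: field_simps)
        then show ?thesis
          using X(2)[of i] by linarith
      qed
      have "(norm (X i - X j))\<^sup>2 < e\<^sup>2"
        using dist_le[OF X(1) X(1), of i j] bnd[OF that(1)] bnd[OF that(2)] by argo
      then show ?thesis
        using \<open>0 < e\<close> by (simp add: dist_norm power_less_imp_less_base)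
    qed
    then show "\<exists>M. \<forall>m\<ge>M. \<forall>n\<ge>M. dist (X m) (X n) < e"
      by blast
  qed
  then obtain z where z: "z \<in> H" "X \<longlonglongrightarrow> z"
    using complete_carrier X(1) unfolding complete_def by blast
  have "(\<lambda>n. \<phi> (X n) - \<phi> z) \<longlonglongrightarrow> 0"
  proof (rule Lim_null_comparison)
    show "\<forall>\<^sub>F n in sequentially. norm (\<phi> (X n) - \<phi> z) \<le> K * norm (X n - z)"
      using bound[OF diff_mem[OF X(1) z(1)]] by (simp add: diff[OF X(1) z(1)])
    show "(\<lambda>n. K * norm (X n - z)) \<longlonglongrightarrow> 0"
      using tendsto_mult_right_zero[OF tendsto_norm_zero[OF LIM_zero[OF z(2)]]] .
  qed
  then have "(\<lambda>n. \<phi> (X n)) \<longlonglongrightarrow> \<phi> z"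
    by (rule LIM_zero_cancel)
  then have "(\<lambda>n. J (X n)) \<longlonglongrightarrow> J z"
    unfolding J_def by (intro tendsto_intros z(2))
  moreover have "(\<lambda>n. m + 1 / real (Suc n)) \<longlonglongrightarrow> m + 0"
    by (intro tendsto_intros LIMSEQ_Suc[OF lim_1_over_n])
  ultimately have "J z \<le> m + 0"
    by (rule LIMSEQ_le) (intro exI allI impI less_imp_le[OF X(2)])
  have Re_eq: "Re (\<phi> h) = Re (cinner h z)" if h: "h \<in> H" for h
  proof -
    define d where "d = Re (cinner h z) - Re (\<phi> h)"
    \<comment> \<open>First variation at the minimiser along the line through \<open>z\<close> in
      direction \<open>h\<close>: a quadratic in \<open>t\<close> without constant term is
      nonnegative everywhere only if its linear coefficient vanishes. The value of \<open>t\<close>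
      chosen below is its minimiser.\<close>
    have nonneg: "0 \<le> t\<^sup>2 * (norm h)\<^sup>2 + 2 * t * d" for t
    proof -
      have "J z \<le> J (z + t *\<^sub>R h)"
        using \<open>J z \<le> m + 0\<close> m_le[of "z + t *\<^sub>R h"] z(1) h by (simp add: mem_intros)
      moreover have "Re (cinner z h) = Re (cinner h z)"
        using arg_cong[OF cinner_commute[of z h], of Re] by simp
      ultimately show ?thesis
        using z(1) h by (simp add: J_def norm_add_square add scaleR mem_intros d_def cinner_simps
            power_mult_distrib algebra_simps)
    qed
    have "d = 0"
    proof (cases "h = 0")
      case False
      define t where "t = - d / (norm h)\<^sup>2"
      have "t\<^sup>2 * (norm h)\<^sup>2 + 2 * t * d = - (d\<^sup>2 / (norm h)\<^sup>2)"
        using False by (simp add: t_def power2_eq_square field_simps)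
      then have "d\<^sup>2 / (norm h)\<^sup>2 \<le> 0"
        using nonneg[of t] by linarith
      then show ?thesis
        using False by (simp add: divide_le_0_iff)
    next
      case True
      then have "d \<le> 0" "- d \<le> 0"
        using nonneg[of "-1"] nonneg[of 1] by simp_all
      then show ?thesis by simp
    qed
    then show ?thesis by (simp add: d_def)
  qed
  have "\<phi> x = cinner x z" if "x \<in> H" for x
  proof (rule complex_eqI)
    show "Re (\<phi> x) = Re (cinner x z)"
      by (rule Re_eq[OF that])
    show "Im (\<phi> x) = Im (cinner x z)"
      using Re_eq[OF scaleC_mem[OF that, of "\<i>"]] that by (simp add: scale cinner_simps)
  qed
  then show ?thesis
    using z(1) by blast
qed

end

section \<open>Bounded operators, adjoints and powers\<close>

locale hilbert_operator =
  fixes H :: "'h::complex_hilbert set" and T :: "'h \<Rightarrow> 'h"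
  assumes operator_on: "operator_on H T"

sublocale hilbert_operator \<subseteq> hilbert_space H
  using operator_on by unfold_locales (simp add: operator_on_def)

context hilbert_operator
begin

lemma op_mem [simp]: "x \<in> H \<Longrightarrow> T x \<in> H"
  and op_add: "x \<in> H \<Longrightarrow> y \<in> H \<Longrightarrow> T (x + y) = T x + T y"
  and op_scaleC: "x \<in> H \<Longrightarrow> T (a *\<^sub>C x) = a *\<^sub>C T x"
  and op_bounded: "\<exists>K. \<forall>x\<in>H. norm (T x) \<le> K * norm x"
  using operator_on by (auto simp: operator_on_def)

lemma op_zero [simp]: "T 0 = 0"
  using op_scaleC[of 0 0] by simp

lemma op_scaleR: "x \<in> H \<Longrightarrow> T (t *\<^sub>R x) = t *\<^sub>R T x"
  by (simp add: scaleR_scaleC op_scaleC)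

lemma op_minus: "x \<in> H \<Longrightarrow> T (- x) = - T x"
  using op_scaleC[of x "-1"] by simp

lemma op_diff: "x \<in> H \<Longrightarrow> y \<in> H \<Longrightarrow> T (x - y) = T x - T y"
  using op_add[of x "- y"] by (simp add: op_minus minus_mem)

lemma op_sum: "(\<And>i. i \<in> I \<Longrightarrow> f i \<in> H) \<Longrightarrow> T (\<Sum>i\<in>I. f i) = (\<Sum>i\<in>I. T (f i))"
  by (induction I rule: infinite_finite_induct) (auto simp: op_add sum_mem)

lemma adj_exists: "y \<in> H \<Longrightarrow> \<exists>z\<in>H. \<forall>x\<in>H. cinner (T x) y = cinner x z"
proof -
  assume y: "y \<in> H"
  obtain K where K: "\<And>x. x \<in> H \<Longrightarrow> norm (T x) \<le> K * norm x"
    using op_bounded by blast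
  show ?thesis
  proof (rule riesz_representation)
    show "cmod (cinner (T x) y) \<le> (K * norm y) * norm x" if "x \<in> H" for x
      using cmod_cinner_le[of "T x" y] mult_right_mono[OF K[OF that] norm_ge_zero[of y]]
      by (simp add: mult_ac)
  qed (simp_all add: op_add op_scaleC cinner_simps)
qed

lemma adj_on_eqI:
  assumes "z \<in> H" "\<And>x. x \<in> H \<Longrightarrow> cinner (T x) y = cinner x z"
  shows "adj_on H T y = z"
  unfolding adj_on_def
proof (rule the_equality)
  fix z' assume "z' \<in> H \<and> (\<forall>x\<in>H. cinner (T x) y = cinner x z')"
  then show "z' = z"
    using assms by (intro eq_if_cinner_eq) auto
qed (use assms in blast)

lemma adj_on_mem [simp]: "y \<in> H \<Longrightarrow> adj_on H T y \<in> H"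
  using adj_exists[of y] by (auto simp: adj_on_eqI)

lemma cinner_adj_on: "x \<in> H \<Longrightarrow> y \<in> H \<Longrightarrow> cinner (T x) y = cinner x (adj_on H T y)"
  using adj_exists[of y] by (auto simp: adj_on_eqI)

lemma cinner_adj_on': "x \<in> H \<Longrightarrow> y \<in> H \<Longrightarrow> cinner (adj_on H T x) y = cinner x (T y)"
  using cinner_adj_on[of y x] cinner_commute[of x "T y"] cinner_commute[of "adj_on H T x" y] by simp

lemma operator_on_adj: "operator_on H (adj_on H T)"
proof -
  obtain K where K: "\<And>x. x \<in> H \<Longrightarrow> norm (T x) \<le> K * norm x"
    using op_bounded by blast
  have "norm (adj_on H T y) \<le> \<bar>K\<bar> * norm y" if y: "y \<in> H" for y
  proof (cases "adj_on H T y = 0")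
    case False
    let ?z = "adj_on H T y"
    \<comment> \<open>Testing the adjoint relation at \<open>?z\<close> itself; one factor
      \<open>norm ?z\<close> cancels at the end.\<close>
    have "(norm ?z)\<^sup>2 = Re (cinner (T ?z) y)"
      using y by (simp add: cinner_adj_on Re_cinner_self)
    also have "\<dots> \<le> norm (T ?z) * norm y"
      using cmod_cinner_le[of "T ?z" y] complex_Re_le_cmod[of "cinner (T ?z) y"] by linarith
    also have "\<dots> \<le> (\<bar>K\<bar> * norm ?z) * norm y"
      using K[of ?z] y mult_right_mono[OF abs_ge_self[of K] norm_ge_zero[of ?z]]
      by (intro mult_right_mono) (auto elim!: order_trans)
    finally show ?thesis
      using False by (simp add: power2_eq_square)
  qed simp
  moreover have "adj_on H T (x + y) = adj_on H T x + adj_on H T y" if "x \<in> H" "y \<in> H" for x y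
    using that by (intro adj_on_eqI) (simp_all add: mem_intros cinner_add_right cinner_adj_on)
  moreover have "adj_on H T (a *\<^sub>C x) = a *\<^sub>C adj_on H T x" if "x \<in> H" for a x
    using that by (intro adj_on_eqI) (simp_all add: mem_intros cinner_scaleC_right cinner_adj_on)
  ultimately show ?thesis
    unfolding operator_on_def using hilbert_subspace by auto
qed

lemma funpow_mem [simp]: "x \<in> H \<Longrightarrow> (T ^^ n) x \<in> H"
  by (induction n) auto

lemma funpow_zero [simp]: "(T ^^ n) 0 = 0"
  by (induction n) auto

lemma funpow_op_add: "x \<in> H \<Longrightarrow> y \<in> H \<Longrightarrow> (T ^^ n) (x + y) = (T ^^ n) x + (T ^^ n) y"
  by (induction n) (auto simp: op_add)

lemma funpow_scaleC: "x \<in> H \<Longrightarrow> (T ^^ n) (a *\<^sub>C x) = a *\<^sub>C (T ^^ n) x"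
  by (induction n) (auto simp: op_scaleC)

end

section \<open>Polynomials of an operator and von Neumann's inequality\<close>

definition poly_op :: "complex poly \<Rightarrow> ('h::complex_hilbert \<Rightarrow> 'h) \<Rightarrow> 'h \<Rightarrow> 'h" where
  "poly_op P T x = (\<Sum>i\<le>degree P. coeff P i *\<^sub>C (T ^^ i) x)"

text \<open>Padding to a common length allows polynomials of different degrees to be added and
  compared termwise.\<close>

lemma poly_op_eq_sum:
  assumes "degree P \<le> n"
  shows "poly_op P T x = (\<Sum>i\<le>n. coeff P i *\<^sub>C (T ^^ i) x)"
  unfolding poly_op_def
  by (rule sum.mono_neutral_left) (use assms in \<open>auto simp: coeff_eq_0\<close>)

lemma poly_op_0 [simp]: "poly_op 0 T x = 0"
  by (simp add: poly_op_def)

lemma poly_op_add: "poly_op (P + Q) T x = poly_op P T x + poly_op Q T x"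
  using degree_add_le_max[of P Q]
  by (simp add: poly_op_eq_sum[of _ "max (degree P) (degree Q)"] scaleC_add_left sum.distrib)

lemma poly_op_smult: "poly_op (smult a P) T x = a *\<^sub>C poly_op P T x"
  by (simp add: poly_op_eq_sum[OF degree_smult_le] poly_op_def scaleC_sum_right scaleC_scaleC)

lemma poly_op_diff: "poly_op (P - Q) T x = poly_op P T x - poly_op Q T x"
  using poly_op_add[of P "- Q" T x] poly_op_smult[of "-1" Q T x] by simp

lemma poly_op_1 [simp]: "poly_op 1 T x = x"
  by (simp add: poly_op_def)

context hilbert_operator
begin

lemma poly_op_mem [simp]: "x \<in> H \<Longrightarrow> poly_op P T x \<in> H"
  by (auto simp: poly_op_def intro!: sum_mem scaleC_mem)

lemma poly_op_pCons:
  assumes "x \<in> H"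
  shows "poly_op (pCons a P) T x = a *\<^sub>C x + T (poly_op P T x)"
proof -
  have "poly_op (pCons a P) T x = (\<Sum>i\<le>Suc (degree P). coeff (pCons a P) i *\<^sub>C (T ^^ i) x)"
    by (rule poly_op_eq_sum) (rule degree_pCons_le)
  also have "\<dots> = a *\<^sub>C x + (\<Sum>i\<le>degree P. coeff P i *\<^sub>C T ((T ^^ i) x))"
    by (subst sum.atMost_Suc_shift) simp
  also have "(\<Sum>i\<le>degree P. coeff P i *\<^sub>C T ((T ^^ i) x)) = T (poly_op P T x)"
    using assms unfolding poly_op_def by (subst op_sum) (auto simp: op_scaleC scaleC_mem)
  finally show ?thesis .
qed

lemma poly_op_add_arg: "x \<in> H \<Longrightarrow> y \<in> H \<Longrightarrow> poly_op P T (x + y) = poly_op P T x + poly_op P T y"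
  by (simp add: poly_op_def funpow_op_add scaleC_add_right sum.distrib)

lemma poly_op_scaleC_arg: "x \<in> H \<Longrightarrow> poly_op P T (a *\<^sub>C x) = a *\<^sub>C poly_op P T x"
  by (simp add: poly_op_def funpow_scaleC scaleC_sum_right scaleC_scaleC mult.commute)

lemma poly_op_mult: "x \<in> H \<Longrightarrow> poly_op (P * Q) T x = poly_op P T (poly_op Q T x)"
proof (induction P arbitrary: x rule: pCons_induct)
  case (pCons a P)
  then show ?case
    by (simp add: poly_op_add poly_op_smult poly_op_pCons)
qed simp

lemma poly_op_mult': "x \<in> H \<Longrightarrow> poly_op (P * Q) T x = poly_op Q T (poly_op P T x)"
  by (metis mult.commute poly_op_mult)

lemma poly_op_monom_1: "x \<in> H \<Longrightarrow> poly_op (monom 1 n) T x = (T ^^ n) x"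
  by (induction n) (simp_all add: monom_Suc poly_op_pCons flip: one_pCons)

end

text \<open>Discrete Fourier orthogonality, the substitute for integration over the circle. The
  terms are powers of the L-th root of unity \<open>w\<close>, and |m - i| < L excludes
  \<open>w = 1\<close> unless m = i, so the geometric sum vanishes.\<close>

lemma sum_root_of_unity_powers:
  fixes L m i :: nat
  assumes "0 < L" "m < L" "i < L"
  shows "(\<Sum>k<L. cis (2 * pi * real k / real L) ^ m * cnj (cis (2 * pi * real k / real L)) ^ i)
           = (if m = i then of_nat L else 0)"
proof (cases "m = i")
  case True
  then show ?thesis
    by (simp add: cis_cnj cis_mult flip: power_mult_distrib)
next
  case False
  define w where "w = cis (2 * pi * (real m - real i) / real L)"
  have "cis (2 * pi * real k / real L) ^ m * cnj (cis (2 * pi * real k / real L)) ^ i = w ^ k" for k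
  proof -
    have "cis (2 * pi * real k / real L) ^ m * cnj (cis (2 * pi * real k / real L)) ^ i
        = cis (real m * (2 * pi * real k / real L) + real i * (- (2 * pi * real k / real L)))"
      by (simp add: cis_cnj Complex.DeMoivre cis_mult)
    also have "\<dots> = w ^ k"
      unfolding w_def Complex.DeMoivre using assms(1) by (intro arg_cong[of _ _ cis]) (simp add: field_simps)
    finally show ?thesis .
  qed
  moreover have "w \<noteq> 1"
  proof
    assume "w = 1"
    then have "cos (2 * pi * (real m - real i) / real L) = 1"
      by (simp add: w_def cis.ctr complex_eq_iff)
    then obtain n :: int where "2 * pi * (real m - real i) / real L = real_of_int n * 2 * pi"
      using cos_one_2pi_int by blast
    then have "(2 * pi) * (real m - real i) = (2 * pi) * (real_of_int n * real L)"
      using assms(1) by (simp add: divide_simps mult_ac)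
    then have "real m - real i = real_of_int n * real L"
      by (subst (asm) mult_left_cancel) auto
    then have "real_of_int (int m - int i) = real_of_int (n * int L)"
      by simp
    then have "int m - int i = n * int L"
      by (simp only: of_int_eq_iff)
    moreover have "\<bar>int m - int i\<bar> < int L"
      using assms by auto
    ultimately have "\<bar>n\<bar> * int L < 1 * int L"
      by (simp add: abs_mult)
    then have "n = 0"
      using assms(1) by (subst (asm) mult_less_cancel_right) auto
    then show False
      using \<open>int m - int i = n * int L\<close> False by simp
  qed
  moreover have "w ^ L = 1"
  proof -
    have "w ^ L = cis (2 * pi * real_of_int (int m - int i))"
      unfolding w_def Complex.DeMoivre using assms(1) by (intro arg_cong[of _ _ cis]) (simp add: field_simps)
    also have "\<dots> = 1"
      by (rule cis_multiple_2pi) simp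
    finally show ?thesis .
  qed
  ultimately show ?thesis
    using False by (simp add: sum_gp_strict)
qed

lemma sum_root_of_unity_powers_pos:
  fixes L m :: nat
  assumes "0 < m" "m < L"
  shows "(\<Sum>k<L. cnj (cis (2 * pi * real k / real L)) ^ m) = 0"
  using sum_root_of_unity_powers[of L 0 m] assms by simp

section \<open>The Fejer kernel of a contraction\<close>

locale hilbert_contraction = hilbert_operator +
  assumes contraction: "x \<in> H \<Longrightarrow> norm (T x) \<le> norm x"
begin

text \<open>N times the Cesaro mean of the operator-valued Fourier series with coefficients T^m for
  m >= 0 and powers of the adjoint for m < 0. As a sesquilinear form it gets by without the
  adjoint.\<close>

definition fejer :: "nat \<Rightarrow> complex \<Rightarrow> 'a \<Rightarrow> 'a \<Rightarrow> complex" where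
  "fejer N c x y = (\<Sum>n<N. cinner x y
     + (\<Sum>m=1..n. c ^ m * cinner ((T ^^ m) x) y + cnj c ^ m * cinner x ((T ^^ m) y)))"

text \<open>With \<open>g\<^sub>n = \<Sum>m\<le>n. c\<^sup>m T\<^sup>m x\<close> one has \<open>g\<^sub>n = x + c T g\<^sub>n\<^sub>-\<^sub>1\<close>, so the \<open>n\<close>-th
  summand is \<open>\<parallel>g\<^sub>n\<parallel>\<^sup>2 - \<parallel>T g\<^sub>n\<^sub>-\<^sub>1\<parallel>\<^sup>2\<close> and the sum telescopes up to nonnegative terms.\<close>

lemma fejer_nonneg:
  assumes c: "cmod c = 1" and x: "x \<in> H"
  shows "0 \<le> Re (fejer N c x x)"
proof -
  define g where "g = (\<lambda>n. \<Sum>m\<le>n. c ^ m *\<^sub>C (T ^^ m) x)"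
  have g_mem: "g n \<in> H" for n
    using x by (auto simp: g_def intro!: mem_intros)
  have g_Suc: "g (Suc n) = x + c *\<^sub>C T (g n)" for n
  proof -
    have "g (Suc n) = x + (\<Sum>m\<le>n. c ^ Suc m *\<^sub>C T ((T ^^ m) x))"
      unfolding g_def by (subst sum.atMost_Suc_shift) simp
    then show ?thesis
      using x by (simp add: g_def op_sum scaleC_mem op_scaleC scaleC_sum_right scaleC_scaleC)
  qed
  define a where "a = (\<lambda>n. Re (cinner x x
     + (\<Sum>m=1..n. c ^ m * cinner ((T ^^ m) x) x + cnj c ^ m * cinner x ((T ^^ m) x))))"
  have sum_eq: "(\<Sum>m=1..n. c ^ m * cinner ((T ^^ m) x) x) = cinner (g n - x) x" for n
  proof -
    have "g n = x + (\<Sum>m=1..n. c ^ m *\<^sub>C (T ^^ m) x)"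
      unfolding g_def by (simp add: atMost_atLeast0 sum.atLeast_Suc_atMost)
    then show ?thesis
      by (simp add: cinner_sum_left cinner_scaleC_left)
  qed
  have a_eq: "a n = (norm x)\<^sup>2 + 2 * Re (cinner (g n - x) x)" for n
  proof -
    have "(\<Sum>m=1..n. cnj c ^ m * cinner x ((T ^^ m) x)) = cnj (\<Sum>m=1..n. c ^ m * cinner ((T ^^ m) x) x)"
      by (simp add: cinner_commute[of x])
    then show ?thesis
      unfolding a_def sum.distrib sum_eq plus_complex.sel(1) Re_cinner_self by simp
  qed
  have a_Suc: "a (Suc n) = (norm (g (Suc n)))\<^sup>2 - (norm (T (g n)))\<^sup>2" for n
  proof -
    have "g (Suc n) = c *\<^sub>C T (g n) + x"
      by (simp add: g_Suc)
    then have "(norm (g (Suc n)))\<^sup>2 = (norm (T (g n)))\<^sup>2 + (norm x)\<^sup>2 + 2 * Re (cinner (g (Suc n) - x) x)"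
      by (simp add: norm_add_square c)
    then show ?thesis
      by (simp add: a_eq)
  qed
  have partial_sums: "(norm (g N))\<^sup>2 \<le> (\<Sum>n<Suc N. a n)" for N
  proof (induction N)
    case 0
    then show ?case by (simp add: a_eq g_def)
  next
    case (Suc N)
    moreover have "(norm (T (g N)))\<^sup>2 \<le> (norm (g N))\<^sup>2"
      by (simp add: contraction g_mem power_mono)
    ultimately show ?case
      using a_Suc[of N] unfolding sum.lessThan_Suc by linarith
  qed
  have "0 \<le> (\<Sum>n<N. a n)"
  proof (cases N)
    case (Suc N')
    then show ?thesis
      using order_trans[OF zero_le_power2 partial_sums[of N']] by simp
  qed simp
  then show ?thesis
    by (simp add: fejer_def a_def)
qed

lemma fejer_add_scaleC:
  assumes "x \<in> H" "y \<in> H"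
  shows "fejer N c (x + a *\<^sub>C y) (x + a *\<^sub>C y)
    = fejer N c x x + a * cnj a * fejer N c y y + cnj a * fejer N c x y + a * fejer N c y x"
  using assms by (simp add: fejer_def funpow_op_add funpow_scaleC scaleC_mem cinner_simps
      sum_distrib_left sum.distrib algebra_simps)

lemma fejer_commute: "fejer N c y x = cnj (fejer N c x y)"
  unfolding fejer_def cnj_sum complex_cnj_add complex_cnj_mult complex_cnj_power
    cinner_commute[symmetric] by (simp add: add.commute)

text \<open>Cauchy-Schwarz for a nonnegative form, with the arithmetic in place of the geometric
  mean: this version is additive and survives summation over the roots of unity. The phase
  \<open>a\<close> is chosen to make both cross terms equal to minus the modulus.\<close>

lemma cmod_fejer_le:
  assumes c: "cmod c = 1" and x: "x \<in> H" and y: "y \<in> H"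
  shows "cmod (fejer N c x y) \<le> Re (fejer N c x x + fejer N c y y) / 2"
proof -
  obtain a where a: "cmod a = 1" "cnj a * fejer N c x y = - complex_of_real (cmod (fejer N c x y))"
  proof (cases "fejer N c x y = 0")
    case False
    define a where "a = - sgn (fejer N c x y)"
    have "cmod a = 1"
      using False by (simp add: a_def norm_sgn)
    moreover have "cnj a * fejer N c x y = - complex_of_real (cmod (fejer N c x y))"
      using False by (simp add: a_def sgn_eq mult.commute flip: complex_norm_square)
        (simp add: power2_eq_square)
    ultimately show ?thesis using that by blast
  qed (use that[of 1] in simp)
  have "a * fejer N c y x = cnj (cnj a * fejer N c x y)"
    by (simp add: fejer_commute[of N c y x])
  then have "a * fejer N c y x = - complex_of_real (cmod (fejer N c x y))"
    using a(2) by simp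
  moreover have "a * cnj a = 1"
    using a(1) by (simp flip: complex_norm_square)
  ultimately have "Re (fejer N c (x + a *\<^sub>C y) (x + a *\<^sub>C y))
      = Re (fejer N c x x + fejer N c y y) - 2 * cmod (fejer N c x y)"
    by (simp add: fejer_add_scaleC[OF x y] a(2))
  moreover have "0 \<le> Re (fejer N c (x + a *\<^sub>C y) (x + a *\<^sub>C y))"
    using x y by (intro fejer_nonneg c mem_intros)
  ultimately show ?thesis by simp
qed

text \<open>Averaging extracts the coefficient of index i. The condition
  \<open>i + N \<le> L\<close> prevents aliasing: the frequencies i + m with 1 <= m < N coming from
  the adjoint half stay below L and average to zero.\<close>

lemma sum_fejer:
  assumes "i < L" "i + N \<le> L"
  defines "u \<equiv> \<lambda>k. cis (2 * pi * real k / real L)"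
  shows "(\<Sum>k<L. cnj (u k) ^ i * fejer N (u k) x y)
    = of_nat L * (\<Sum>n<N. if i \<le> n then cinner ((T ^^ i) x) y else 0)"
proof -
  have "(\<Sum>k<L. cnj (u k) ^ i * fejer N (u k) x y) =
    (\<Sum>n<N. \<Sum>k<L. cnj (u k) ^ i * (cinner x y +
       (\<Sum>m=1..n. u k ^ m * cinner ((T ^^ m) x) y + cnj (u k) ^ m * cinner x ((T ^^ m) y))))"
    unfolding fejer_def sum_distrib_left by (rule sum.swap)
  also have "\<dots> = (\<Sum>n<N. of_nat L * (if i \<le> n then cinner ((T ^^ i) x) y else 0))"
  proof (rule sum.cong)
    fix n assume "n \<in> {..<N}"
    then have n: "n < N" by simp
    have pos: "(\<Sum>k<L. u k ^ m * cnj (u k) ^ i) = (if m = i then of_nat L else 0)" if "m \<le> n" for m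
      unfolding u_def using assms(1,2) that n by (intro sum_root_of_unity_powers) auto
    have neg: "(\<Sum>k<L. cnj (u k) ^ (i + m)) = 0" if "m \<le> n" "1 \<le> m" for m
      unfolding u_def using assms(1,2) that n by (intro sum_root_of_unity_powers_pos) auto
    have "(\<Sum>k<L. cnj (u k) ^ i * (cinner x y +
       (\<Sum>m=1..n. u k ^ m * cinner ((T ^^ m) x) y + cnj (u k) ^ m * cinner x ((T ^^ m) y))))
      = (\<Sum>k<L. u k ^ 0 * cnj (u k) ^ i * cinner x y) +
        (\<Sum>k<L. \<Sum>m=1..n. u k ^ m * cnj (u k) ^ i * cinner ((T ^^ m) x) y
           + cnj (u k) ^ (i + m) * cinner x ((T ^^ m) y))"
      by (simp add: distrib_left sum_distrib_left sum.distrib power_add mult_ac)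
    also have "\<dots> = (\<Sum>k<L. u k ^ 0 * cnj (u k) ^ i) * cinner x y +
        (\<Sum>m=1..n. (\<Sum>k<L. u k ^ m * cnj (u k) ^ i) * cinner ((T ^^ m) x) y
           + (\<Sum>k<L. cnj (u k) ^ (i + m)) * cinner x ((T ^^ m) y))"
      unfolding sum_distrib_right sum.distrib by (subst (1 2) sum.swap[of _ "{..<L}"]) (rule refl)
    also have "\<dots> = (if 0 = i then of_nat L else 0) * cinner x y +
        (\<Sum>m=1..n. (if m = i then of_nat L else 0) * cinner ((T ^^ m) x) y)"
      using pos[of 0] by (intro arg_cong2[of _ _ _ _ "(+)"] sum.cong) (auto simp: pos neg)
    also have "\<dots> = (\<Sum>m=0..n. (if m = i then of_nat L else 0) * cinner ((T ^^ m) x) y)"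
      by (simp add: sum.atLeast_Suc_atMost)
    also have "\<dots> = of_nat L * (if i \<le> n then cinner ((T ^^ i) x) y else 0)"
      by (simp add: if_distrib[of "\<lambda>a. a * _"] cong: if_cong)
    finally show "(\<Sum>k<L. cnj (u k) ^ i * (cinner x y +
       (\<Sum>m=1..n. u k ^ m * cinner ((T ^^ m) x) y + cnj (u k) ^ m * cinner x ((T ^^ m) y))))
       = of_nat L * (if i \<le> n then cinner ((T ^^ i) x) y else 0)" .
  qed simp
  finally show ?thesis
    by (simp add: sum_distrib_left)
qed

text \<open>Averaging \<open>P\<close> against the Fejer kernel gives the sum of the
  \<open>B n\<close>, bounded by M times the average of a nonnegative kernel. Since
  \<open>B n\<close> equals \<open>\<beta>\<close> from the degree on, the sum differs from N times
  \<open>\<beta>\<close> by \<open>C\<close>, which is independent of N; letting N grow removes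
  \<open>C\<close>.\<close>

lemma cmod_cinner_poly_op_le:
  assumes M: "\<And>z. cmod z = 1 \<Longrightarrow> cmod (poly P z) \<le> M" and x: "x \<in> H" and y: "y \<in> H"
  shows "cmod (cinner (poly_op P T x) y) \<le> M * (((norm x)\<^sup>2 + (norm y)\<^sup>2) / 2)"
proof -
  define d where "d = degree P"
  define S where "S = ((norm x)\<^sup>2 + (norm y)\<^sup>2) / 2"
  define \<beta> where "\<beta> = cinner (poly_op P T x) y"
  define B where "B = (\<lambda>n. \<Sum>i\<le>d. coeff P i * (if i \<le> n then cinner ((T ^^ i) x) y else 0))"
  define C where "C = (\<Sum>n<d. B n - \<beta>)"
  have B_eq: "B n = \<beta>" if "d \<le> n" for n
    using that unfolding B_def \<beta>_def poly_op_def d_def[symmetric] cinner_sum_left cinner_scaleC_left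
    by (intro sum.cong) auto
  have bound: "cmod (\<Sum>n<N. B n) \<le> M * (real N * S)" for N
  proof -
    \<comment> \<open>Large enough for \<open>sum_fejer\<close> at every index up to the degree
      \<open>d\<close>.\<close>
    define L where "L = N + d + 1"
    define u where "u = (\<lambda>k. cis (2 * pi * real k / real L))"
    have L: "L > 0" and cmod_u: "cmod (u k) = 1" for k
      by (simp_all add: L_def u_def)
    have self: "(\<Sum>k<L. fejer N (u k) w w) = complex_of_real (real L * (real N * (norm w)\<^sup>2))" for w
      using sum_fejer[of 0 L N w w] L unfolding u_def by (simp add: L_def cinner_norm)
    have "(\<Sum>k<L. poly P (cnj (u k)) * fejer N (u k) x y)
        = (\<Sum>k<L. \<Sum>i\<le>d. coeff P i * (cnj (u k) ^ i * fejer N (u k) x y))"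
      by (simp add: poly_altdef d_def sum_distrib_right mult.assoc)
    also have "\<dots> = (\<Sum>i\<le>d. coeff P i * (\<Sum>k<L. cnj (u k) ^ i * fejer N (u k) x y))"
      by (subst sum.swap) (simp add: sum_distrib_left)
    also have "\<dots> = (\<Sum>i\<le>d. coeff P i * (of_nat L * (\<Sum>n<N. if i \<le> n then cinner ((T ^^ i) x) y else 0)))"
      unfolding u_def by (intro sum.cong refl arg_cong2[of _ _ _ _ "(*)"] sum_fejer) (auto simp: L_def)
    also have "\<dots> = of_nat L * (\<Sum>i\<le>d. \<Sum>n<N. coeff P i * (if i \<le> n then cinner ((T ^^ i) x) y else 0))"
      by (simp add: sum_distrib_left mult_ac)
    also have "\<dots> = of_nat L * (\<Sum>n<N. B n)"
      unfolding B_def by (subst sum.swap) (rule refl)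
    finally have "real L * cmod (\<Sum>n<N. B n) = cmod (\<Sum>k<L. poly P (cnj (u k)) * fejer N (u k) x y)"
      by (simp add: norm_mult)
    also have "\<dots> \<le> (\<Sum>k<L. M * (Re (fejer N (u k) x x + fejer N (u k) y y) / 2))"
    proof (rule sum_norm_le)
      show "cmod (poly P (cnj (u k)) * fejer N (u k) x y)
          \<le> M * (Re (fejer N (u k) x x + fejer N (u k) y y) / 2)" for k
        unfolding norm_mult by (intro mult_mono' M cmod_fejer_le cmod_u x y norm_ge_zero) (simp add: cmod_u)
    qed
    also have "\<dots> = M * (Re ((\<Sum>k<L. fejer N (u k) x x) + (\<Sum>k<L. fejer N (u k) y y)) / 2)"
      by (simp only: plus_complex.sel Re_sum sum.distrib[symmetric] sum_distrib_left sum_divide_distrib)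
    also have "\<dots> = real L * (M * (real N * S))"
      unfolding self plus_complex.sel(1) Re_complex_of_real S_def by (simp add: algebra_simps)
    finally show ?thesis
      using L by simp
  qed
  have "real N * (cmod \<beta> - M * S) \<le> cmod C" if N: "d \<le> N" for N
  proof -
    have "(\<Sum>n<N. B n - \<beta>) = C"
      unfolding C_def using N by (intro sum.mono_neutral_right) (auto simp: B_eq)
    then have "of_nat N * \<beta> = (\<Sum>n<N. B n) - C"
      by (simp add: sum_subtractf diff_eq_eq add.commute eq_diff_eq)
    then have "real N * cmod \<beta> \<le> cmod (\<Sum>n<N. B n) + cmod C"
      by (metis norm_mult norm_of_nat norm_triangle_ineq4)
    then show ?thesis
      using bound[of N] by (simp add: algebra_simps)
  qed
  note large = this
  have "cmod \<beta> \<le> M * S"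
  proof (rule ccontr)
    assume "\<not> ?thesis"
    then have e: "cmod \<beta> - M * S > 0" by simp
    then obtain N :: nat where "cmod C / (cmod \<beta> - M * S) < real N"
      using reals_Archimedean2 by blast
    then have "cmod C < real N * (cmod \<beta> - M * S)"
      using e by (simp add: field_simps)
    also have "\<dots> \<le> real (N + d) * (cmod \<beta> - M * S)"
      using e by (intro mult_right_mono) auto
    finally show False
      using large[of "N + d"] by simp
  qed
  then show ?thesis
    by (simp add: \<beta>_def S_def)
qed

theorem von_Neumann_inequality:
  assumes M: "\<And>z. cmod z = 1 \<Longrightarrow> cmod (poly P z) \<le> M" and x: "x \<in> H"
  shows "norm (poly_op P T x) \<le> M * norm x"
proof (cases "poly_op P T x = 0")
  case True
  have "0 \<le> M"
    using M[of 1] norm_ge_zero[of "poly P 1"] by (simp del: norm_ge_zero)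
  then show ?thesis
    by (simp add: True)
next
  case False
  define w where "w = poly_op P T x"
  \<comment> \<open>Rescaling \<open>w\<close> to the norm of \<open>x\<close> makes the mean of the
    two squared norms equal to their product, so the additive bound loses nothing.\<close>
  define t where "t = norm x / norm w"
  have w: "norm w > 0" "w \<in> H"
    using False x by (auto simp: w_def)
  have x0: "norm x > 0"
    using False by (cases "x = 0") (auto simp: poly_op_def)
  have "cinner w (t *\<^sub>R w) = complex_of_real (norm x * norm w)"
    using w by (simp add: cinner_scaleR_right cinner_norm t_def power2_eq_square)
  moreover have "norm (t *\<^sub>R w) = norm x"
    using w by (simp add: t_def)
  ultimately have "norm x * norm w \<le> M * (norm x)\<^sup>2"
    using cmod_cinner_poly_op_le[OF M x scaleR_mem[OF w(2)], of t] w by (simp add: w_def[symmetric] norm_mult)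
  then have "norm x * norm w \<le> norm x * (M * norm x)"
    by (simp add: power2_eq_square mult_ac)
  then show ?thesis
    using x0 by (simp add: w_def)
qed

end

section \<open>Rational functions\<close>

lemma poly_bounded_on_disc: "\<exists>K. \<forall>z. cmod z \<le> 1 \<longrightarrow> cmod (poly P z) \<le> K"
proof -
  have "compact (poly P ` cball 0 1)"
    by (rule compact_continuous_image[OF continuous_at_imp_continuous_on compact_cball]) simp
  then have "bounded (poly P ` cball 0 1)"
    by (rule compact_imp_bounded)
  then obtain K where "\<forall>w\<in>poly P ` cball 0 1. cmod w \<le> K"
    by (auto simp: bounded_iff)
  then show ?thesis
    by (intro exI[of _ K]) auto
qed

lemma poly_root_factor:
  fixes P :: "complex poly"
  assumes "degree P \<noteq> 0"
  obtains a Q where "P = [:- a, 1:] * Q" "degree Q < degree P"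
proof -
  obtain a where "poly P a = 0"
    using fundamental_theorem_of_algebra[of P] assms by (auto simp: constant_degree)
  then obtain Q where Q: "P = [:- a, 1:] * Q"
    by (auto simp: poly_eq_0_iff_dvd)
  then have "Q \<noteq> 0"
    using assms by auto
  then have "degree P = Suc (degree Q)"
    unfolding Q by (subst degree_mult_eq) auto
  then show ?thesis
    using that[OF Q] by simp
qed

text \<open>For a linear factor the approximate inverse is a partial sum of the geometric series.\<close>

lemma poly_approximate_inverse:
  fixes P :: "complex poly"
  assumes "\<And>z. cmod z \<le> 1 \<Longrightarrow> poly P z \<noteq> 0" "0 < e"
  shows "\<exists>Q. \<forall>z. cmod z \<le> 1 \<longrightarrow> cmod (poly (Q * P) z - 1) \<le> e"
  using assms
proof (induction "degree P" arbitrary: P e rule: less_induct)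
  case less
  show ?case
  proof (cases "degree P = 0")
    case True
    then obtain c where "P = [:c:]"
      by (rule degree_eq_zeroE)
    moreover have "c \<noteq> 0"
      using less.prems(1)[of 0] \<open>P = [:c:]\<close> by simp
    ultimately show ?thesis
      using less.prems(2) by (intro exI[of _ "[:1 / c:]"]) simp
  next
    case False
    then obtain a R where R: "P = [:- a, 1:] * R" "degree R < degree P"
      by (rule poly_root_factor)
    have a: "1 < cmod a"
      using less.prems(1)[of a] R(1) by force
    have "poly R z \<noteq> 0" if "cmod z \<le> 1" for z
      using less.prems(1)[OF that] R(1) by auto
    \<comment> \<open>The total error is v - u - u v, where u is the error of the geometric sum and
      v that of the cofactor. Each is at most e/3, and the cap 1 controls the product.\<close>
    then obtain Q where Q: "\<And>z. cmod z \<le> 1 \<Longrightarrow> cmod (poly (Q * R) z - 1) \<le> min 1 (e / 3)"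
      using less.hyps[OF R(2), of "min 1 (e / 3)"] less.prems(2) by auto
    have "0 < min 1 (e / 3)" "cmod (1 / a) < 1"
      using less.prems(2) a by (auto simp: norm_divide divide_less_eq_1)
    then obtain n where n: "cmod (1 / a) ^ n < min 1 (e / 3)"
      using real_arch_pow_inv by blast
    \<comment> \<open>Partial sum of the expansion of 1/(z - a) in powers of z/a.\<close>
    define S where "S = (\<Sum>i<n. monom (- ((1 / a) ^ Suc i)) i)"
    have S: "poly (S * [:- a, 1:]) z = 1 - (z / a) ^ n" for z
    proof -
      have "poly S z = - (1 / a) * (\<Sum>i<n. (z / a) ^ i)"
        by (simp add: S_def poly_sum poly_monom sum_distrib_left sum_negf power_divide)
      then have "poly (S * [:- a, 1:]) z = (1 - z / a) * (\<Sum>i<n. (z / a) ^ i)"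
        using a by (simp add: field_simps) (auto simp: algebra_simps)
      then show ?thesis
        by (simp add: one_diff_power_eq)
    qed
    have "cmod (poly (S * Q * P) z - 1) \<le> e" if z: "cmod z \<le> 1" for z
    proof -
      define u where "u = (z / a) ^ n"
      define v where "v = poly (Q * R) z - 1"
      have "cmod u \<le> cmod (1 / a) ^ n"
        unfolding u_def norm_power using z a by (intro power_mono) (auto simp: norm_divide divide_right_mono)
      then have u: "cmod u \<le> 1" "cmod u \<le> e / 3"
        using n by auto
      have v: "cmod v \<le> e / 3"
        using Q[OF z] by (simp add: v_def)
      have "poly (S * Q * P) z = poly (S * [:- a, 1:]) z * poly (Q * R) z"
        unfolding R(1) poly_mult by (simp only: mult_ac)
      also have "\<dots> = (1 - u) * (1 + v)"
        unfolding S u_def v_def by simp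
      finally have "poly (S * Q * P) z - 1 = v - u - u * v"
        by (simp add: algebra_simps)
      then have "cmod (poly (S * Q * P) z - 1) \<le> cmod v + cmod u + cmod u * cmod v"
        using norm_triangle_ineq4[of "v - u" "u * v"] norm_triangle_ineq4[of v u] by (simp add: norm_mult)
      also have "cmod u * cmod v \<le> 1 * (e / 3)"
        using u v by (intro mult_mono) auto
      finally show ?thesis
        using u v by simp
    qed
    then show ?thesis by blast
  qed
qed

section \<open>Rational functions of a contraction\<close>

context hilbert_contraction
begin

text \<open>The solution is the fixed point of the map sending y to (T y - x)/a, which has Lipschitz
  constant 1/|a| < 1.\<close>

lemma shift_surj:
  assumes a: "1 < cmod a" and x: "x \<in> H"
  shows "\<exists>y\<in>H. T y - a *\<^sub>C y = x"
proof -
  define f where "f = (\<lambda>y. (1 / a) *\<^sub>C (T y - x))"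
  have "\<exists>!y. y \<in> H \<and> f y = y"
  proof (rule Banach_fix[OF complete_carrier])
    show "f ` H \<subseteq> H"
      using x by (auto simp: f_def intro!: mem_intros)
    show "dist (f y) (f z) \<le> cmod (1 / a) * dist y z" if "y \<in> H" "z \<in> H" for y z
    proof -
      have "f y - f z = (1 / a) *\<^sub>C T (y - z)"
        using that by (simp add: f_def op_diff flip: scaleC_diff_right)
      then show ?thesis
        using contraction[OF diff_mem, of y z] that a
        by (simp add: dist_norm norm_divide divide_right_mono)
    qed
    show "H \<noteq> {}"
      using zero_mem by blast
  qed (use a in \<open>auto simp: norm_divide divide_less_eq_1\<close>)
  then obtain y where y: "y \<in> H" "f y = y" by blast
  have "a *\<^sub>C f y = T y - x"
    using a by (auto simp: f_def scaleC_scaleC)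
  then show ?thesis
    using y by (intro bexI[of _ y]) simp_all
qed

lemma shift_inj:
  assumes a: "1 < cmod a" and x: "x \<in> H" and eq: "T x = a *\<^sub>C x"
  shows "x = 0"
proof (rule ccontr)
  assume "x \<noteq> 0"
  then have "norm x < cmod a * norm x"
    using a by simp
  then show False
    using contraction[OF x] eq by simp
qed

text \<open>Linear factors are solved one at a time, by surjectivity of \<open>T\<close> for the
  root 0 and by \<open>shift_surj\<close> for roots outside the disc. A preimage is all that the
  norm estimate for quotients requires.\<close>

lemma poly_op_surj:
  assumes surj: "T ` H = H" and "P \<noteq> 0"
    and "\<And>z. poly P z = 0 \<Longrightarrow> z = 0 \<or> 1 < cmod z" and "x \<in> H"
  shows "\<exists>y\<in>H. poly_op P T y = x"
  using assms(2-)
proof (induction "degree P" arbitrary: P x rule: less_induct)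
  case less
  show ?case
  proof (cases "degree P = 0")
    case True
    then obtain c where c: "P = [:c:]"
      by (rule degree_eq_zeroE)
    then have "poly_op P T ((1 / c) *\<^sub>C x) = x"
      using less.prems by (simp add: poly_op_def scaleC_scaleC)
    then show ?thesis
      using less.prems(3) scaleC_mem by blast
  next
    case False
    then obtain a Q where Q: "P = [:- a, 1:] * Q" "degree Q < degree P"
      by (rule poly_root_factor)
    have a: "a = 0 \<or> 1 < cmod a"
      using less.prems(2)[of a] Q(1) by force
    have "\<exists>w\<in>H. T w - a *\<^sub>C w = x"
    proof (cases "a = 0")
      case True
      then have "x \<in> T ` H" using less.prems(3) surj by simp
      then show ?thesis using True by auto
    next
      case False
      then show ?thesis using shift_surj[of a x] a less.prems(3) by blast
    qed
    then obtain w where w: "w \<in> H" "T w - a *\<^sub>C w = x" by blast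
    have "Q \<noteq> 0"
      using less.prems(1) Q(1) by auto
    moreover have "poly Q z = 0 \<Longrightarrow> z = 0 \<or> 1 < cmod z" for z
      using less.prems(2)[of z] Q(1) by simp
    ultimately have "\<exists>y\<in>H. poly_op Q T y = w"
      using less.hyps[OF Q(2), of w] w(1) by blast
    then obtain y where y: "y \<in> H" "poly_op Q T y = w" by blast
    then have "poly_op P T y = x"
      unfolding Q(1) poly_op_mult[OF y(1)] using w by (simp add: poly_op_pCons scaleC_minus_left)
    then show ?thesis
      using y by blast
  qed
qed

text \<open>With Q an approximate inverse of G, write P = (P - P Q G) + (P Q) G. On the circle the
  first polynomial is at most e K and P Q at most M (1 + e), so the polynomial inequality applies to
  both; then e tends to 0.\<close>

lemma rational_von_Neumann_inequality:
  assumes le: "\<And>z. cmod z \<le> 1 \<Longrightarrow> cmod (poly P z) \<le> M * cmod (poly G z)"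
    and G: "\<And>z. cmod z \<le> 1 \<Longrightarrow> poly G z \<noteq> 0" and x: "x \<in> H"
  shows "norm (poly_op P T x) \<le> M * norm (poly_op G T x)"
proof -
  obtain K where K: "\<And>z. cmod z \<le> 1 \<Longrightarrow> cmod (poly P z) \<le> K"
    using poly_bounded_on_disc by blast
  have "0 \<le> M"
    using order_trans[OF norm_ge_zero le[of 0]] G[of 0] by (simp add: zero_le_mult_iff)
  have approx: "norm (poly_op P T x) \<le> M * norm (poly_op G T x) + e * (K * norm x + M * norm (poly_op G T x))"
    if e: "0 < e" for e
  proof -
    obtain Q where Q: "\<And>z. cmod z \<le> 1 \<Longrightarrow> cmod (poly (Q * G) z - 1) \<le> e"
      using poly_approximate_inverse[OF G e] by blast
    have "cmod (poly (P - P * Q * G) z) \<le> e * K" if "cmod z = 1" for z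
    proof -
      have "poly (P - P * Q * G) z = - ((poly (Q * G) z - 1) * poly P z)"
        by (simp add: algebra_simps)
      then have "cmod (poly (P - P * Q * G) z) = cmod (poly (Q * G) z - 1) * cmod (poly P z)"
        by (simp only: norm_minus_cancel norm_mult)
      also have "\<dots> \<le> e * K"
        using Q[of z] K[of z] that e by (intro mult_mono) auto
      finally show ?thesis .
    qed
    then have 1: "norm (poly_op (P - P * Q * G) T x) \<le> e * K * norm x"
      using x by (rule von_Neumann_inequality)
    have "cmod (poly (P * Q) z) \<le> M * (1 + e)" if "cmod z = 1" for z
    proof -
      have "cmod (poly (Q * G) z) \<le> 1 + e"
        using norm_triangle_sub[of "poly (Q * G) z" 1] Q[of z] that by simp
      then have "M * cmod (poly (Q * G) z) \<le> M * (1 + e)"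
        using \<open>0 \<le> M\<close> by (rule mult_left_mono)
      moreover have "cmod (poly (P * Q) z) \<le> M * cmod (poly (Q * G) z)"
        using mult_right_mono[OF le[of z] norm_ge_zero[of "poly Q z"]] that
        by (simp add: norm_mult mult_ac)
      ultimately show ?thesis by simp
    qed
    then have 2: "norm (poly_op (P * Q) T (poly_op G T x)) \<le> M * (1 + e) * norm (poly_op G T x)"
      by (rule von_Neumann_inequality) (use x in simp_all)
    have "poly_op P T x = poly_op (P - P * Q * G) T x + poly_op (P * Q) T (poly_op G T x)"
      using x by (simp add: poly_op_diff flip: poly_op_mult)
    then have "norm (poly_op P T x) \<le> norm (poly_op (P - P * Q * G) T x) + norm (poly_op (P * Q) T (poly_op G T x))"
      by (simp add: norm_triangle_ineq)
    also have "\<dots> \<le> e * K * norm x + M * (1 + e) * norm (poly_op G T x)"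
      by (rule add_mono[OF 1 2])
    finally show ?thesis
      by (simp add: algebra_simps)
  qed
  show ?thesis
  proof (rule tendsto_lowerbound[of _ _ "at_right (0::real)"])
    show "((\<lambda>e. M * norm (poly_op G T x) + e * (K * norm x + M * norm (poly_op G T x)))
        \<longlongrightarrow> M * norm (poly_op G T x)) (at_right 0)"
      by (auto intro!: tendsto_eq_intros)
    show "\<forall>\<^sub>F e in at_right 0. norm (poly_op P T x)
        \<le> M * norm (poly_op G T x) + e * (K * norm x + M * norm (poly_op G T x))"
      using approx by (auto simp: eventually_at_filter)
  qed simp
qed

text \<open>Zeros of \<open>G\<close> at the origin are cancelled against zeros of \<open>P\<close>.\<close>

lemma rational_von_Neumann_inequality_punctured:
  assumes le: "\<And>z. z \<noteq> 0 \<Longrightarrow> cmod z \<le> 1 \<Longrightarrow> cmod (poly P z) \<le> M * cmod (poly G z)"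
    and G: "\<And>z. z \<noteq> 0 \<Longrightarrow> cmod z \<le> 1 \<Longrightarrow> poly G z \<noteq> 0" and x: "x \<in> H"
  shows "norm (poly_op P T x) \<le> M * norm (poly_op G T x)"
  using assms
proof (induction "degree G" arbitrary: P G x rule: less_induct)
  case less
  \<comment> \<open>By continuity the bound holds at 0 as well, so a zero of \<open>G\<close> there
    forces one of \<open>P\<close>.\<close>
  have le0: "cmod (poly P 0) \<le> M * cmod (poly G 0)"
  proof (rule tendsto_le[of "at 0"])
    show "((\<lambda>z. M * cmod (poly G z)) \<longlongrightarrow> M * cmod (poly G 0)) (at 0)"
      by (intro tendsto_intros tendsto_poly)
    show "((\<lambda>z. cmod (poly P z)) \<longlongrightarrow> cmod (poly P 0)) (at 0)"
      by (intro tendsto_intros tendsto_poly)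
    show "\<forall>\<^sub>F z in at 0. cmod (poly P z) \<le> M * cmod (poly G z)"
      unfolding eventually_at by (intro exI[of _ 1]) (auto intro: less.prems(1))
  qed simp
  show ?case
  proof (cases "poly G 0 = 0")
    case False
    show ?thesis
    proof (rule rational_von_Neumann_inequality)
      show "cmod (poly P z) \<le> M * cmod (poly G z)" if "cmod z \<le> 1" for z
        using less.prems(1)[of z] le0 that by (cases "z = 0") auto
      show "poly G z \<noteq> 0" if "cmod z \<le> 1" for z
        using less.prems(2)[of z] False that by (cases "z = 0") auto
    qed (rule less.prems(3))
  next
    case True
    then have "poly P 0 = 0"
      using le0 by simp
    obtain G' P' where G': "G = pCons 0 G'" and P': "P = pCons 0 P'"
      using True \<open>poly P 0 = 0\<close> by (cases G, cases P) auto
    have "G' \<noteq> 0"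
      using less.prems(2)[of 1] G' by auto
    \<comment> \<open>The cancelled factor z is moved into the argument, which is why the induction
      lets \<open>x\<close> vary.\<close>
    have "norm (poly_op P' T (T x)) \<le> M * norm (poly_op G' T (T x))"
    proof (rule less.hyps)
      show "degree G' < degree G"
        using G' \<open>G' \<noteq> 0\<close> by simp
      show "cmod (poly P' z) \<le> M * cmod (poly G' z)" if "z \<noteq> 0" "cmod z \<le> 1" for z
        using less.prems(1)[OF that] that by (simp add: G' P' norm_mult mult.left_commute)
      show "poly G' z \<noteq> 0" if "z \<noteq> 0" "cmod z \<le> 1" for z
        using less.prems(2)[OF that] by (auto simp: G')
    qed (use less.prems(3) in simp)
    moreover have "poly_op (pCons 0 Q) T x = poly_op Q T (T x)" for Q
    proof -
      have "pCons 0 Q = Q * [:0, 1:]" by simp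
      then have "poly_op (pCons 0 Q) T x = poly_op Q T (poly_op [:0, 1:] T x)"
        using less.prems(3) by (simp only: poly_op_mult)
      then show ?thesis
        using less.prems(3) by (simp add: poly_op_pCons)
    qed
    ultimately show ?thesis
      by (simp add: G' P')
  qed
qed

end

section \<open>The Koszul complex of a pair and the map \<open>\<kappa>\<close>\<close>

text \<open>In the numeral type the literal 2 denotes 0, so index 2 precedes index 1. This fixes the
  signs of the Koszul map and the order of factors in \<open>monom_op\<close>.\<close>

lemma two_less_one: "(2::2) < 1"
proof -
  have "(2::2) = 0"
    by simp
  then show ?thesis
    unfolding less_bit0_def by (simp only: bit0.Rep_0 bit0.Rep_1)
qed

lemma sorted_list_of_UNIV_2: "sorted_list_of_set (UNIV :: 2 set) = [2, 1]"
proof (rule sorted_list_of_set.idem_if_sorted_distinct[of "[2, 1]", symmetric, THEN trans, THEN sym])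
qed (use two_less_one in \<open>auto simp: UNIV_2 insert_commute\<close>)

lemma set_2_cases:
  obtains "S = {}" | "S = {1 :: 2}" | "S = {2}" | "S = UNIV"
proof -
  have "S = {} \<or> S = {1} \<or> S = {2} \<or> S = UNIV"
    unfolding UNIV_2 using exhaust_2 by auto metis+
  then show ?thesis using that by blast
qed

lemma koszul_2:
  fixes T :: "('h::complex_hilbert \<Rightarrow> 'h) ^ 2"
  shows "koszul T \<omega> {} = 0" "koszul T \<omega> {1} = (T $ 1) (\<omega> {})" "koszul T \<omega> {2} = (T $ 2) (\<omega> {})"
    "koszul T \<omega> UNIV = (T $ 2) (\<omega> {1}) - (T $ 1) (\<omega> {2})"
proof -
  show "koszul T \<omega> {} = 0" "koszul T \<omega> {1} = (T $ 1) (\<omega> {})" "koszul T \<omega> {2} = (T $ 2) (\<omega> {})"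
    by (simp_all add: koszul_def conj_commute cong: conj_cong)
  have *: "{j :: 2. j < 1} = {2}" "{j :: 2. j < 2} = {}"
    using two_less_one by (auto simp: UNIV_2[symmetric]) (metis exhaust_2 less_asym' less_irrefl)+
  have "UNIV - {1 :: 2} = {2}" "UNIV - {2 :: 2} = {1}"
    by (auto simp: UNIV_2)
  then show "koszul T \<omega> UNIV = (T $ 2) (\<omega> {1}) - (T $ 1) (\<omega> {2})"
    unfolding koszul_def by (simp add: sum_2 *)
qed

text \<open>If the ideal generated by a commuting pair contains the identity, the pair of coefficients
  provides a contracting homotopy of the Koszul complex.\<close>

lemma (in hilbert_space) taylor_nonsingular_2I:
  fixes A :: "('h \<Rightarrow> 'h) ^ 2"
  assumes A_mem: "\<And>i x. x \<in> H \<Longrightarrow> (A $ i) x \<in> H"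
    and A_add: "\<And>i x y. x \<in> H \<Longrightarrow> y \<in> H \<Longrightarrow> (A $ i) (x + y) = (A $ i) x + (A $ i) y"
    and A_commute: "\<And>x. x \<in> H \<Longrightarrow> (A $ 1) ((A $ 2) x) = (A $ 2) ((A $ 1) x)"
    and B_mem: "\<And>x. x \<in> H \<Longrightarrow> B1 x \<in> H" "\<And>x. x \<in> H \<Longrightarrow> B2 x \<in> H"
    and B_add: "\<And>x y. x \<in> H \<Longrightarrow> y \<in> H \<Longrightarrow> B1 (x + y) = B1 x + B1 y"
      "\<And>x y. x \<in> H \<Longrightarrow> y \<in> H \<Longrightarrow> B2 (x + y) = B2 x + B2 y"
    and B_commute: "\<And>i x. x \<in> H \<Longrightarrow> B1 ((A $ i) x) = (A $ i) (B1 x)"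
      "\<And>i x. x \<in> H \<Longrightarrow> B2 ((A $ i) x) = (A $ i) (B2 x)"
    and id: "\<And>x. x \<in> H \<Longrightarrow> B1 ((A $ 1) x) + B2 ((A $ 2) x) = x"
  shows "taylor_nonsingular H A"
  unfolding taylor_nonsingular_def
proof (intro equalityI subsetI)
  fix \<omega> assume "\<omega> \<in> {\<omega>. range \<omega> \<subseteq> H \<and> koszul A \<omega> = (\<lambda>_. 0)}"
  then have mem: "\<omega> S \<in> H" and ker: "koszul A \<omega> S = 0" for S
    by (auto simp: image_subset_iff fun_eq_iff)
  have zero: "B1 0 = 0" "B2 0 = 0"
    using B_add[of 0 0] by simp_all
  have minus: "(A $ 1) (- x) = - (A $ 1) x" if "x \<in> H" for x
    using A_add[of x "- x" 1] A_add[of 0 0 1] that minus_mem by (simp add: minus_unique)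
  have "\<omega> {} = 0"
    using id[OF mem[of "{}"]] ker[of "{1}"] ker[of "{2}"] by (simp add: koszul_2 zero)
  have eq: "(A $ 2) (\<omega> {1}) = (A $ 1) (\<omega> {2})"
    using ker[of UNIV] by (simp add: koszul_2)
  \<comment> \<open>The contraction of \<open>\<omega>\<close> with the pair (B1, B2). The minus
    sign at \<open>{2}\<close> matches the sign that the order 2 < 1 gives in
    \<open>koszul\<close>.\<close>
  define \<eta> where "\<eta> = (\<lambda>S :: 2 set. if S = {} then B1 (\<omega> {1}) + B2 (\<omega> {2})
    else if S = {1} then B2 (\<omega> UNIV) else if S = {2} then - B1 (\<omega> UNIV) else 0)"
  have "koszul A \<eta> S = \<omega> S" for S
  proof (cases S rule: set_2_cases)
    case 1
    then show ?thesis by (simp add: koszul_2 \<open>\<omega> {} = 0\<close>)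
  next
    case 2
    have "(A $ 1) (B1 (\<omega> {1}) + B2 (\<omega> {2})) = B1 ((A $ 1) (\<omega> {1})) + B2 ((A $ 2) (\<omega> {1}))"
      by (simp add: A_add mem B_mem B_commute eq)
    then show ?thesis
      using 2 by (simp add: koszul_2 \<eta>_def id mem)
  next
    case 3
    have "(A $ 2) (B1 (\<omega> {1}) + B2 (\<omega> {2})) = B1 ((A $ 2) (\<omega> {1})) + B2 ((A $ 2) (\<omega> {2}))"
      by (simp add: A_add mem B_mem B_commute)
    then show ?thesis
      using 3 by (simp add: koszul_2 \<eta>_def id mem eq)
  next
    case 4
    have "{1::2} \<noteq> {2}"
      by simp
    then show ?thesis
      using 4 id[OF mem[of UNIV]] by (simp add: koszul_2 \<eta>_def minus mem B_mem B_commute add.commute)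
  qed
  then have "\<omega> = koszul A \<eta>" by auto
  moreover have "range \<eta> \<subseteq> H"
    by (auto simp: \<eta>_def mem B_mem mem_intros)
  ultimately show "\<omega> \<in> koszul A ` {\<eta>. range \<eta> \<subseteq> H}" by blast
next
  fix \<omega> assume "\<omega> \<in> koszul A ` {\<eta>. range \<eta> \<subseteq> H}"
  then obtain \<eta> where \<eta>: "\<omega> = koszul A \<eta>" and mem: "\<And>S. \<eta> S \<in> H" by auto
  have zero: "(A $ i) 0 = 0" for i
    using A_add[of 0 0 i] by simp
  have "koszul A \<omega> S = 0 \<and> \<omega> S \<in> H" for S
    by (cases S rule: set_2_cases)
      (simp_all add: koszul_2 \<eta> A_commute mem zero A_mem diff_mem)
  then show "\<omega> \<in> {\<omega>. range \<omega> \<subseteq> H \<and> koszul A \<omega> = (\<lambda>_. 0)}"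
    by auto
qed

locale hilbert_invertible =
  fixes H :: "'h::complex_hilbert set" and T :: "'h \<Rightarrow> 'h"
  assumes invertible_on: "invertible_on H T"

sublocale hilbert_invertible \<subseteq> hilbert_operator H T
  using invertible_on by unfold_locales (simp add: invertible_on_def)

sublocale hilbert_invertible \<subseteq> inverse: hilbert_operator H "inv_into H T"
  using invertible_on by unfold_locales (simp add: invertible_on_def)

context hilbert_invertible
begin

abbreviation R :: "'h \<Rightarrow> 'h" where "R \<equiv> inv_into H T"

lemma bij: "bij_betw T H H"
  using invertible_on by (simp add: invertible_on_def)

lemma image_eq: "T ` H = H"
  using bij by (simp add: bij_betw_def)

lemma op_inverse [simp]: "x \<in> H \<Longrightarrow> T (R x) = x"
  using bij_betw_inv_into_right[OF bij] by blast

lemma inverse_op [simp]: "x \<in> H \<Longrightarrow> R (T x) = x"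
  using bij_betw_inv_into_left[OF bij] by blast

lemma funpow_inverse_funpow: "x \<in> H \<Longrightarrow> m \<le> n \<Longrightarrow> (R ^^ m) ((T ^^ n) x) = (T ^^ (n - m)) x"
proof (induction m)
  case (Suc m)
  then have "(R ^^ Suc m) ((T ^^ n) x) = R ((T ^^ Suc (n - Suc m)) x)"
    by (simp add: Suc_diff_Suc del: funpow.simps) simp
  then show ?case
    using Suc.prems by simp
qed simp

lemma funpow_funpow_inverse: "x \<in> H \<Longrightarrow> (T ^^ n) ((R ^^ n) x) = x"
  by (induction n arbitrary: x) (simp_all add: funpow_swap1[of T])

end

section \<open>The curve and the tuple given by kappa\<close>

lemma kappa_nth:
  "kappa r z $ 1 = z / complex_of_real (sqrt (1 + r\<^sup>2))"
  "kappa r z $ 2 = complex_of_real r * inverse z / complex_of_real (sqrt (1 + r\<^sup>2))"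
  by (simp_all add: kappa_def vector_2)

lemma kappa_op_nth:
  "kappa_op r H T $ 1 = (\<lambda>x. (1 / sqrt (1 + r\<^sup>2)) *\<^sub>R T x)"
  "kappa_op r H T $ 2 = (\<lambda>x. (r / sqrt (1 + r\<^sup>2)) *\<^sub>R inv_into H T x)"
  by (simp_all add: kappa_op_def)

lemma sqrt_1_plus_square_pos: "0 < sqrt (1 + r\<^sup>2 :: real)"
  by (simp add: add_pos_nonneg)

text \<open>The image is a piece of a hyperbola cut out by closed conditions: the product of the
  coordinates is a nonzero constant, so the first one cannot vanish. This is why the image is closed
  although the punctured disc is not.\<close>

lemma kappa_image_eq:
  assumes "0 < r"
  shows "kappa r ` (cball 0 1 - {0}) =
    {l. l $ 1 * l $ 2 = complex_of_real (r / (1 + r\<^sup>2)) \<and> cmod (l $ 1) \<le> 1 / sqrt (1 + r\<^sup>2)}"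
proof (intro equalityI subsetI)
  let ?s = "sqrt (1 + r\<^sup>2)"
  have s: "0 < ?s" "?s * ?s = 1 + r\<^sup>2"
    using sqrt_1_plus_square_pos by (simp_all add: add_nonneg_nonneg)
  fix l :: "complex ^ 2"
  assume "l \<in> kappa r ` (cball 0 1 - {0})"
  then obtain z where "z \<in> cball 0 1 - {0}" "l = kappa r z" by blast
  then have z: "z \<noteq> 0" "cmod z \<le> 1" "l = kappa r z" by auto
  have "l $ 1 * l $ 2 = complex_of_real r / (complex_of_real ?s * complex_of_real ?s)"
    using z(1) by (simp add: z(3) kappa_nth field_simps)
  also have "\<dots> = complex_of_real (r / (?s * ?s))"
    by (simp only: of_real_divide of_real_mult)
  finally have "l $ 1 * l $ 2 = complex_of_real (r / (1 + r\<^sup>2))"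
    by (simp only: s(2))
  moreover have "cmod (l $ 1) \<le> 1 / ?s"
    using z(2) s by (simp add: z(3) kappa_nth norm_divide divide_right_mono)
  ultimately show "l \<in> {l. l $ 1 * l $ 2 = complex_of_real (r / (1 + r\<^sup>2)) \<and> cmod (l $ 1) \<le> 1 / ?s}"
    by simp
next
  let ?s = "sqrt (1 + r\<^sup>2)"
  have s: "0 < ?s" "?s * ?s = 1 + r\<^sup>2"
    using sqrt_1_plus_square_pos by (simp_all add: add_nonneg_nonneg)
  fix l :: "complex ^ 2"
  assume "l \<in> {l. l $ 1 * l $ 2 = complex_of_real (r / (1 + r\<^sup>2)) \<and> cmod (l $ 1) \<le> 1 / ?s}"
  then have l: "l $ 1 * l $ 2 = complex_of_real (r / (?s * ?s))" "cmod (l $ 1) \<le> 1 / ?s"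
    by (simp_all only: s(2) mem_Collect_eq)
  define z where "z = complex_of_real ?s * l $ 1"
  have "r / (?s * ?s) \<noteq> 0"
    using assms s(1) by simp
  then have "l $ 1 \<noteq> 0"
    using l(1) by (metis mult_zero_left of_real_eq_0_iff)
  then have "z \<noteq> 0"
    using s(1) by (simp add: z_def)
  have "l $ 2 = complex_of_real (r / (?s * ?s)) / l $ 1"
    using l(1) \<open>l $ 1 \<noteq> 0\<close> by (metis nonzero_mult_div_cancel_left)
  also have "\<dots> = complex_of_real r * inverse z / complex_of_real ?s"
    by (simp only: z_def of_real_divide of_real_mult) (simp add: field_simps)
  finally have "l = kappa r z"
    using s(1) by (auto simp: vec_eq_iff forall_2 kappa_nth z_def)
  moreover have "cmod z \<le> 1"
    using l(2) s(1) by (simp add: z_def norm_mult field_simps)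
  ultimately show "l \<in> kappa r ` (cball 0 1 - {0})"
    using \<open>z \<noteq> 0\<close> by auto
qed

lemma closed_kappa_image: "0 < r \<Longrightarrow> closed (kappa r ` (cball 0 1 - {0}))"
  unfolding kappa_image_eq
  by (intro closed_Collect_conj closed_Collect_eq closed_Collect_le continuous_intros)

lemma (in hilbert_operator) funpow_scaleR: "x \<in> H \<Longrightarrow> (T ^^ n) (t *\<^sub>R x) = t *\<^sub>R (T ^^ n) x"
  by (simp add: scaleR_scaleC funpow_scaleC)

lemma (in hilbert_operator) operator_on_scaleR: "operator_on H (\<lambda>x. t *\<^sub>R T x)"
proof -
  obtain K where K: "\<And>x. x \<in> H \<Longrightarrow> norm (T x) \<le> K * norm x"
    using op_bounded by blast
  have "norm (t *\<^sub>R T x) \<le> (\<bar>t\<bar> * K) * norm x" if "x \<in> H" for x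
    using mult_left_mono[OF K[OF that] abs_ge_zero[of t]] by (simp add: mult.assoc)
  moreover have "t *\<^sub>R T (a *\<^sub>C x) = a *\<^sub>C t *\<^sub>R T x" if "x \<in> H" for a x
    using that by (simp add: op_scaleC scaleR_scaleC scaleC_scaleC mult.commute)
  ultimately show ?thesis
    unfolding operator_on_def using hilbert_subspace
    by (intro conjI exI[of _ "\<bar>t\<bar> * K"]) (auto simp: op_add scaleR_mem scaleR_add_right)
qed

context hilbert_invertible
begin

lemma commuting_tuple_kappa_op: "commuting_tuple H (kappa_op r H T)"
proof -
  have "operator_on H (kappa_op r H T $ i)" for i
    using exhaust_2[of i] operator_on_scaleR inverse.operator_on_scaleR
    by (auto simp: kappa_op_nth)
  moreover have "(kappa_op r H T $ i) ((kappa_op r H T $ j) x) = (kappa_op r H T $ j) ((kappa_op r H T $ i) x)"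
    if "x \<in> H" for i j x
    using exhaust_2[of i] exhaust_2[of j] that
    by (auto simp: kappa_op_nth op_scaleR inverse.op_scaleR)
  ultimately show ?thesis
    by (simp add: commuting_tuple_def hilbert_subspace)
qed

lemma funpow_scaled: "x \<in> H \<Longrightarrow> ((\<lambda>x. t *\<^sub>R T x) ^^ n) x = t ^ n *\<^sub>R (T ^^ n) x"
  by (induction n) (simp_all add: op_scaleR)

lemma funpow_scaled_inverse: "x \<in> H \<Longrightarrow> ((\<lambda>x. t *\<^sub>R R x) ^^ n) x = t ^ n *\<^sub>R (R ^^ n) x"
  by (induction n) (simp_all add: inverse.op_scaleR)

text \<open>On the range of \<open>T ^^ k\<close>, with k at least the exponent of the inverse, all
  inverse powers cancel, so only powers of \<open>T\<close> remain. This is the operator form of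
  multiplying a Laurent polynomial by z^k.\<close>

lemma monom_op_kappa_op:
  assumes "x \<in> H" "m $ 2 \<le> k"
  shows "monom_op (kappa_op r H T) m ((T ^^ k) x) = ((1 / sqrt (1 + r\<^sup>2)) ^ (m $ 1) *
    (r / sqrt (1 + r\<^sup>2)) ^ (m $ 2)) *\<^sub>R (T ^^ (m $ 1 + k - m $ 2)) x"
proof -
  have "(R ^^ (m $ 2)) ((T ^^ (m $ 1)) ((T ^^ k) x)) = (T ^^ (m $ 1 + k - m $ 2)) x"
    using funpow_inverse_funpow[OF assms(1), of "m $ 2" "m $ 1 + k"] assms(2)
    by (simp add: funpow_add)
  then show ?thesis
    using assms(1) by (simp add: monom_op_def sorted_list_of_UNIV_2 kappa_op_nth funpow_scaled
        funpow_scaled_inverse scaleR_mem inverse.funpow_scaleR mult.commute)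
qed

end

text \<open>The numerator of the Laurent polynomial \<open>p \<circ> \<kappa>\<close> over the denominator \<open>z ^ k\<close>.\<close>

definition kappa_poly :: "real \<Rightarrow> nat \<Rightarrow> 2 cpoly \<Rightarrow> complex poly" where
  "kappa_poly r k p = (\<Sum>m\<in>Poly_Mapping.keys p. monom (Poly_Mapping.lookup p m *
     complex_of_real ((1 / sqrt (1 + r\<^sup>2)) ^ (m $ 1) * (r / sqrt (1 + r\<^sup>2)) ^ (m $ 2)))
       (m $ 1 + k - m $ 2))"

lemma poly_kappa_poly:
  assumes "z \<noteq> 0" "\<And>m. m \<in> Poly_Mapping.keys p \<Longrightarrow> m $ 2 \<le> k"
  shows "poly (kappa_poly r k p) z = z ^ k * cpoly_eval p (kappa r z)"
  unfolding kappa_poly_def cpoly_eval_def poly_sum poly_monom sum_distrib_left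
proof (rule sum.cong)
  fix m assume "m \<in> Poly_Mapping.keys p"
  then have le: "m $ 2 \<le> k" by (rule assms)
  have "z ^ (m $ 1 + k - m $ 2) = z ^ (m $ 1) * z ^ k * inverse z ^ (m $ 2)"
    using le assms(1) by (simp add: power_diff power_add field_simps)
  then show "Poly_Mapping.lookup p m * complex_of_real ((1 / sqrt (1 + r\<^sup>2)) ^ (m $ 1) *
      (r / sqrt (1 + r\<^sup>2)) ^ (m $ 2)) * z ^ (m $ 1 + k - m $ 2)
    = z ^ k * (Poly_Mapping.lookup p m * (\<Prod>i\<in>UNIV. (kappa r z $ i) ^ (m $ i)))"
    by (simp add: prod_2 UNIV_2 kappa_nth power_mult_distrib power_divide)
qed simp

lemma poly_op_sum: "poly_op (\<Sum>i\<in>I. P i) T x = (\<Sum>i\<in>I. poly_op (P i) T x)"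
  by (induction I rule: infinite_finite_induct) (simp_all add: poly_op_add)

lemma (in hilbert_invertible) cpoly_op_kappa_op:
  assumes "x \<in> H" "\<And>m. m \<in> Poly_Mapping.keys p \<Longrightarrow> m $ 2 \<le> k"
  shows "cpoly_op p (kappa_op r H T) ((T ^^ k) x) = poly_op (kappa_poly r k p) T x"
  unfolding kappa_poly_def cpoly_op_def poly_op_sum
proof (rule sum.cong)
  fix m assume "m \<in> Poly_Mapping.keys p"
  then have le: "m $ 2 \<le> k" by (rule assms)
  have "poly_op (monom c n) T x = c *\<^sub>C (T ^^ n) x" for c n
    using poly_op_smult[of c "monom 1 n" T x] poly_op_monom_1[OF assms(1), of n] by (simp add: smult_monom)
  then show "Poly_Mapping.lookup p m *\<^sub>C monom_op (kappa_op r H T) m ((T ^^ k) x) =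
    poly_op (monom (Poly_Mapping.lookup p m * complex_of_real ((1 / sqrt (1 + r\<^sup>2)) ^ (m $ 1) *
     (r / sqrt (1 + r\<^sup>2)) ^ (m $ 2))) (m $ 1 + k - m $ 2)) T x"
    by (simp only: monom_op_kappa_op[OF assms(1) le] scaleR_scaleC scaleC_scaleC)
qed simp

lemma op_norm_leI:
  assumes "\<And>x. x \<in> H \<Longrightarrow> norm x \<le> 1 \<Longrightarrow> norm (T x) \<le> M"
  shows "op_norm H T \<le> ennreal M"
  unfolding op_norm_def using assms by (auto intro!: SUP_least ennreal_leI)

lemma (in hilbert_operator) norm_le_if_op_norm_le:
  assumes "op_norm H T \<le> 1" "x \<in> H"
  shows "norm (T x) \<le> norm x"
proof (cases "x = 0")
  case False
  define y where "y = (1 / norm x) *\<^sub>R x"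
  have "y \<in> {x \<in> H. norm x \<le> 1}"
    using assms(2) False by (simp add: y_def scaleR_mem)
  then have "ennreal (norm (T y)) \<le> op_norm H T"
    unfolding op_norm_def by (rule SUP_upper)
  also note assms(1)
  finally have "norm (T y) \<le> 1"
    by simp
  then show ?thesis
    using assms(2) False by (simp add: y_def op_scaleR divide_le_eq)
qed simp

section \<open>The von Neumann property for invertible contractions\<close>

locale hilbert_invertible_contraction = hilbert_invertible + hilbert_contraction
begin

text \<open>Any preimage \<open>w\<close> of \<open>x\<close> under g of the tuple is
  \<open>T ^^ k\<close> applied to some \<open>v\<close>, where both polynomials become polynomials
  in \<open>T\<close>. The estimate holds for every preimage, so it does not matter which one
  \<open>inv_into\<close> selects.\<close>

lemma rational_op_kappa_op_le:
  assumes bound: "\<And>z. z \<noteq> 0 \<Longrightarrow> cmod z \<le> 1 \<Longrightarrow>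
      cmod (cpoly_eval p (kappa r z)) \<le> M * cmod (cpoly_eval g (kappa r z))"
    and g: "\<And>z. z \<noteq> 0 \<Longrightarrow> cmod z \<le> 1 \<Longrightarrow> cpoly_eval g (kappa r z) \<noteq> 0"
    and x: "x \<in> H"
  shows "norm (rational_op H p g (kappa_op r H T) x) \<le> M * norm x"
proof -
  obtain k where k: "\<And>m. m \<in> Poly_Mapping.keys p \<union> Poly_Mapping.keys g \<Longrightarrow> m $ 2 \<le> k"
    using finite_nat_set_iff_bounded_le[of "(\<lambda>m. m $ 2) ` (Poly_Mapping.keys p \<union> Poly_Mapping.keys g)"]
    by auto
  define P where "P = kappa_poly r k p"
  define G where "G = kappa_poly r k g"
  have P: "poly P z = z ^ k * cpoly_eval p (kappa r z)"
    and G: "poly G z = z ^ k * cpoly_eval g (kappa r z)" if "z \<noteq> 0" for z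
    unfolding P_def G_def by (rule poly_kappa_poly[OF that]; use k in blast)+
  have P_op: "cpoly_op p (kappa_op r H T) ((T ^^ k) y) = poly_op P T y"
    and G_op: "cpoly_op g (kappa_op r H T) ((T ^^ k) y) = poly_op G T y" if "y \<in> H" for y
    unfolding P_def G_def by (rule cpoly_op_kappa_op[OF that]; use k in blast)+
  have G_nz: "poly G z \<noteq> 0" if "z \<noteq> 0" "cmod z \<le> 1" for z
    using g[OF that] that by (simp add: G)
  have le: "cmod (poly P z) \<le> M * cmod (poly G z)" if "z \<noteq> 0" "cmod z \<le> 1" for z
    using mult_left_mono[OF bound[OF that], of "cmod (z ^ k)"] that(1)
    by (simp add: P G norm_mult mult_ac)
  have "\<exists>y\<in>H. poly_op G T y = x"
  proof (rule poly_op_surj[OF image_eq _ _ x])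
    show "G \<noteq> 0"
      using G_nz[of 1] by auto
    show "z = 0 \<or> 1 < cmod z" if "poly G z = 0" for z
      using G_nz[of z] that by force
  qed
  then obtain y where y: "y \<in> H" "poly_op G T y = x" by blast
  then have "x \<in> cpoly_op g (kappa_op r H T) ` H"
    using G_op[OF y(1)] by (metis funpow_mem imageI)
  define w where "w = inv_into H (cpoly_op g (kappa_op r H T)) x"
  define v where "v = (R ^^ k) w"
  have w: "w \<in> H" "cpoly_op g (kappa_op r H T) w = x"
    unfolding w_def using \<open>x \<in> _ ` H\<close> by (simp_all add: inv_into_into f_inv_into_f)
  have v: "v \<in> H" "(T ^^ k) v = w"
    using w(1) by (simp_all add: v_def funpow_funpow_inverse)
  have "norm (poly_op P T v) \<le> M * norm (poly_op G T v)"
    by (rule rational_von_Neumann_inequality_punctured[OF le G_nz v(1)])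
  then show ?thesis
    using P_op[OF v(1)] G_op[OF v(1)] v(2) w(2) by (simp add: rational_op_def w_def)
qed

text \<open>The solution operator of \<open>shift_surj\<close>. By \<open>shift_inj\<close>
  solutions are unique, and each identity follows by applying \<open>S\<close> to both sides. The
  Koszul homotopy asks only for additive maps preserving \<open>H\<close>.\<close>

lemma resolvent:
  assumes z: "1 < cmod z"
  obtains V where "\<And>x. x \<in> H \<Longrightarrow> V x \<in> H" "\<And>x y. x \<in> H \<Longrightarrow> y \<in> H \<Longrightarrow> V (x + y) = V x + V y"
    "\<And>x. x \<in> H \<Longrightarrow> V (T x - z *\<^sub>C x) = x" "\<And>a x. x \<in> H \<Longrightarrow> V (a *\<^sub>C x) = a *\<^sub>C V x"
    "\<And>x. x \<in> H \<Longrightarrow> V (T x) = T (V x)" "\<And>x. x \<in> H \<Longrightarrow> V (R x) = R (V x)"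
proof -
  define S where "S = (\<lambda>x. T x - z *\<^sub>C x)"
  have S_add: "S (x + y) = S x + S y" if "x \<in> H" "y \<in> H" for x y
    using that by (simp add: S_def op_add scaleC_add_right)
  have S_scale: "S (a *\<^sub>C x) = a *\<^sub>C S x" if "x \<in> H" for a x
    using that by (simp add: S_def op_scaleC scaleC_diff_right scaleC_scaleC mult.commute)
  have S_T: "S (T x) = T (S x)" if "x \<in> H" for x
    using that by (simp add: S_def op_diff op_scaleC scaleC_mem)
  have S_R: "S (R x) = R (S x)" if "x \<in> H" for x
    using that by (simp add: S_def inverse.op_diff inverse.op_scaleC scaleC_mem)
  define V where "V = (\<lambda>x. SOME y. y \<in> H \<and> S y = x)"
  have V: "V x \<in> H \<and> S (V x) = x" if "x \<in> H" for x
    unfolding V_def by (rule someI_ex) (use shift_surj[OF z that] in \<open>auto simp: S_def\<close>)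
  have S_inj: "x = y" if "x \<in> H" "y \<in> H" "S x = S y" for x y
  proof -
    have "T (x - y) = z *\<^sub>C (x - y)"
      using that by (simp add: S_def op_diff scaleC_diff_right algebra_simps)
    then show ?thesis
      using shift_inj[OF z diff_mem[OF that(1,2)]] by simp
  qed
  have S_mem: "S x \<in> H" if "x \<in> H" for x
    using that by (auto simp: S_def intro!: mem_intros)
  show ?thesis
  proof
    show "V x \<in> H" if "x \<in> H" for x
      using V[OF that] by simp
    show "V (x + y) = V x + V y" if "x \<in> H" "y \<in> H" for x y
      by (rule S_inj) (use that V in \<open>auto simp: S_add add_mem\<close>)
    show "V (a *\<^sub>C x) = a *\<^sub>C V x" if "x \<in> H" for a x
      by (rule S_inj) (use that V in \<open>auto simp: S_scale scaleC_mem\<close>)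
    show "V (T x - z *\<^sub>C x) = x" if "x \<in> H" for x
      by (rule S_inj) (use that V[OF S_mem[OF that]] in \<open>auto simp: S_def\<close>)
    show "V (T x) = T (V x)" if "x \<in> H" for x
      by (rule S_inj) (use that V in \<open>auto simp: S_T\<close>)
    show "V (R x) = R (V x)" if "x \<in> H" for x
      by (rule S_inj) (use that V in \<open>auto simp: S_R\<close>)
  qed
qed

text \<open>A point can leave the curve in two ways. If l1 l2 differs from a b, then b R (a T - l1)
  + l1 (b R - l2) is the nonzero scalar a b - l1 l2, as R inverts T. If |l1/a| > 1, the first
  shifted coordinate is invertible by itself.\<close>

lemma taylor_spectrum_kappa_op:
  assumes r: "0 < r"
  shows "taylor_spectrum H (kappa_op r H T) \<subseteq> kappa r ` (cball 0 1 - {0})"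
proof
  fix l assume l: "l \<in> taylor_spectrum H (kappa_op r H T)"
  define a where "a = complex_of_real (1 / sqrt (1 + r\<^sup>2))"
  define b where "b = complex_of_real (r / sqrt (1 + r\<^sup>2))"
  define A where "A = (\<chi> i. (\<lambda>x. (kappa_op r H T $ i) x - (l $ i) *\<^sub>C x))"
  have A: "A $ 1 = (\<lambda>x. a *\<^sub>C T x - (l $ 1) *\<^sub>C x)" "A $ 2 = (\<lambda>x. b *\<^sub>C R x - (l $ 2) *\<^sub>C x)"
    by (simp_all add: A_def kappa_op_nth scaleR_scaleC a_def b_def)
  have s: "0 < sqrt (1 + r\<^sup>2)" "sqrt (1 + r\<^sup>2) * sqrt (1 + r\<^sup>2) = 1 + r\<^sup>2"
    using sqrt_1_plus_square_pos by (simp_all add: add_nonneg_nonneg)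
  have ab: "a * b = complex_of_real (r / (1 + r\<^sup>2))"
    unfolding a_def b_def of_real_mult[symmetric] times_divide_times_eq s(2) by simp
  have a0: "a \<noteq> 0" and b0: "b \<noteq> 0"
    using r s(1) by (simp_all add: a_def b_def del: real_sqrt_eq_zero_cancel_iff real_sqrt_gt_0_iff)
  have A_mem: "(A $ i) x \<in> H" if "x \<in> H" for i x
    using exhaust_2[of i] that by (auto simp: A intro!: mem_intros)
  have A_add: "(A $ i) (x + y) = (A $ i) x + (A $ i) y" if "x \<in> H" "y \<in> H" for i x y
    using exhaust_2[of i] that by (auto simp: A op_add inverse.op_add scaleC_add_right)
  have A_commute: "(A $ 1) ((A $ 2) x) = (A $ 2) ((A $ 1) x)" if "x \<in> H" for x
    using that by (simp add: A op_diff inverse.op_diff op_scaleC inverse.op_scaleC scaleC_mem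
        scaleC_diff_right scaleC_scaleC mult.commute algebra_simps)
  have sing: "\<not> taylor_nonsingular H A"
    using l by (simp add: taylor_spectrum_def A_def)
  have l_eq: "l $ 1 * l $ 2 = a * b"
  proof (rule ccontr)
    assume neq: "l $ 1 * l $ 2 \<noteq> a * b"
    define c where "c = a * b - l $ 1 * l $ 2"
    have c: "c \<noteq> 0"
      using neq by (simp add: c_def)
    have "taylor_nonsingular H A"
    proof (rule taylor_nonsingular_2I[OF A_mem A_add A_commute])
      show "(b / c) *\<^sub>C R x \<in> H" "(l $ 1 / c) *\<^sub>C x \<in> H" if "x \<in> H" for x
        using that by (auto intro!: mem_intros)
      show "(b / c) *\<^sub>C R (x + y) = (b / c) *\<^sub>C R x + (b / c) *\<^sub>C R y"
        "(l $ 1 / c) *\<^sub>C (x + y) = (l $ 1 / c) *\<^sub>C x + (l $ 1 / c) *\<^sub>C y" if "x \<in> H" "y \<in> H" for x y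
        using that by (simp_all add: inverse.op_add scaleC_add_right)
      show "(b / c) *\<^sub>C R ((A $ i) x) = (A $ i) ((b / c) *\<^sub>C R x)"
        "(l $ 1 / c) *\<^sub>C (A $ i) x = (A $ i) ((l $ 1 / c) *\<^sub>C x)" if "x \<in> H" for i x
        using exhaust_2[of i] that
        by (auto simp: A op_scaleC inverse.op_diff inverse.op_scaleC scaleC_mem
            scaleC_diff_right scaleC_scaleC mult.commute)
      show "(b / c) *\<^sub>C R ((A $ 1) x) + (l $ 1 / c) *\<^sub>C (A $ 2) x = x" if "x \<in> H" for x
      proof -
        have "(b / c) *\<^sub>C R ((A $ 1) x) + (l $ 1 / c) *\<^sub>C (A $ 2) x
          = (b * a / c) *\<^sub>C x - (l $ 1 * l $ 2 / c) *\<^sub>C x"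
          using that by (simp add: A inverse.op_diff inverse.op_scaleC scaleC_mem
            scaleC_diff_right scaleC_scaleC mult.commute)
        also have "\<dots> = (c / c) *\<^sub>C x"
          by (simp add: c_def mult.commute flip: scaleC_diff_left diff_divide_distrib)
        finally show ?thesis
          using c by simp
      qed
    qed
    then show False using sing by simp
  qed
  define z where "z = l $ 1 / a"
  have "cmod z \<le> 1"
  proof (rule ccontr)
    assume "\<not> cmod z \<le> 1"
    then have "1 < cmod z" by simp
    from resolvent[OF this] obtain V where V_mem: "\<And>x. x \<in> H \<Longrightarrow> V x \<in> H"
      and V_add: "\<And>x y. x \<in> H \<Longrightarrow> y \<in> H \<Longrightarrow> V (x + y) = V x + V y"
      and V_inv: "\<And>x. x \<in> H \<Longrightarrow> V (T x - z *\<^sub>C x) = x"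
      and V_scale: "\<And>a x. x \<in> H \<Longrightarrow> V (a *\<^sub>C x) = a *\<^sub>C V x"
      and V_T: "\<And>x. x \<in> H \<Longrightarrow> V (T x) = T (V x)"
      and V_R: "\<And>x. x \<in> H \<Longrightarrow> V (R x) = R (V x)"
      by blast
    have V_diff: "V (x - y) = V x - V y" if "x \<in> H" "y \<in> H" for x y
      using V_add[of x "(-1) *\<^sub>C y"] V_scale[of y "-1"] that scaleC_mem[of y "-1"] by simp
    have "taylor_nonsingular H A"
    proof (rule taylor_nonsingular_2I[OF A_mem A_add A_commute])
      show "(1 / a) *\<^sub>C V x \<in> H" "0 \<in> H" if "x \<in> H" for x
        using that V_mem by (auto intro!: mem_intros)
      show "(1 / a) *\<^sub>C V (x + y) = (1 / a) *\<^sub>C V x + (1 / a) *\<^sub>C V y"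
        if "x \<in> H" "y \<in> H" for x y
        using that by (simp add: V_add scaleC_add_right)
      show "0 = 0 + (0::'a)" by simp
      show "(1 / a) *\<^sub>C V ((A $ i) x) = (A $ i) ((1 / a) *\<^sub>C V x)" "0 = (A $ i) 0" if "x \<in> H" for i x
        using exhaust_2[of i] that
        by (auto simp: A V_diff V_scale V_T V_R V_mem op_scaleC inverse.op_scaleC scaleC_mem
            scaleC_diff_right scaleC_scaleC mult.commute)
      show "(1 / a) *\<^sub>C V ((A $ 1) x) + 0 = x" if "x \<in> H" for x
      proof -
        have "(A $ 1) x = a *\<^sub>C (T x - z *\<^sub>C x)"
          using a0 by (simp add: A z_def scaleC_diff_right scaleC_scaleC)
        then show ?thesis
          using that a0 by (simp add: V_scale V_inv mem_intros scaleC_scaleC)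
      qed
    qed
    then show False using sing by simp
  qed
  have cmod_a: "cmod a = 1 / sqrt (1 + r\<^sup>2)"
    using s(1) by (simp add: a_def norm_divide)
  have "cmod (l $ 1) = cmod z * cmod a"
    using a0 by (simp add: z_def norm_divide)
  also have "\<dots> \<le> 1 * cmod a"
    using \<open>cmod z \<le> 1\<close> by (intro mult_right_mono) auto
  finally show "l \<in> kappa r ` (cball 0 1 - {0})"
    unfolding kappa_image_eq[OF r] using l_eq by (simp add: cmod_a ab)
qed

theorem von_Neumann_set_kappa:
  assumes r: "0 < r"
  shows "von_Neumann_set (kappa r ` (cball 0 1 - {0})) H (kappa_op r H T)"
  unfolding von_Neumann_set_def
proof (intro conjI allI impI)
  show "taylor_spectrum H (kappa_op r H T) \<subseteq> kappa r ` (cball 0 1 - {0})"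
    by (rule taylor_spectrum_kappa_op[OF r])
  fix p g :: "2 cpoly"
  let ?Y = "kappa r ` (cball 0 1 - {0})"
  assume g: "g \<noteq> 0 \<and> (\<forall>\<xi>\<in>?Y. cpoly_eval g \<xi> \<noteq> 0)"
  let ?M = "SUP \<xi>\<in>?Y. ennreal (cmod (cpoly_eval p \<xi> / cpoly_eval g \<xi>))"
  show "op_norm H (rational_op H p g (kappa_op r H T)) \<le> ?M"
  proof (cases ?M)
    case (real M)
    have bound: "cmod (cpoly_eval p (kappa r z)) \<le> M * cmod (cpoly_eval g (kappa r z))"
      if "z \<noteq> 0" "cmod z \<le> 1" for z
    proof -
      have z: "kappa r z \<in> ?Y"
        using that by simp
      have "ennreal (cmod (cpoly_eval p (kappa r z) / cpoly_eval g (kappa r z))) \<le> ?M"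
        using z by (rule SUP_upper)
      then have "cmod (cpoly_eval p (kappa r z) / cpoly_eval g (kappa r z)) \<le> M"
        unfolding real(2) using real(1) by simp
      moreover have "cpoly_eval g (kappa r z) \<noteq> 0"
        using g z by blast
      ultimately show ?thesis
        by (simp add: norm_divide divide_le_eq)
    qed
    have nz: "cpoly_eval g (kappa r z) \<noteq> 0" if "z \<noteq> 0" "cmod z \<le> 1" for z
      using g that by simp
    have "norm (rational_op H p g (kappa_op r H T) x) \<le> M" if "x \<in> H" "norm x \<le> 1" for x
      using rational_op_kappa_op_le[of p r M g x, OF bound nz that(1)]
        mult_left_mono[OF that(2) real(1)] by simp
    then have "op_norm H (rational_op H p g (kappa_op r H T)) \<le> ennreal M"
      by (rule op_norm_leI)
    then show ?thesis
      by (simp only: real(2))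
  next
    case top
    show ?thesis
      unfolding top by (rule top_greatest)
  qed
qed

end

section \<open>The operator classes\<close>

text \<open>Pairing with \<open>x\<close> and moving every adjoint to the other side turns
  positivity into an inequality between norms, the only form used below.\<close>

lemma C_alpha_iff:
  "(H, T) \<in> C_alpha r \<longleftrightarrow> invertible_on H T \<and>
    (\<forall>x\<in>H. (norm (T (T x)))\<^sup>2 + r\<^sup>2 * (norm x)\<^sup>2 \<le> (1 + r\<^sup>2) * (norm (T x))\<^sup>2)"
proof (cases "invertible_on H T")
  case True
  then interpret hilbert_invertible H T by unfold_locales
  have "cinner (- adj_on H T (adj_on H T (T (T x))) + (1 + r\<^sup>2) *\<^sub>R adj_on H T (T x) - r\<^sup>2 *\<^sub>R x) x
    = complex_of_real ((1 + r\<^sup>2) * (norm (T x))\<^sup>2 - ((norm (T (T x)))\<^sup>2 + r\<^sup>2 * (norm x)\<^sup>2))" if "x \<in> H" for x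
    using that by (simp add: cinner_simps cinner_adj_on' cinner_norm)
  then show ?thesis
    using True by (simp add: C_alpha_def positive_on_def nonneg_Reals_def
        flip: of_real_add of_real_mult of_real_diff of_real_power)
qed (simp add: C_alpha_def)

text \<open>If \<open>\<parallel>T x\<parallel> > \<parallel>x\<parallel>\<close>, the defining inequality forces the squared norms of the backward
  orbit of \<open>x\<close> to decrease at least linearly.\<close>

lemma C_alpha_contraction:
  assumes r: "0 < r" "r < 1" and T: "(H, T) \<in> C_alpha r" and x: "x \<in> H"
  shows "norm (T x) \<le> norm x"
proof (rule ccontr)
  assume expands: "\<not> ?thesis"
  interpret hilbert_invertible H T
    using T by unfold_locales (simp add: C_alpha_iff)
  define y where "y = (\<lambda>k. (R ^^ k) x)"
  define D where "D = (\<lambda>k. (norm (T (y k)))\<^sup>2 - (norm (y k))\<^sup>2)"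
  have y_mem: "y k \<in> H" and T_y: "T (y (Suc k)) = y k" for k
    using x by (simp_all add: y_def)
  have D0: "0 < D 0"
    using expands by (simp add: D_def y_def power_strict_mono)
  \<comment> \<open>The defining inequality at \<open>y (Suc k)\<close>. As r < 1, a positive
    \<open>D 0\<close> then keeps all later \<open>D k\<close> at least as large.\<close>
  have D_le: "D k \<le> r\<^sup>2 * D (Suc k)" for k
    using T y_mem[of "Suc k"] by (auto simp: C_alpha_iff D_def T_y algebra_simps)
  have "D 0 \<le> D k" for k
  proof (induction k)
    case (Suc k)
    then have "0 < r\<^sup>2 * D (Suc k)"
      using D0 D_le[of k] by linarith
    then have "0 < D (Suc k)"
      using r by (simp add: zero_less_mult_iff)
    then have "r\<^sup>2 * D (Suc k) \<le> 1 * D (Suc k)"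
      using r by (intro mult_right_mono) (simp_all add: power_le_one)
    then show ?case
      using Suc.IH D_le[of k] by linarith
  qed simp
  have linear: "(norm (y k))\<^sup>2 \<le> (norm x)\<^sup>2 - real k * D 0" for k
  proof (induction k)
    case (Suc k)
    have "D (Suc k) = (norm (y k))\<^sup>2 - (norm (y (Suc k)))\<^sup>2"
      by (simp add: D_def T_y)
    then show ?case
      using Suc.IH \<open>D 0 \<le> D (Suc k)\<close> by (simp add: algebra_simps)
  qed (simp add: y_def)
  have "real k * D 0 \<le> (norm x)\<^sup>2" for k
    using linear[of k] zero_le_power2[of "norm (y k)"] by linarith
  moreover obtain k :: nat where "(norm x)\<^sup>2 / D 0 < real k"
    using reals_Archimedean2 by blast
  ultimately show False
    using D0 by (simp add: divide_less_eq not_less[symmetric])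
qed

lemma hilbert_invertible_contractionI:
  assumes "invertible_on H T" "\<And>x. x \<in> H \<Longrightarrow> norm (T x) \<le> norm x"
  shows "hilbert_invertible_contraction H T"
proof -
  interpret hilbert_invertible H T
    using assms(1) by unfold_locales
  show ?thesis
    by unfold_locales (rule assms(2))
qed

text \<open>\<open>inv_into\<close> and \<open>adj_on\<close> agree with explicit operators on
  \<open>H\<close> only; this transfers boundedness and linearity to them.\<close>

lemma operator_on_cong:
  assumes "operator_on H S" "\<And>x. x \<in> H \<Longrightarrow> T x = S x"
  shows "operator_on H T"
proof -
  interpret hilbert_operator H S using assms(1) by unfold_locales
  show ?thesis
    using assms op_bounded unfolding operator_on_def by (auto simp: add_mem scaleC_mem)
qed

lemma invertible_onI:
  assumes T: "operator_on H T" and S: "operator_on H S"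
    and "\<And>x. x \<in> H \<Longrightarrow> T (S x) = x" "\<And>x. x \<in> H \<Longrightarrow> S (T x) = x"
  shows "invertible_on H T" "\<And>x. x \<in> H \<Longrightarrow> inv_into H T x = S x"
proof -
  interpret T: hilbert_operator H T using T by unfold_locales
  interpret S: hilbert_operator H S using S by unfold_locales
  have bij: "bij_betw T H H"
    by (rule bij_betw_byWitness[of _ S]) (use assms(3,4) in auto)
  show inv: "inv_into H T x = S x" if "x \<in> H" for x
    using that assms(3)[OF that] bij by (metis S.op_mem bij_betw_inv_into_left)
  show "invertible_on H T"
    unfolding invertible_on_def using T bij operator_on_cong[OF S inv] by blast
qed

text \<open>The inverse of \<open>T\<close> is the adjoint of the inverse of its adjoint, checked
  weakly against vectors of \<open>H\<close>. Contractivity passes from the adjoint to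
  \<open>T\<close> because the square of \<open>norm (T x)\<close> is the pairing of
  \<open>x\<close> with the adjoint applied to \<open>T x\<close>.\<close>

lemma C_alpha_star_invertible_contraction:
  assumes r: "0 < r" "r < 1" and T: "(H, T) \<in> C_alpha_star r"
  shows "hilbert_invertible_contraction H T"
proof -
  interpret T: hilbert_operator H T
    using T by unfold_locales (simp add: C_alpha_star_def)
  let ?S = "adj_on H T"
  have S: "(H, ?S) \<in> C_alpha r"
    using T by (simp add: C_alpha_star_def)
  interpret S: hilbert_invertible H ?S
    using S by unfold_locales (simp add: C_alpha_iff)
  let ?V = "adj_on H (inv_into H ?S)"
  show ?thesis
  proof (rule hilbert_invertible_contractionI)
    show "invertible_on H T"
    proof (rule invertible_onI(1)[OF T.operator_on S.inverse.operator_on_adj])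
      show "T (?V x) = x" if "x \<in> H" for x
      proof (rule T.eq_if_cinner_eq)
        show "cinner y (T (?V x)) = cinner y x" if "y \<in> H" for y
          using that \<open>x \<in> H\<close> by (simp flip: T.cinner_adj_on' S.inverse.cinner_adj_on)
      qed (use that in simp_all)
      show "?V (T x) = x" if "x \<in> H" for x
      proof (rule T.eq_if_cinner_eq)
        show "cinner y (?V (T x)) = cinner y x" if "y \<in> H" for y
          using that \<open>x \<in> H\<close> by (simp flip: T.cinner_adj_on' S.inverse.cinner_adj_on)
      qed (use that in simp_all)
    qed
    show "norm (T x) \<le> norm x" if x: "x \<in> H" for x
    proof (cases "T x = 0")
      case False
      have "(norm (T x))\<^sup>2 = Re (cinner x (?S (T x)))"
        using x by (simp flip: T.cinner_adj_on Re_cinner_self)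
      also have "\<dots> \<le> norm x * norm (?S (T x))"
        using complex_Re_le_cmod cmod_cinner_le by (rule order_trans)
      also have "\<dots> \<le> norm x * norm (T x)"
        using C_alpha_contraction[OF r S] x by (intro mult_left_mono) simp_all
      finally show ?thesis
        using False by (simp add: power2_eq_square)
    qed simp
  qed
qed

lemma C_alpha_invertible_contraction:
  assumes "0 < r" "r < 1" "(H, T) \<in> C_alpha r"
  shows "hilbert_invertible_contraction H T"
  using assms C_alpha_contraction[OF assms]
  by (intro hilbert_invertible_contractionI) (auto simp: C_alpha_iff)

lemma C_1_invertible_contraction:
  assumes "(H, T) \<in> C_1"
  shows "hilbert_invertible_contraction H T"
proof (rule hilbert_invertible_contractionI)
  show inv: "invertible_on H T"
    using assms by (simp add: C_1_def)
  then interpret hilbert_invertible H T by unfold_locales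
  show "norm (T x) \<le> norm x" if "x \<in> H" for x
    using norm_le_if_op_norm_le[OF _ that] assms by (simp add: C_1_def)
qed

lemma C_1r_subset_C_1: "C_1r r \<subseteq> C_1"
  by (auto simp: C_1r_def C_1_def)

lemma C_1rI:
  assumes "invertible_on H T" "\<And>x. x \<in> H \<Longrightarrow> norm (T x) \<le> norm x"
    and "\<And>x. x \<in> H \<Longrightarrow> r * norm x \<le> norm (T x)" "0 \<le> r"
  shows "(H, T) \<in> C_1r r"
proof -
  interpret hilbert_invertible H T
    using assms(1) by unfold_locales
  have "norm (r *\<^sub>R R x) \<le> 1" if "x \<in> H" "norm x \<le> 1" for x
    using assms(3)[of "R x"] that assms(4) by simp
  moreover have "norm (T x) \<le> 1" if "x \<in> H" "norm x \<le> 1" for x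
    using assms(2)[of x] that by simp
  ultimately show ?thesis
    using assms(1) op_norm_leI[of H T 1] op_norm_leI[of H "\<lambda>x. r *\<^sub>R R x" 1]
    by (simp add: C_1r_def)
qed

section \<open>Scalar operators\<close>

lemma hilbert_subspace_UNIV: "hilbert_subspace (UNIV :: 'h::complex_hilbert set)"
  by (simp add: hilbert_subspace_def)

lemma operator_on_scalar: "operator_on (UNIV :: 'h::complex_hilbert set) (\<lambda>x. a *\<^sub>C x)"
  by (auto simp: operator_on_def hilbert_subspace_UNIV scaleC_add_right scaleC_scaleC mult.commute
      intro!: exI[of _ "cmod a"])

lemma
  assumes "a \<noteq> 0"
  shows invertible_on_scalar: "invertible_on (UNIV :: 'h::complex_hilbert set) (\<lambda>x. a *\<^sub>C x)"
    and inv_into_scalar: "inv_into (UNIV :: 'h set) (\<lambda>x. a *\<^sub>C x) x = inverse a *\<^sub>C x"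
  using invertible_onI[OF operator_on_scalar[of a] operator_on_scalar[of "inverse a"]] assms
  by (simp_all add: scaleC_scaleC)

lemma adj_on_scalar: "adj_on (UNIV :: 'h::complex_hilbert set) (\<lambda>x. a *\<^sub>C x) = (\<lambda>x. cnj a *\<^sub>C x)"
proof
  fix y :: 'h
  interpret hilbert_operator "UNIV :: 'h set" "\<lambda>x. a *\<^sub>C x"
    by unfold_locales (rule operator_on_scalar)
  show "adj_on UNIV (\<lambda>x. a *\<^sub>C x) y = cnj a *\<^sub>C y"
    by (rule adj_on_eqI) (simp_all add: cinner_simps)
qed

text \<open>For a scalar the inequality of \<open>C_alpha\<close> reads (1 - |a|^2)(|a|^2 - r^2) >=
  0. It sees only the modulus, so the same computation covers the adjoint scalar
  \<open>cnj a\<close>.\<close>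

lemma scalar_mem_classes:
  fixes T :: "'h::complex_hilbert \<Rightarrow> 'h"
  assumes r: "0 < r" and a: "r \<le> cmod a" "cmod a \<le> 1"
  defines "T \<equiv> (\<lambda>x. a *\<^sub>C x)"
  shows "(UNIV, T) \<in> C_alpha r" "(UNIV, T) \<in> C_alpha_star r" "(UNIV, T) \<in> C_1r r"
proof -
  have a0: "b \<noteq> 0" if "cmod b = cmod a" for b
    using r a that by auto
  have C_alpha: "(UNIV, \<lambda>x::'h. b *\<^sub>C x) \<in> C_alpha r" if b: "cmod b = cmod a" for b
  proof -
    have "0 \<le> (1 - (cmod a)\<^sup>2) * ((cmod a)\<^sup>2 - r\<^sup>2)"
      using r a by (intro mult_nonneg_nonneg) (auto simp: power_mono power_le_one)
    then have "0 \<le> ((1 - (cmod a)\<^sup>2) * ((cmod a)\<^sup>2 - r\<^sup>2)) * (norm x)\<^sup>2" for x :: 'h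
      by simp
    then show ?thesis
      unfolding C_alpha_iff
      using invertible_on_scalar[OF a0[OF b], where 'h = 'h]
      by (simp add: b power_mult_distrib algebra_simps)
  qed
  show "(UNIV, T) \<in> C_alpha r"
    unfolding T_def by (rule C_alpha) simp
  show "(UNIV, T) \<in> C_alpha_star r"
    unfolding T_def by (simp add: C_alpha_star_def operator_on_scalar adj_on_scalar C_alpha)
  show "(UNIV, T) \<in> C_1r r"
    unfolding T_def
    by (rule C_1rI) (use r a in \<open>auto simp: invertible_on_scalar a0 mult_left_le_one_le intro: mult_right_mono\<close>)
qed

text \<open>Both shifted operators vanish, hence so does the Koszul map; its kernel is everything
  and its range is zero, which differ because of \<open>e\<close>.\<close>

lemma kappa_mem_taylor_spectrum_scalar:
  assumes "a \<noteq> 0" and "(e :: 'h::complex_hilbert) \<noteq> 0"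
  shows "kappa r a \<in> taylor_spectrum UNIV (kappa_op r UNIV (\<lambda>x. a *\<^sub>C (x :: 'h)))"
proof -
  let ?A = "\<chi> i. (\<lambda>x :: 'h. (kappa_op r UNIV (\<lambda>x. a *\<^sub>C x) $ i) x - (kappa r a $ i) *\<^sub>C x)"
  have "(?A $ i) x = 0" for i x
    using exhaust_2[of i] assms(1)
    by (auto simp: kappa_op_nth kappa_nth inv_into_scalar scaleR_scaleC scaleC_scaleC field_simps)
  then have "koszul ?A \<omega> = (\<lambda>_. 0)" for \<omega>
    by (simp add: koszul_def fun_eq_iff)
  then have "\<not> taylor_nonsingular UNIV ?A"
    unfolding taylor_nonsingular_def using assms(2)
    by (auto simp: set_eq_iff fun_eq_iff intro!: exI[of _ "\<lambda>_. e"])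
  then show ?thesis
    by (simp add: taylor_spectrum_def)
qed

section \<open>Weighted shifts on an orthonormal family\<close>

text \<open>\<open>span\<close> is taken over the reals, so the multiples by \<open>\<i>\<close>
  have to be added to the generators.\<close>

lemma span_real_contains_complex_combination:
  fixes f :: "nat \<Rightarrow> 'h::complex_hilbert"
  shows "(\<Sum>m<n. c m *\<^sub>C f m) \<in> span (f ` {..<n} \<union> (\<lambda>x. \<i> *\<^sub>C x) ` f ` {..<n})"
proof (rule span_sum)
  fix m assume m: "m \<in> {..<n}"
  have "c m *\<^sub>C f m = Re (c m) *\<^sub>R f m + Im (c m) *\<^sub>R (\<i> *\<^sub>C f m)"
    by (simp add: scaleR_scaleC scaleC_scaleC mult.commute flip: scaleC_add_left complex_eq)
  then show "c m *\<^sub>C f m \<in> span (f ` {..<n} \<union> (\<lambda>x. \<i> *\<^sub>C x) ` f ` {..<n})"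
    by (simp only:) (intro span_add span_scale span_base; use m in blast)
qed

text \<open>Gram-Schmidt: the real span of finitely many vectors and their multiples by
  \<open>\<i>\<close> is never everything, and the residue of a vector outside it is
  normalised.\<close>

lemma ex_orthonormal_sequence:
  assumes "\<not> (\<exists>B :: 'h::complex_hilbert set. finite B \<and> span B = UNIV)"
  shows "\<exists>E :: nat \<Rightarrow> 'h. \<forall>m n. cinner (E m) (E n) = (if m = n then 1 else 0)"
proof -
  define P where "P = (\<lambda>(f :: nat \<Rightarrow> 'h) n e. cinner e e = 1 \<and> (\<forall>m<n. cinner e (f m) = 0))"
  have "\<exists>f. \<forall>n. P f n (f n)"
  proof (rule dependent_wellorder_choice)
    fix e and f g :: "nat \<Rightarrow> 'h" and n :: nat
    assume "\<And>m. m < n \<Longrightarrow> f m = g m"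
    then show "P f n e = P g n e"
      by (simp add: P_def)
  next
    fix n :: nat and f :: "nat \<Rightarrow> 'h"
    assume "\<And>m. m < n \<Longrightarrow> P f m (f m)"
    then have norm: "cinner (f m) (f m) = 1" and orth: "k < m \<Longrightarrow> cinner (f m) (f k) = 0" if "m < n" for m k
      using that by (auto simp: P_def)
    have orth': "cinner (f k) (f m) = (if k = m then 1 else 0)" if "m < n" "k < n" for m k
    proof (cases m k rule: linorder_cases)
      case greater
      then show ?thesis
        using orth[OF that(1), of k] cinner_commute[of "f k" "f m"] by simp
    qed (use that norm orth in simp_all)
    let ?B = "f ` {..<n} \<union> (\<lambda>x. \<i> *\<^sub>C x) ` f ` {..<n}"
    have "finite ?B"
      by simp
    then obtain x where x: "x \<notin> span ?B"
      using assms by blast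
    define w where "w = x - (\<Sum>m<n. cinner x (f m) *\<^sub>C f m)"
    have "w \<noteq> 0"
      using x span_real_contains_complex_combination[of "\<lambda>m. cinner x (f m)" f n] by (auto simp: w_def)
    have "cinner w (f m) = 0" if m: "m < n" for m
    proof -
      have "(\<Sum>k<n. cinner x (f k) * cinner (f k) (f m)) = (\<Sum>k<n. if k = m then cinner x (f k) else 0)"
        by (rule sum.cong) (use m orth' in auto)
      then show ?thesis
        using m by (simp add: w_def cinner_diff_left cinner_sum_left cinner_scaleC_left)
    qed
    then have "P f n ((1 / norm w) *\<^sub>R w)"
      using \<open>w \<noteq> 0\<close> by (simp add: P_def cinner_scaleR_left cinner_scaleR_right cinner_norm power2_eq_square)
    then show "\<exists>e. P f n e"
      by blast
  qed
  then obtain E where E: "\<And>n. P E n (E n)"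
    by blast
  have "cinner (E m) (E n) = (if m = n then 1 else 0)" for m n
  proof (cases m n rule: linorder_cases)
    case less
    then show ?thesis
      using E[of n] cinner_commute[of "E m" "E n"] by (simp add: P_def)
  qed (use E[of m] in \<open>simp_all add: P_def\<close>)
  then show ?thesis
    by blast
qed

locale orthonormal_family =
  fixes E :: "int \<Rightarrow> 'h::complex_hilbert"
  assumes orthonormal: "cinner (E m) (E n) = (if m = n then 1 else 0)"
begin

text \<open>The double orthogonal complement, that is the closed linear span of the family. In this
  form closedness and determination of a vector by its coefficients are immediate.\<close>

definition H :: "'h set" where
  "H = {x. \<forall>y. (\<forall>n. cinner y (E n) = 0) \<longrightarrow> cinner x y = 0}"

lemma continuous_cinner_left: "continuous_on UNIV (\<lambda>x. cinner x (y :: 'h))"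
proof -
  have "bounded_linear (\<lambda>x. cinner x y)"
    by (rule bounded_linear_intro[of _ "norm y"])
      (simp_all add: cinner_add_left cinner_scaleR_left cmod_cinner_le scaleR_conv_of_real)
  then show ?thesis
    by (rule linear_continuous_on)
qed

lemma closed_H: "closed H"
proof -
  have "H = (\<Inter>y\<in>{y. \<forall>n. cinner y (E n) = 0}. {x. cinner x y = 0})"
    by (auto simp: H_def)
  then show ?thesis
    by (auto intro!: closed_INT closed_Collect_eq continuous_cinner_left continuous_on_const)
qed

sublocale hilbert_space H
  by unfold_locales (use closed_H in \<open>auto simp: hilbert_subspace_def H_def cinner_simps\<close>)

lemma basis_mem [simp]: "E n \<in> H"
proof -
  have "cinner (E n) y = 0" if "\<forall>m. cinner y (E m) = 0" for y
    using that cinner_commute[of "E n" y] by simp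
  then show ?thesis
    by (simp add: H_def)
qed

lemma eq_if_coeff_eq:
  assumes "x \<in> H" "y \<in> H" "\<And>n. cinner x (E n) = cinner y (E n)"
  shows "x = y"
proof -
  have "cinner (x - y) (x - y) = 0"
    using diff_mem[OF assms(1,2)] assms(3) by (simp add: H_def cinner_diff_left)
  then show ?thesis
    by (simp add: cinner_norm)
qed

lemma bessel:
  assumes "finite F"
  shows "(\<Sum>n\<in>F. (cmod (cinner x (E n)))\<^sup>2) \<le> (norm x)\<^sup>2"
proof -
  define v where "v = (\<Sum>n\<in>F. cinner x (E n) *\<^sub>C E n)"
  define S where "S = (\<Sum>n\<in>F. (cmod (cinner x (E n)))\<^sup>2)"
  have 1: "cinner x v = complex_of_real S"
    by (simp add: v_def S_def cinner_sum_right cinner_scaleC_right complex_norm_square mult.commute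
        del: of_real_power)
  have "cinner v (E n) = cinner x (E n)" if "n \<in> F" for n
  proof -
    have "(\<Sum>m\<in>F. cinner x (E m) * cinner (E m) (E n)) = (\<Sum>m\<in>F. if m = n then cinner x (E m) else 0)"
      by (rule sum.cong) (simp_all add: orthonormal)
    then show ?thesis
      using that assms by (simp add: v_def cinner_sum_left cinner_scaleC_left)
  qed
  moreover have "cinner y v = (\<Sum>n\<in>F. cnj (cinner x (E n)) * cinner y (E n))" for y
    by (simp add: v_def cinner_sum_right cinner_scaleC_right)
  ultimately have "cinner v v = cinner x v"
    by simp
  then have "(norm v)\<^sup>2 = S"
    using 1 by (simp add: Re_cinner_self flip: Re_cinner_self)
  have "0 \<le> (norm (x - v))\<^sup>2"
    by simp
  also have "\<dots> = (norm x)\<^sup>2 - S"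
    unfolding norm_diff_square 1 \<open>(norm v)\<^sup>2 = S\<close> by simp
  finally show ?thesis
    by (simp add: S_def)
qed

lemma summable_coeff: "(\<lambda>n. (cmod (cinner x (E n)))\<^sup>2) summable_on UNIV"
  by (rule nonneg_bdd_above_summable_on) (auto intro!: bdd_aboveI2 bessel)

lemma infsum_coeff_le: "(\<Sum>\<^sub>\<infinity>n. (cmod (cinner x (E n)))\<^sup>2) \<le> (norm x)\<^sup>2"
  by (rule infsum_le_finite_sums[OF summable_coeff]) (rule bessel)

text \<open>The vector is obtained from the Riesz representation, which avoids vector-valued series.\<close>

lemma riesz_fischer:
  assumes c: "(\<lambda>n. (cmod (c n))\<^sup>2) summable_on UNIV"
  shows "\<exists>z\<in>H. (\<forall>n. cinner z (E n) = c n) \<and> (norm z)\<^sup>2 = (\<Sum>\<^sub>\<infinity>n. (cmod (c n))\<^sup>2)"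
proof -
  define C where "C = (\<Sum>\<^sub>\<infinity>n. (cmod (c n))\<^sup>2)"
  define \<phi> where "\<phi> = (\<lambda>x. \<Sum>\<^sub>\<infinity>n. cinner x (E n) * cnj (c n))"
  have term_le: "cmod (cinner x (E n) * cnj (c n)) \<le> ((cmod (cinner x (E n)))\<^sup>2 + (cmod (c n))\<^sup>2) / 2" for x n
    using sum_squares_bound[of "cmod (cinner x (E n))" "cmod (c n)"] by (simp add: norm_mult)
  have majorant: "(\<lambda>n. ((cmod (cinner x (E n)))\<^sup>2 + (cmod (c n))\<^sup>2) / 2) summable_on UNIV" for x
    unfolding divide_inverse by (intro summable_on_cmult_left summable_on_add summable_coeff c)
  have abs: "(\<lambda>n. cmod (cinner x (E n) * cnj (c n))) summable_on UNIV" for x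
    by (rule summable_on_comparison_test[OF majorant term_le]) simp
  have sm: "(\<lambda>n. cinner x (E n) * cnj (c n)) summable_on UNIV" for x
    by (rule abs_summable_summable[OF abs])
  have \<phi>_scale: "\<phi> (a *\<^sub>C x) = a * \<phi> x" for a x
    by (simp add: \<phi>_def cinner_scaleC_left mult.assoc infsum_cmult_right')
  have quad: "cmod (\<phi> x) \<le> ((norm x)\<^sup>2 + C) / 2" for x
  proof -
    have "cmod (\<phi> x) \<le> (\<Sum>\<^sub>\<infinity>n. cmod (cinner x (E n) * cnj (c n)))"
      unfolding \<phi>_def by (rule norm_infsum_bound[OF abs])
    also have "\<dots> \<le> (\<Sum>\<^sub>\<infinity>n. ((cmod (cinner x (E n)))\<^sup>2 + (cmod (c n))\<^sup>2) / 2)"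
      by (rule infsum_mono[OF abs majorant]) (rule term_le)
    also have "\<dots> = ((\<Sum>\<^sub>\<infinity>n. (cmod (cinner x (E n)))\<^sup>2) + C) / 2"
      unfolding divide_inverse C_def
      by (subst infsum_cmult_left') (simp add: infsum_add[OF summable_coeff c])
    also have "\<dots> \<le> ((norm x)\<^sup>2 + C) / 2"
      using infsum_coeff_le[of x] by simp
    finally show ?thesis .
  qed
  have "\<exists>z\<in>H. \<forall>x\<in>H. \<phi> x = cinner x z"
  proof (rule riesz_representation)
    show "\<phi> (x + y) = \<phi> x + \<phi> y" for x y
      unfolding \<phi>_def by (simp add: cinner_add_left distrib_right infsum_add[OF sm sm])
    show "\<phi> (a *\<^sub>C x) = a * \<phi> x" for a x
      by (rule \<phi>_scale)
    show "cmod (\<phi> x) \<le> ((1 + C) / 2) * norm x" for x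
    proof (cases "x = 0")
      case True
      then show ?thesis
        using \<phi>_scale[of 0 0] by simp
    next
      case False
      \<comment> \<open>The bound \<open>quad\<close> is not homogeneous; applied to the unit vector
        \<open>u\<close> and scaled back it becomes linear.\<close>
      define u where "u = complex_of_real (1 / norm x) *\<^sub>C x"
      have "cmod (\<phi> u) \<le> (1 + C) / 2"
        using quad[of u] False by (simp add: u_def norm_divide)
      moreover have "cmod (\<phi> u) = cmod (\<phi> x) / norm x"
        unfolding u_def \<phi>_scale by (simp add: norm_mult norm_divide)
      ultimately show ?thesis
        using False by (simp add: divide_le_eq)
    qed
  qed
  then obtain z where z: "z \<in> H" "\<And>x. x \<in> H \<Longrightarrow> \<phi> x = cinner x z"
    by blast
  have coeff: "cinner z (E n) = c n" for n
  proof -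
    have "\<phi> (E n) = (\<Sum>\<^sub>\<infinity>m\<in>{n}. cnj (c m))"
      unfolding \<phi>_def by (rule infsum_cong_neutral) (auto simp: orthonormal)
    then show ?thesis
      using z(2)[of "E n"] cinner_commute[of z "E n"] by simp
  qed
  have "complex_of_real ((norm z)\<^sup>2) = \<phi> z"
    using z by (simp add: cinner_norm)
  also have "\<dots> = (\<Sum>\<^sub>\<infinity>n. complex_of_real ((cmod (c n))\<^sup>2))"
    by (simp add: \<phi>_def coeff complex_norm_square del: of_real_power)
  also have "\<dots> = complex_of_real C"
    unfolding C_def
    by (rule infsumI) (simp only: has_sum_of_real_iff has_sum_infsum[OF c])
  finally have "(norm z)\<^sup>2 = C"
    by (simp only: of_real_eq_iff)
  then show ?thesis
    using z(1) coeff by (auto simp: C_def)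
qed

text \<open>The vector that \<open>riesz_fischer\<close> builds from the coefficients of
  \<open>x\<close> can only be \<open>x\<close>.\<close>

lemma parseval:
  assumes "x \<in> H"
  shows "(norm x)\<^sup>2 = (\<Sum>\<^sub>\<infinity>n. (cmod (cinner x (E n)))\<^sup>2)"
proof -
  obtain z where "z \<in> H" "\<And>n. cinner z (E n) = cinner x (E n)"
    "(norm z)\<^sup>2 = (\<Sum>\<^sub>\<infinity>n. (cmod (cinner x (E n)))\<^sup>2)"
    using riesz_fischer[OF summable_coeff[of x]] by blast
  then show ?thesis
    using eq_if_coeff_eq[of z x] assms by simp
qed

text \<open>Given through coefficients: for bounded nonnegative weights \<open>E n\<close> is sent
  to w (n - k) times \<open>E (n - k)\<close>, so k = -1 is the forward shift.\<close>

definition weighted_shift :: "int \<Rightarrow> (int \<Rightarrow> real) \<Rightarrow> 'h \<Rightarrow> 'h" where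
  "weighted_shift k w x = (SOME z. z \<in> H \<and> (\<forall>n. cinner z (E n) = complex_of_real (w n) * cinner x (E (n + k))))"

end

locale bounded_weights = orthonormal_family +
  fixes w :: "int \<Rightarrow> real" and C :: real
  assumes weight_nonneg: "0 \<le> w n" and weight_le: "w n \<le> C"
begin

lemma summable_shifted_coeff: "(\<lambda>n. (cmod (cinner x (E (n + k))))\<^sup>2) summable_on UNIV"
  using summable_coeff[of x] summable_on_reindex_bij_betw[of "\<lambda>n. n + k" UNIV UNIV "\<lambda>n. (cmod (cinner x (E n)))\<^sup>2"]
  by (simp add: bij_betw_def inj_on_def surj_plus_right)

lemma summable_weighted: "(\<lambda>n. (cmod (complex_of_real (w n) * cinner x (E (n + k))))\<^sup>2) summable_on UNIV"
proof (rule summable_on_comparison_test)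
  show "(\<lambda>n. C\<^sup>2 * (cmod (cinner x (E (n + k))))\<^sup>2) summable_on UNIV"
    by (intro summable_on_cmult_right summable_shifted_coeff)
  show "(cmod (complex_of_real (w n) * cinner x (E (n + k))))\<^sup>2 \<le> C\<^sup>2 * (cmod (cinner x (E (n + k))))\<^sup>2" for n
    using weight_nonneg[of n] weight_le[of n]
    by (simp add: norm_mult power_mult_distrib mult_right_mono power_mono)
qed simp

lemma
  shows weighted_shift_mem: "weighted_shift k w x \<in> H"
    and weighted_shift_coeff: "cinner (weighted_shift k w x) (E n) = complex_of_real (w n) * cinner x (E (n + k))"
proof -
  have "\<exists>z. z \<in> H \<and> (\<forall>n. cinner z (E n) = complex_of_real (w n) * cinner x (E (n + k)))"
    using riesz_fischer[OF summable_weighted[of x k]] by blast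
  from someI_ex[OF this] show "weighted_shift k w x \<in> H"
    "cinner (weighted_shift k w x) (E n) = complex_of_real (w n) * cinner x (E (n + k))"
    unfolding weighted_shift_def by blast+
qed

lemma norm_weighted_shift:
  "(norm (weighted_shift k w x))\<^sup>2 = (\<Sum>\<^sub>\<infinity>n. (w (n - k))\<^sup>2 * (cmod (cinner x (E n)))\<^sup>2)"
proof -
  have "(norm (weighted_shift k w x))\<^sup>2 = (\<Sum>\<^sub>\<infinity>n. (w (n + k - k))\<^sup>2 * (cmod (cinner x (E (n + k))))\<^sup>2)"
    by (simp add: parseval[OF weighted_shift_mem] weighted_shift_coeff norm_mult power_mult_distrib)
  also have "\<dots> = (\<Sum>\<^sub>\<infinity>n. (w (n - k))\<^sup>2 * (cmod (cinner x (E n)))\<^sup>2)"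
    by (rule infsum_reindex_bij_betw[of "\<lambda>n. n + k" UNIV UNIV "\<lambda>n. (w (n - k))\<^sup>2 * (cmod (cinner x (E n)))\<^sup>2"])
      (simp add: bij_betw_def inj_on_def surj_plus_right)
  finally show ?thesis .
qed

lemma summable_bounded_weight:
  assumes "\<And>n. 0 \<le> v n" "\<And>n. v n \<le> (D::real)"
  shows "(\<lambda>n. v n * (cmod (cinner x (E n)))\<^sup>2) summable_on UNIV"
  by (rule summable_on_comparison_test[OF summable_on_cmult_right[OF summable_coeff[of x], of D]])
    (use assms in \<open>auto intro: mult_right_mono\<close>)

lemma norm_weighted_shift_le:
  assumes "x \<in> H"
  shows "norm (weighted_shift k w x) \<le> C * norm x"
proof -
  have C: "0 \<le> C"
    using weight_nonneg[of 0] weight_le[of 0] by linarith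
  have le: "(w n)\<^sup>2 \<le> C\<^sup>2" for n
    using weight_nonneg weight_le by (intro power_mono) auto
  have "(norm (weighted_shift k w x))\<^sup>2 \<le> (\<Sum>\<^sub>\<infinity>n. C\<^sup>2 * (cmod (cinner x (E n)))\<^sup>2)"
    unfolding norm_weighted_shift
    by (intro infsum_mono summable_bounded_weight[of _ "C\<^sup>2"]) (auto intro: le mult_right_mono)
  also have "\<dots> = (C * norm x)\<^sup>2"
    using assms by (simp add: infsum_cmult_right' parseval power_mult_distrib)
  finally show ?thesis
    using C by (simp add: power2_le_iff_abs_le)
qed

lemma operator_on_weighted_shift: "operator_on H (weighted_shift k w)"
proof -
  have "weighted_shift k w (x + y) = weighted_shift k w x + weighted_shift k w y" for x y
    by (rule eq_if_coeff_eq) (simp_all add: weighted_shift_mem weighted_shift_coeff add_mem cinner_add_left distrib_left)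
  moreover have "weighted_shift k w (a *\<^sub>C x) = a *\<^sub>C weighted_shift k w x" for a x
    by (rule eq_if_coeff_eq) (simp_all add: weighted_shift_mem weighted_shift_coeff scaleC_mem cinner_scaleC_left)
  ultimately show ?thesis
    unfolding operator_on_def using hilbert_subspace weighted_shift_mem norm_weighted_shift_le by blast
qed

lemma weighted_shift_basis: "weighted_shift k w (E n) = complex_of_real (w (n - k)) *\<^sub>C E (n - k)"
  by (rule eq_if_coeff_eq)
    (auto simp: weighted_shift_mem weighted_shift_coeff scaleC_mem cinner_scaleC_left orthonormal)

end

section \<open>Polynomials of equal modulus on the unit circle\<close>

text \<open>Together with \<open>blaschke_den\<close> the numerator and denominator of b_a^2 / b_p,
  where b_a(z) = (z - a)/(1 - cnj a z). Each factor of one has a partner of equal modulus on the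
  circle in the other.\<close>

definition blaschke_num :: "complex \<Rightarrow> complex \<Rightarrow> complex poly" where
  "blaschke_num a p = [:- a, 1:] * ([:- a, 1:] * [:1, - cnj p:])"

definition blaschke_den :: "complex \<Rightarrow> complex \<Rightarrow> complex poly" where
  "blaschke_den a p = [:1, - cnj a:] * ([:1, - cnj a:] * [:- p, 1:])"

text \<open>The squared norm in L^2 of the circle once N reaches the degree. The explicit cut-off
  lets two polynomials be summed over the same range.\<close>

definition coeff_sqnorm :: "nat \<Rightarrow> complex poly \<Rightarrow> real" where
  "coeff_sqnorm N Q = (\<Sum>i\<le>N. (cmod (coeff Q i))\<^sup>2)"

lemma cmod_square_swap:
  "(cmod (v - a * u))\<^sup>2 - (cmod (u - cnj a * v))\<^sup>2 = (1 - (cmod a)\<^sup>2) * ((cmod v)\<^sup>2 - (cmod u)\<^sup>2)"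
  unfolding cmod_power2 by (simp add: algebra_simps power2_eq_square)

text \<open>Multiplication by \<open>z - a\<close> and by \<open>1 - cnj a * z\<close> have the same \<open>L\<^sup>2\<close> norm on the unit
  circle, since these factors have equal modulus there.\<close>

lemma coeff_sqnorm_swap:
  assumes "degree Q < N"
  shows "coeff_sqnorm N ([:- a, 1:] * Q) = coeff_sqnorm N ([:1, - cnj a:] * Q)"
proof -
  \<comment> \<open>For an arbitrary cut-off the difference telescopes to a defect seeing only
    \<open>coeff Q N\<close>, which vanishes when N exceeds the degree of \<open>Q\<close>.\<close>
  have "coeff_sqnorm N ([:- a, 1:] * Q) - coeff_sqnorm N ([:1, - cnj a:] * Q)
      = - (1 - (cmod a)\<^sup>2) * (cmod (coeff Q N))\<^sup>2" for N
  proof (induction N)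
    case 0
    then show ?case
      by (simp add: coeff_sqnorm_def norm_mult power_mult_distrib algebra_simps)
  next
    case (Suc N)
    have "coeff_sqnorm (Suc N) ([:- a, 1:] * Q) - coeff_sqnorm (Suc N) ([:1, - cnj a:] * Q)
      = coeff_sqnorm N ([:- a, 1:] * Q) - coeff_sqnorm N ([:1, - cnj a:] * Q)
        + ((cmod (coeff Q N - a * coeff Q (Suc N)))\<^sup>2 - (cmod (coeff Q (Suc N) - cnj a * coeff Q N))\<^sup>2)"
      by (simp add: coeff_sqnorm_def)
    then show ?case
      unfolding Suc.IH cmod_square_swap by (simp add: algebra_simps)
  qed
  from this[of N] show ?thesis
    using coeff_eq_0[OF assms] by (simp only:) simp
qed

lemma degree_linear_mult_le: "degree ([:a, b:] * Q) \<le> Suc (degree Q)"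
  using degree_mult_le[of "[:a, b:]" Q] degree_pCons_le[of a "[:b:]"] by simp

text \<open>Three swaps of one linear factor each, the last in reverse. The cut-off L + 4 exceeds
  the degree of the remaining cofactor, at most L + 2.\<close>

lemma coeff_sqnorm_blaschke:
  assumes "degree Y \<le> L"
  shows "coeff_sqnorm (L + 4) (blaschke_num a p * Y) = coeff_sqnorm (L + 4) (blaschke_den a p * Y)"
proof -
  have deg: "degree ([:b1, c1:] * ([:b2, c2:] * Y)) < L + 4" for b1 b2 c1 c2
    using degree_linear_mult_le[of b1 c1 "[:b2, c2:] * Y"] degree_linear_mult_le[of b2 c2 Y] assms
    by linarith
  have "coeff_sqnorm (L + 4) (blaschke_num a p * Y)
      = coeff_sqnorm (L + 4) ([:- a, 1:] * ([:- a, 1:] * ([:1, - cnj p:] * Y)))"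
    by (simp only: blaschke_num_def mult.assoc)
  also have "\<dots> = coeff_sqnorm (L + 4) ([:1, - cnj a:] * ([:- a, 1:] * ([:1, - cnj p:] * Y)))"
    by (rule coeff_sqnorm_swap[OF deg])
  also have "\<dots> = coeff_sqnorm (L + 4) ([:- a, 1:] * ([:1, - cnj a:] * ([:1, - cnj p:] * Y)))"
    by (simp only: mult.left_commute)
  also have "\<dots> = coeff_sqnorm (L + 4) ([:1, - cnj a:] * ([:1, - cnj a:] * ([:1, - cnj p:] * Y)))"
    by (rule coeff_sqnorm_swap[OF deg])
  also have "\<dots> = coeff_sqnorm (L + 4) ([:1, - cnj p:] * ([:1, - cnj a:] * ([:1, - cnj a:] * Y)))"
    by (simp only: mult.left_commute)
  also have "\<dots> = coeff_sqnorm (L + 4) ([:- p, 1:] * ([:1, - cnj a:] * ([:1, - cnj a:] * Y)))"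
    by (rule coeff_sqnorm_swap[OF deg, symmetric])
  also have "\<dots> = coeff_sqnorm (L + 4) (blaschke_den a p * Y)"
    by (simp only: blaschke_den_def mult_ac)
  finally show ?thesis .
qed

text \<open>Truncation of 1/(1 - c z). For c = cnj p it cancels the factor 1 - cnj p z of the
  numerator up to one high-order term.\<close>

definition geometric_poly :: "complex \<Rightarrow> nat \<Rightarrow> complex poly" where
  "geometric_poly c L = (\<Sum>n\<le>L. monom (c ^ n) n)"

lemma geometric_poly_mult: "[:1, - c:] * geometric_poly c L = 1 - monom (c ^ Suc L) (Suc L)"
proof -
  have factor: "[:1, - c:] * monom b n = monom b n - monom (c * b) (Suc n)" for b n
    by (simp add: monom_Suc smult_monom flip: minus_monom)
  show ?thesis
  proof (induction L)
    case 0
    then show ?case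
      by (simp add: geometric_poly_def monom_Suc monom_0 one_pCons)
  next
    case (Suc L)
    have "[:1, - c:] * geometric_poly c (Suc L)
        = [:1, - c:] * geometric_poly c L + [:1, - c:] * monom (c ^ Suc L) (Suc L)"
      by (simp add: geometric_poly_def distrib_left)
    then show ?case
      by (simp only: Suc.IH factor) simp
  qed
qed

lemma coeff_geometric_poly: "n \<le> L \<Longrightarrow> coeff (geometric_poly c L) n = c ^ n"
  by (simp add: geometric_poly_def coeff_sum)

lemma degree_geometric_poly: "degree (geometric_poly c L) \<le> L"
  unfolding geometric_poly_def by (rule degree_sum_le) (auto intro: order_trans[OF degree_monom_le])

lemma degree_blaschke_mult_le:
  "degree (blaschke_num a p * Q) \<le> degree Q + 3" "degree (blaschke_den a p * Q) \<le> degree Q + 3"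
proof -
  have "degree ([:b1, c1:] * ([:b2, c2:] * ([:b3, c3:] * Q))) \<le> degree Q + 3" for b1 b2 b3 c1 c2 c3
    using degree_linear_mult_le[of b1 c1 "[:b2, c2:] * ([:b3, c3:] * Q)"]
      degree_linear_mult_le[of b2 c2 "[:b3, c3:] * Q"] degree_linear_mult_le[of b3 c3 Q] by linarith
  then show "degree (blaschke_num a p * Q) \<le> degree Q + 3" "degree (blaschke_den a p * Q) \<le> degree Q + 3"
    unfolding blaschke_num_def blaschke_den_def mult.assoc by blast+
qed

text \<open>The coefficient is the value at cnj p of the reversed denominator (z - cnj a)^2 (1 - p
  z). It is nonzero for |p| < 1 and p different from a.\<close>

lemma coeff_blaschke_den_3:
  assumes "3 \<le> L"
  shows "coeff (blaschke_den a p * geometric_poly (cnj p) L) 3 = (cnj p - cnj a)\<^sup>2 * (1 - p * cnj p)"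
proof -
  have den: "blaschke_den a p = [:- p, 1 + 2 * cnj a * p, - (2 * cnj a + (cnj a)\<^sup>2 * p), (cnj a)\<^sup>2:]"
    by (simp add: blaschke_den_def algebra_simps power2_eq_square)
  have "coeff (blaschke_den a p * geometric_poly (cnj p) L) 3
    = (\<Sum>i\<le>3. coeff (blaschke_den a p) i * cnj p ^ (3 - i))"
    unfolding coeff_mult by (rule sum.cong) (use assms in \<open>auto simp: coeff_geometric_poly\<close>)
  also have "\<dots> = (cnj p - cnj a)\<^sup>2 * (1 - p * cnj p)"
    by (simp add: den numeral_eq_Suc algebra_simps)
  finally show ?thesis .
qed

text \<open>The product is (z - a)^2 minus the truncation error, the same quadratic multiplied by
  (cnj p z)^(L + 1). From index 3 on only the error survives, at three indices, and 2 bounds the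
  coefficients of the quadratic.\<close>

lemma coeff_blaschke_num_le:
  assumes "cmod a \<le> 1" "3 \<le> i"
  shows "(cmod (coeff (blaschke_num a p * geometric_poly (cnj p) L) i))\<^sup>2
    \<le> (if i \<in> {Suc L..L + 3} then 4 * (cmod p ^ Suc L)\<^sup>2 else 0)"
proof -
  define A where "A = [:a\<^sup>2, - 2 * a, 1:]"
  have A: "[:- a, 1:] * [:- a, 1:] = A"
    by (simp add: A_def power2_eq_square)
  have "blaschke_num a p * geometric_poly (cnj p) L = A * ([:1, - cnj p:] * geometric_poly (cnj p) L)"
    by (simp only: blaschke_num_def A[symmetric] mult.assoc)
  also have "\<dots> = A - monom (cnj p ^ Suc L) (Suc L) * A"
    unfolding geometric_poly_mult by (simp add: algebra_simps)
  finally have eq: "blaschke_num a p * geometric_poly (cnj p) L = A - monom (cnj p ^ Suc L) (Suc L) * A" .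
  have degA: "coeff A j = 0" if "3 \<le> j" for j
    using that by (intro coeff_eq_0) (simp add: A_def)
  have cmodA: "cmod (coeff A j) \<le> 2" for j
  proof -
    consider "j = 0" | "j = 1" | "j = 2" | "3 \<le> j" by linarith
    then show ?thesis
    proof cases
      case 1
      then show ?thesis
        using assms(1) power_le_one[of "cmod a" 2] by (simp add: A_def norm_power)
    qed (use assms(1) degA in \<open>auto simp: A_def norm_mult numeral_2_eq_2\<close>)
  qed
  have "coeff (blaschke_num a p * geometric_poly (cnj p) L) i
      = - (if i < Suc L then 0 else cnj p ^ Suc L * coeff A (i - Suc L))"
    unfolding eq by (simp add: coeff_monom_mult degA[OF assms(2)])
  then have "cmod (coeff (blaschke_num a p * geometric_poly (cnj p) L) i)
      \<le> (if i \<in> {Suc L..L + 3} then 2 * cmod p ^ Suc L else 0)"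
    using mult_left_mono[OF cmodA[of "i - Suc L"] norm_ge_zero[of "cnj p ^ Suc L"]] degA[of "i - Suc L"]
    by (auto simp: norm_mult norm_power)
  then have "(cmod (coeff (blaschke_num a p * geometric_poly (cnj p) L) i))\<^sup>2
      \<le> (if i \<in> {Suc L..L + 3} then 2 * cmod p ^ Suc L else 0)\<^sup>2"
    by (intro power_mono) auto
  also have "\<dots> = (if i \<in> {Suc L..L + 3} then 4 * (cmod p ^ Suc L)\<^sup>2 else 0)"
    by (simp add: power_mult_distrib)
  finally show ?thesis .
qed

text \<open>The weight \<open>u\<close> ignores indices up to 2, where the numerator product lives
  apart from its truncation error, but sees index 3, where the denominator product does not vanish.
  The hypothesis \<open>lim\<close> says that the error decays faster than \<open>u\<close>
  grows.\<close>

lemma blaschke_weight_gap: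
  fixes u :: "nat \<Rightarrow> real"
  assumes a: "cmod a \<le> 1" and p: "cmod p < 1" "p \<noteq> a"
    and u: "mono u" "\<And>i. i \<le> 2 \<Longrightarrow> u i = 0" "0 < u 3"
    and lim: "(\<lambda>L. (cmod p ^ Suc L)\<^sup>2 * u (L + 3)) \<longlonglongrightarrow> 0"
  obtains N Y where "degree (blaschke_num a p * Y) \<le> N" "degree (blaschke_den a p * Y) \<le> N"
    "coeff_sqnorm N (blaschke_num a p * Y) = coeff_sqnorm N (blaschke_den a p * Y)"
    "(\<Sum>i\<le>N. (cmod (coeff (blaschke_num a p * Y) i))\<^sup>2 * u i)
      < (\<Sum>i\<le>N. (cmod (coeff (blaschke_den a p * Y) i))\<^sup>2 * u i)"
proof -
  define K where "K = (cmod ((cnj p - cnj a)\<^sup>2 * (1 - p * cnj p)))\<^sup>2 * u 3"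
  have "(1 - p * cnj p) \<noteq> 0"
  proof
    assume "1 - p * cnj p = 0"
    then have "(cmod p)\<^sup>2 = 1"
      by (simp flip: complex_norm_square) (metis of_real_1 of_real_eq_iff of_real_power)
    then show False
      using p(1) power_strict_mono[of "cmod p" 1 2] by simp
  qed
  then have "0 < K"
    using p(2) u(3) by (simp add: K_def)
  \<comment> \<open>Three error indices times the coefficient bound 4; \<open>K\<close> is the
    contribution of index 3 for the denominator.\<close>
  have "(\<lambda>L. 12 * ((cmod p ^ Suc L)\<^sup>2 * u (L + 3))) \<longlonglongrightarrow> 0"
    using tendsto_mult_left[OF lim, of 12] by simp
  then have "\<forall>\<^sub>F L in sequentially. 12 * ((cmod p ^ Suc L)\<^sup>2 * u (L + 3)) < K"
    using \<open>0 < K\<close> by (rule order_tendstoD)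
  then have "\<forall>\<^sub>F L in sequentially. 12 * ((cmod p ^ Suc L)\<^sup>2 * u (L + 3)) < K \<and> 3 \<le> L"
    by (intro eventually_conj eventually_ge_at_top)
  then obtain L where L: "12 * ((cmod p ^ Suc L)\<^sup>2 * u (L + 3)) < K" "3 \<le> L"
    by (auto simp: eventually_sequentially)
  define Y where "Y = geometric_poly (cnj p) L"
  define N where "N = L + 4"
  have u_nonneg: "0 \<le> u i" for i
    using monoD[OF u(1), of 0 i] u(2)[of 0] by simp
  have degY: "degree Y \<le> L"
    unfolding Y_def by (rule degree_geometric_poly)
  have "(\<Sum>i\<le>N. (cmod (coeff (blaschke_num a p * Y) i))\<^sup>2 * u i)
    \<le> (\<Sum>i\<le>N. if i \<in> {Suc L..L + 3} then 4 * (cmod p ^ Suc L)\<^sup>2 * u (L + 3) else 0)"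
  proof (rule sum_mono)
    fix i
    show "(cmod (coeff (blaschke_num a p * Y) i))\<^sup>2 * u i
      \<le> (if i \<in> {Suc L..L + 3} then 4 * (cmod p ^ Suc L)\<^sup>2 * u (L + 3) else 0)"
    proof (cases "i \<le> 2")
      case True
      then show ?thesis
        using u(2)[OF True] u_nonneg by simp
    next
      case False
      then have "(cmod (coeff (blaschke_num a p * Y) i))\<^sup>2
          \<le> (if i \<in> {Suc L..L + 3} then 4 * (cmod p ^ Suc L)\<^sup>2 else 0)"
        unfolding Y_def by (intro coeff_blaschke_num_le a) simp
      from mult_right_mono[OF this u_nonneg[of i]] have le: "(cmod (coeff (blaschke_num a p * Y) i))\<^sup>2 * u i
          \<le> (if i \<in> {Suc L..L + 3} then 4 * (cmod p ^ Suc L)\<^sup>2 else 0) * u i" .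
      show ?thesis
      proof (cases "i \<in> {Suc L..L + 3}")
        case False
        then show ?thesis
          using le by (simp only: if_False mult_zero_left)
      next
        case True
        have "4 * (cmod p ^ Suc L)\<^sup>2 * u i \<le> 4 * (cmod p ^ Suc L)\<^sup>2 * u (L + 3)"
          using True by (intro mult_left_mono monoD[OF u(1)]) simp_all
        then show ?thesis
          using le True by simp
      qed
    qed
  qed
  also have "\<dots> = (\<Sum>i\<in>{Suc L..L + 3}. 4 * (cmod p ^ Suc L)\<^sup>2 * u (L + 3))"
  proof -
    have "{..N} \<inter> {Suc L..L + 3} = {Suc L..L + 3}"
      by (auto simp: N_def)
    then show ?thesis
      by (simp only: sum.inter_restrict[OF finite_atMost, symmetric])
  qed
  also have "\<dots> = 12 * ((cmod p ^ Suc L)\<^sup>2 * u (L + 3))"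
    by simp
  also have "\<dots> < K"
    by (rule L(1))
  also have "K = (cmod (coeff (blaschke_den a p * Y) 3))\<^sup>2 * u 3"
    unfolding K_def Y_def coeff_blaschke_den_3[OF L(2)] ..
  also have "\<dots> \<le> (\<Sum>i\<le>N. (cmod (coeff (blaschke_den a p * Y) i))\<^sup>2 * u i)"
    by (rule member_le_sum) (use u_nonneg in \<open>auto simp: N_def\<close>)
  finally have gap: "(\<Sum>i\<le>N. (cmod (coeff (blaschke_num a p * Y) i))\<^sup>2 * u i)
      < (\<Sum>i\<le>N. (cmod (coeff (blaschke_den a p * Y) i))\<^sup>2 * u i)" .
  show ?thesis
  proof (rule that[OF _ _ _ gap])
    show "degree (blaschke_num a p * Y) \<le> N" "degree (blaschke_den a p * Y) \<le> N"
      using degree_blaschke_mult_le[of a p Y] degY by (simp_all add: N_def)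
    show "coeff_sqnorm N (blaschke_num a p * Y) = coeff_sqnorm N (blaschke_den a p * Y)"
      unfolding N_def by (rule coeff_sqnorm_blaschke[OF degY])
  qed
qed

section \<open>Bilateral shifts with two weights\<close>

lemma invertible_on_cong:
  assumes "invertible_on H S" "\<And>x. x \<in> H \<Longrightarrow> T x = S x"
  shows "invertible_on H T"
proof -
  interpret hilbert_invertible H S
    using assms(1) by unfold_locales
  show ?thesis
    using invertible_onI(1)[OF operator_on_cong[OF operator_on assms(2)] inverse.operator_on] assms(2)
    by simp
qed

lemma power_diff_Suc:
  fixes x :: real
  assumes "Suc 0 < i"
  shows "x ^ (i - Suc 0) = x ^ (i - 2) * x"
proof -
  have "i - Suc 0 = Suc (i - 2)"
    using assms by simp
  then show ?thesis
    by (simp only: power_Suc2)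
qed

context bounded_weights
begin

text \<open>All three norms are diagonal in the coefficients, so one inequality between weights per
  index suffices.\<close>

lemma C_alpha_inequality:
  assumes w: "\<And>n. (w (n - 2 * k))\<^sup>2 * (w (n - k))\<^sup>2 + r\<^sup>2 \<le> (1 + r\<^sup>2) * (w (n - k))\<^sup>2" and x: "x \<in> H"
  shows "(norm (weighted_shift k w (weighted_shift k w x)))\<^sup>2 + r\<^sup>2 * (norm x)\<^sup>2
    \<le> (1 + r\<^sup>2) * (norm (weighted_shift k w x))\<^sup>2"
proof -
  let ?c = "\<lambda>n. (cmod (cinner x (E n)))\<^sup>2"
  let ?v = "\<lambda>n. (w (n - 2 * k))\<^sup>2 * (w (n - k))\<^sup>2"
  have sq_le: "(w n)\<^sup>2 \<le> C\<^sup>2" for n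
    using weight_nonneg weight_le by (intro power_mono) auto
  have v_le: "?v n \<le> C\<^sup>2 * C\<^sup>2" for n
    by (intro mult_mono sq_le) simp_all
  have "(norm (weighted_shift k w (weighted_shift k w x)))\<^sup>2
      = (\<Sum>\<^sub>\<infinity>n. (w (n + k - 2 * k))\<^sup>2 * (w (n + k - k))\<^sup>2 * ?c (n + k))"
    unfolding norm_weighted_shift
    by (simp add: weighted_shift_coeff norm_mult power_mult_distrib mult.assoc)
  also have "\<dots> = (\<Sum>\<^sub>\<infinity>n. ?v n * ?c n)"
    by (rule infsum_reindex_bij_betw[of "\<lambda>n. n + k" UNIV UNIV "\<lambda>n. ?v n * ?c n"])
      (simp add: bij_betw_def inj_on_def surj_plus_right)
  finally have "(norm (weighted_shift k w (weighted_shift k w x)))\<^sup>2 + r\<^sup>2 * (norm x)\<^sup>2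
      = (\<Sum>\<^sub>\<infinity>n. ?v n * ?c n) + (\<Sum>\<^sub>\<infinity>n. r\<^sup>2 * ?c n)"
    using x by (simp add: parseval infsum_cmult_right')
  also have "\<dots> = (\<Sum>\<^sub>\<infinity>n. ?v n * ?c n + r\<^sup>2 * ?c n)"
    by (rule infsum_add[symmetric])
      (auto intro!: summable_bounded_weight[OF _ v_le] summable_on_cmult_right summable_coeff)
  also have "\<dots> \<le> (\<Sum>\<^sub>\<infinity>n. (1 + r\<^sup>2) * ((w (n - k))\<^sup>2 * ?c n))"
  proof (rule infsum_mono)
    show "(\<lambda>n. ?v n * ?c n + r\<^sup>2 * ?c n) summable_on UNIV"
      by (auto intro!: summable_on_add summable_bounded_weight[OF _ v_le] summable_on_cmult_right summable_coeff)
    show "(\<lambda>n. (1 + r\<^sup>2) * ((w (n - k))\<^sup>2 * ?c n)) summable_on UNIV"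
      by (intro summable_on_cmult_right summable_bounded_weight[OF _ sq_le]) simp
    show "?v n * ?c n + r\<^sup>2 * ?c n \<le> (1 + r\<^sup>2) * ((w (n - k))\<^sup>2 * ?c n)" for n
      using mult_right_mono[OF w[of n], of "?c n"] by (simp add: distrib_right mult.assoc)
  qed
  also have "\<dots> = (1 + r\<^sup>2) * (norm (weighted_shift k w x))\<^sup>2"
    unfolding norm_weighted_shift by (rule infsum_cmult_right')
  finally show ?thesis .
qed

lemma norm_weighted_shift_ge:
  assumes "x \<in> H" "0 \<le> d" "\<And>n. d \<le> w n"
  shows "d * norm x \<le> norm (weighted_shift k w x)"
proof -
  have le: "(w n)\<^sup>2 \<le> C\<^sup>2" "d\<^sup>2 \<le> (w n)\<^sup>2" for n
    using weight_nonneg weight_le assms(2,3) by (auto intro!: power_mono)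
  have "(d * norm x)\<^sup>2 = (\<Sum>\<^sub>\<infinity>n. d\<^sup>2 * (cmod (cinner x (E n)))\<^sup>2)"
    using assms by (simp add: infsum_cmult_right' parseval power_mult_distrib)
  also have "\<dots> \<le> (norm (weighted_shift k w x))\<^sup>2"
    unfolding norm_weighted_shift
    by (intro infsum_mono summable_bounded_weight[of _ "C\<^sup>2"] summable_on_cmult_right summable_coeff)
      (auto intro: le mult_right_mono)
  finally show ?thesis
    by (simp add: power2_le_iff_abs_le)
qed

context
  fixes d :: real
  assumes d: "0 < d" "\<And>n. d \<le> w n"
begin

lemma weight_nonzero: "w n \<noteq> 0"
  using less_le_trans[OF d(1) d(2)[of n]] by simp

lemma bounded_weights_inverse: "bounded_weights E (\<lambda>n. 1 / w (n - k)) (1 / d)"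
  by unfold_locales (auto simp: weight_nonneg intro!: frac_le d)

lemma weighted_shift_inverse:
  assumes "x \<in> H"
  shows "weighted_shift k w (weighted_shift (- k) (\<lambda>n. 1 / w (n - k)) x) = x"
    and "weighted_shift (- k) (\<lambda>n. 1 / w (n - k)) (weighted_shift k w x) = x"
proof -
  interpret v: bounded_weights E "\<lambda>n. 1 / w (n - k)" "1 / d"
    by (rule bounded_weights_inverse)
  show "weighted_shift k w (weighted_shift (- k) (\<lambda>n. 1 / w (n - k)) x) = x"
    by (rule eq_if_coeff_eq)
      (simp_all add: assms weighted_shift_mem weighted_shift_coeff v.weighted_shift_coeff weight_nonzero)
  show "weighted_shift (- k) (\<lambda>n. 1 / w (n - k)) (weighted_shift k w x) = x"
    by (rule eq_if_coeff_eq)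
      (simp_all add: assms v.weighted_shift_mem weighted_shift_coeff v.weighted_shift_coeff weight_nonzero)
qed

lemma invertible_on_weighted_shift: "invertible_on H (weighted_shift k w)"
  using bounded_weights.operator_on_weighted_shift[OF bounded_weights_inverse]
  by (intro invertible_onI(1)[OF operator_on_weighted_shift _ weighted_shift_inverse])

end

text \<open>The coefficients of the adjoint are pairings of \<open>x\<close> with the shifted basis
  vectors; real weights need no conjugation.\<close>

lemma adj_on_weighted_shift:
  assumes "x \<in> H"
  shows "adj_on H (weighted_shift k w) x = weighted_shift (- k) (\<lambda>n. w (n - k)) x"
proof -
  interpret T: hilbert_operator H "weighted_shift k w"
    by unfold_locales (rule operator_on_weighted_shift)
  interpret v: bounded_weights E "\<lambda>n. w (n - k)" C
    by unfold_locales (simp_all add: weight_nonneg weight_le)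
  show ?thesis
  proof (rule eq_if_coeff_eq)
    show "cinner (adj_on H (weighted_shift k w) x) (E n)
      = cinner (weighted_shift (- k) (\<lambda>n. w (n - k)) x) (E n)" for n
      using assms by (simp add: T.cinner_adj_on' v.weighted_shift_coeff weighted_shift_basis cinner_scaleC_right)
  qed (use assms v.weighted_shift_mem in simp_all)
qed

lemma funpow_weighted_shift_basis:
  assumes "W 0 = 1" "\<And>i. W (Suc i) = W i * w (n - int (Suc i) * k)"
  shows "(weighted_shift k w ^^ i) (E n) = complex_of_real (W i) *\<^sub>C E (n - int i * k)"
proof -
  interpret T: hilbert_operator H "weighted_shift k w"
    by unfold_locales (rule operator_on_weighted_shift)
  show ?thesis
  proof (induction i)
    case (Suc i)
    have eq: "n - int (Suc i) * k = n - int i * k - k"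
      by (simp add: algebra_simps)
    show ?case
      unfolding assms(2) eq by (simp add: Suc.IH T.op_scaleC weighted_shift_basis scaleC_scaleC)
  qed (simp add: assms(1))
qed

text \<open>The orbit of a basis vector consists of orthogonal multiples of basis vectors, so a
  polynomial of the shift acts on it as a weighted l^2 space of coefficients, with \<open>W\<close>
  the running products of the weights.\<close>

lemma norm_poly_op_weighted_shift:
  assumes W: "W 0 = 1" "\<And>i. W (Suc i) = W i * w (n - int (Suc i) * k)"
    and k: "k \<noteq> 0" and N: "degree Q \<le> N"
  shows "(norm (poly_op Q (weighted_shift k w) (E n)))\<^sup>2 = (\<Sum>i\<le>N. (cmod (coeff Q i))\<^sup>2 * (W i)\<^sup>2)"
proof -
  define v where "v = (\<Sum>i\<le>N. (coeff Q i * complex_of_real (W i)) *\<^sub>C E (n - int i * k))"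
  have "poly_op Q (weighted_shift k w) (E n) = v"
    unfolding v_def poly_op_eq_sum[OF N] funpow_weighted_shift_basis[OF W] scaleC_scaleC ..
  moreover have "cinner v v = complex_of_real (\<Sum>i\<le>N. (cmod (coeff Q i))\<^sup>2 * (W i)\<^sup>2)"
  proof -
    have "cinner v (E (n - int j * k)) = coeff Q j * complex_of_real (W j)" if "j \<le> N" for j
    proof -
      have "cinner v (E (n - int j * k)) = (\<Sum>i\<le>N. if i = j then coeff Q i * complex_of_real (W i) else 0)"
        unfolding v_def cinner_sum_left cinner_scaleC_left
        by (rule sum.cong) (use k in \<open>auto simp: orthonormal\<close>)
      then show ?thesis
        using that by simp
    qed
    moreover have "cinner v v = (\<Sum>j\<le>N. cnj (coeff Q j * complex_of_real (W j)) * cinner v (E (n - int j * k)))"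
      by (subst (2) v_def) (simp add: cinner_sum_right cinner_scaleC_right)
    ultimately have "cinner v v = (\<Sum>j\<le>N. cnj (coeff Q j * complex_of_real (W j)) * (coeff Q j * complex_of_real (W j)))"
      by simp
    also have "\<dots> = (\<Sum>j\<le>N. complex_of_real ((cmod (coeff Q j))\<^sup>2 * (W j)\<^sup>2))"
      by (rule sum.cong[OF refl], simp only: of_real_mult complex_norm_square)
        (simp add: power2_eq_square mult_ac)
    finally show ?thesis
      by simp
  qed
  ultimately show ?thesis
    by (simp add: cinner_norm del: of_real_sum of_real_power of_real_mult)
qed

end

context orthonormal_family
begin

context
  fixes r :: real
  assumes r: "0 < r" "r < 1"
begin

text \<open>In \<open>C_alpha\<close> a weight r may be followed only by weights at most r, so among
  weights 1 and r the 1s come first. The squared norm of a polynomial on the test vector is the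
  circle norm minus the sum against \<open>u\<close>, and the denominator loses more.\<close>

lemma C_alpha_shift:
  obtains T where "(H, T) \<in> C_alpha r" "(H, T) \<in> C_1r r" "\<And>x. x \<in> H \<Longrightarrow> r * norm x \<le> norm (T x)"
    "\<And>a p. cmod a < r \<Longrightarrow> cmod p < r \<Longrightarrow> p \<noteq> a \<Longrightarrow>
      \<exists>y\<in>H. norm (poly_op (blaschke_den a p) T y) < norm (poly_op (blaschke_num a p) T y)"
proof -
  define w where "w = (\<lambda>n :: int. if n \<le> 0 then 1 else r)"
  interpret bounded_weights E w 1
    by unfold_locales (use r in \<open>auto simp: w_def\<close>)
  let ?T = "weighted_shift (- 1) w"
  have ge: "r \<le> w n" for n
    using r by (simp add: w_def)
  have inv: "invertible_on H ?T"
    by (rule invertible_on_weighted_shift[OF r(1) ge])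
  then interpret T: hilbert_invertible H ?T by unfold_locales
  have r2: "r\<^sup>2 \<le> 1"
    using r by (simp add: power_le_one)
  have "(w (n - 2 * - 1))\<^sup>2 * (w (n - - 1))\<^sup>2 + r\<^sup>2 \<le> (1 + r\<^sup>2) * (w (n - - 1))\<^sup>2" for n
    using r2 by (auto simp: w_def algebra_simps)
  then have 1: "(H, ?T) \<in> C_alpha r"
    using inv C_alpha_inequality unfolding C_alpha_iff by blast
  have 2: "(H, ?T) \<in> C_1r r"
    by (rule C_1rI[OF inv]) (use norm_weighted_shift_le norm_weighted_shift_ge[OF _ _ ge] r in auto)
  \<comment> \<open>Starting at \<open>E (- 2)\<close> the first two steps have weight 1 and the
    third has weight r; truncated subtraction gives \<open>W i = 1\<close> for i up to 2.\<close>
  define W where "W = (\<lambda>i :: nat. r ^ (i - 2))"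
  define u where "u = (\<lambda>i. 1 - (W i)\<^sup>2)"
  have W: "W 0 = 1" "W (Suc i) = W i * w (- 2 - int (Suc i) * - 1)" for i
    by (auto simp: W_def w_def power_diff_Suc not_le)
  have mono: "mono u"
    using r by (auto intro!: monoI power_mono power_decreasing simp: u_def W_def)
  have zero: "u i = 0" if "i \<le> 2" for i
    using that by (simp add: u_def W_def)
  have pos: "0 < u 3"
    using r by (simp add: u_def W_def power_less_one_iff)
  have bad: "\<exists>y\<in>H. norm (poly_op (blaschke_den a p) ?T y) < norm (poly_op (blaschke_num a p) ?T y)"
    if a: "cmod a < r" and p: "cmod p < r" "p \<noteq> a" for a p
  proof -
    have lim: "(\<lambda>L. (cmod p ^ Suc L)\<^sup>2 * u (L + 3)) \<longlonglongrightarrow> 0"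
    proof (rule Lim_null_comparison)
      show "\<forall>\<^sub>F L in sequentially. norm ((cmod p ^ Suc L)\<^sup>2 * u (L + 3)) \<le> (cmod p ^ Suc L)\<^sup>2"
      proof (intro always_eventually allI)
        fix L
        have "0 \<le> W (L + 3)" "W (L + 3) \<le> 1"
          using power_le_one[of r "L + 3 - 2"] r by (simp_all add: W_def)
        then have "(W (L + 3))\<^sup>2 \<le> 1"
          by (rule power_le_one)
        then have "\<bar>u (L + 3)\<bar> \<le> 1"
          using zero_le_power2[of "W (L + 3)"] unfolding u_def by linarith
        then show "norm ((cmod p ^ Suc L)\<^sup>2 * u (L + 3)) \<le> (cmod p ^ Suc L)\<^sup>2"
          by (simp only: real_norm_def abs_mult abs_of_nonneg[OF zero_le_power2] mult_left_le[OF _ zero_le_power2])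
      qed
      have "(\<lambda>L. cmod p ^ Suc L) \<longlonglongrightarrow> 0"
        using p(1) r by (intro LIMSEQ_Suc LIMSEQ_power_zero) simp
      then show "(\<lambda>L. (cmod p ^ Suc L)\<^sup>2) \<longlonglongrightarrow> 0"
        using tendsto_power[of _ 0 _ 2] by fastforce
    qed
    have ap: "cmod a \<le> 1" "cmod p < 1"
      using r a p by auto
    obtain N Y where
      deg: "degree (blaschke_num a p * Y) \<le> N" "degree (blaschke_den a p * Y) \<le> N"
      and eq: "coeff_sqnorm N (blaschke_num a p * Y) = coeff_sqnorm N (blaschke_den a p * Y)"
      and gap: "(\<Sum>i\<le>N. (cmod (coeff (blaschke_num a p * Y) i))\<^sup>2 * u i)
        < (\<Sum>i\<le>N. (cmod (coeff (blaschke_den a p * Y) i))\<^sup>2 * u i)"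
      by (rule blaschke_weight_gap[OF ap p(2) mono zero pos lim])
    define y where "y = poly_op Y ?T (E (- 2))"
    have y: "y \<in> H"
      by (simp add: y_def)
    have norm: "(norm (poly_op Q ?T y))\<^sup>2 = coeff_sqnorm N (Q * Y) - (\<Sum>i\<le>N. (cmod (coeff (Q * Y) i))\<^sup>2 * u i)"
      if "degree (Q * Y) \<le> N" for Q
    proof -
      have "poly_op Q ?T y = poly_op (Q * Y) ?T (E (- 2))"
        by (simp add: y_def T.poly_op_mult)
      then show ?thesis
        using norm_poly_op_weighted_shift[OF W _ that]
        by (simp add: coeff_sqnorm_def u_def right_diff_distrib sum_subtractf)
    qed
    have "(norm (poly_op (blaschke_den a p) ?T y))\<^sup>2 < (norm (poly_op (blaschke_num a p) ?T y))\<^sup>2"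
      unfolding norm[OF deg(1)] norm[OF deg(2)] using eq gap by linarith
    then have "norm (poly_op (blaschke_den a p) ?T y) < norm (poly_op (blaschke_num a p) ?T y)"
      by (rule power_less_imp_less_base) simp
    then show ?thesis
      using y by blast
  qed
  show ?thesis
    using norm_weighted_shift_ge[OF _ less_imp_le[OF r(1)] ge] by (rule that[OF 1 2 _ bad])
qed

text \<open>The weights r, 1 are in the order for which the adjoint lies in \<open>C_alpha\<close>.
  The gap is produced for the inverse \<open>?S\<close>, whose products of weights grow, so there
  the numerator gets the smaller norm. Reversing coefficients exchanges numerator and denominator
  and conjugates the parameters, hence the start from \<open>cnj a\<close> and
  \<open>cnj p\<close>.\<close>

lemma C_alpha_star_shift:
  obtains T where "(H, T) \<in> C_alpha_star r" "invertible_on H T" "\<And>x. x \<in> H \<Longrightarrow> r * norm x \<le> norm (T x)"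
    "\<And>a p. cmod a < r \<Longrightarrow> cmod p < r \<Longrightarrow> p \<noteq> a \<Longrightarrow>
      \<exists>y\<in>H. norm (poly_op (blaschke_den a p) T y) < norm (poly_op (blaschke_num a p) T y)"
proof -
  define w where "w = (\<lambda>n :: int. if n \<le> 0 then r else 1)"
  interpret bounded_weights E w 1
    by unfold_locales (use r in \<open>auto simp: w_def\<close>)
  let ?T = "weighted_shift (- 1) w"
  let ?v = "\<lambda>n. 1 / w (n - - 1)"
  let ?S = "weighted_shift (- (- 1)) ?v"
  have ge: "r \<le> w n" for n
    using r by (simp add: w_def)
  interpret v: bounded_weights E ?v "1 / r"
    by (rule bounded_weights_inverse[OF r(1) ge])
  interpret adj: bounded_weights E "\<lambda>n. w (n - - 1)" 1
    by unfold_locales (simp_all add: weight_nonneg weight_le)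
  interpret T: hilbert_operator H ?T
    by unfold_locales (rule operator_on_weighted_shift)
  interpret S: hilbert_operator H ?S
    by unfold_locales (rule v.operator_on_weighted_shift)
  have r2: "r\<^sup>2 \<le> 1"
    using r by (simp add: power_le_one)
  have "(H, adj_on H ?T) \<in> C_alpha r"
    unfolding C_alpha_iff
  proof (intro conjI ballI)
    show "invertible_on H (adj_on H ?T)"
      using adj.invertible_on_weighted_shift[OF r(1) ge] adj_on_weighted_shift by (rule invertible_on_cong)
    fix x assume x: "x \<in> H"
    have "(w (n - 2 * (- (- 1)) - - 1))\<^sup>2 * (w (n - (- (- 1)) - - 1))\<^sup>2 + r\<^sup>2 \<le> (1 + r\<^sup>2) * (w (n - (- (- 1)) - - 1))\<^sup>2" for n
      using r2 by (auto simp: w_def algebra_simps)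
    from adj.C_alpha_inequality[OF this x]
    show "(norm (adj_on H ?T (adj_on H ?T x)))\<^sup>2 + r\<^sup>2 * (norm x)\<^sup>2 \<le> (1 + r\<^sup>2) * (norm (adj_on H ?T x))\<^sup>2"
      using x by (simp only: adj_on_weighted_shift adj.weighted_shift_mem)
  qed
  then have 1: "(H, ?T) \<in> C_alpha_star r"
    by (simp add: C_alpha_star_def operator_on_weighted_shift)
  \<comment> \<open>The orbit of \<open>E 2\<close> under the backward shift \<open>?S\<close> meets
    the weights 1, 1, 1/r, 1/r and so on.\<close>
  define W where "W = (\<lambda>i :: nat. (1 / r) ^ (i - 2))"
  define u where "u = (\<lambda>i. (W i)\<^sup>2 - 1)"
  have W: "W 0 = 1" "W (Suc i) = W i * ?v (2 - int (Suc i) * (- (- 1)))" for i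
    by (auto simp: W_def w_def power_diff_Suc not_le)
  have mono: "mono u"
    using r by (auto intro!: monoI power_mono power_increasing simp: u_def W_def)
  have zero: "u i = 0" if "i \<le> 2" for i
    using that by (simp add: u_def W_def)
  have pos: "0 < u 3"
    using r by (simp add: u_def W_def power_less_one_iff)
  have bad: "\<exists>y\<in>H. norm (poly_op (blaschke_den a p) ?T y) < norm (poly_op (blaschke_num a p) ?T y)"
    if a: "cmod a < r" and p: "cmod p < r" "p \<noteq> a" for a p
  proof -
    have lim: "(\<lambda>L. (cmod (cnj p) ^ Suc L)\<^sup>2 * u (L + 3)) \<longlonglongrightarrow> 0"
    proof (rule Lim_null_comparison)
      \<comment> \<open>The growth of the weights, (1/r)^(L + 1), exactly matches the power of |p|;
        this is where |p| < r enters.\<close>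
      have "(cmod p ^ Suc L)\<^sup>2 * u (L + 3) \<le> ((cmod p / r) ^ Suc L)\<^sup>2" for L
      proof -
        have "(cmod p ^ Suc L)\<^sup>2 * u (L + 3) \<le> (cmod p ^ Suc L)\<^sup>2 * ((1 / r) ^ Suc L)\<^sup>2"
          by (intro mult_left_mono) (simp_all add: u_def W_def numeral_3_eq_3)
        then show ?thesis
          by (simp only: power_mult_distrib[symmetric] times_divide_eq_right mult_1_right)
      qed
      moreover have "0 \<le> u i" for i
        using monoD[OF mono, of 0 i] zero[of 0] by simp
      ultimately show "\<forall>\<^sub>F L in sequentially. norm ((cmod (cnj p) ^ Suc L)\<^sup>2 * u (L + 3)) \<le> ((cmod p / r) ^ Suc L)\<^sup>2"
        by (intro always_eventually allI) (simp only: complex_mod_cnj real_norm_def abs_of_nonneg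
            mult_nonneg_nonneg zero_le_power2)
      have "(\<lambda>L. (cmod p / r) ^ Suc L) \<longlonglongrightarrow> 0"
        using p(1) r by (intro LIMSEQ_Suc LIMSEQ_power_zero) simp
      then show "(\<lambda>L. ((cmod p / r) ^ Suc L)\<^sup>2) \<longlonglongrightarrow> 0"
        using tendsto_power[of _ 0 _ 2] by fastforce
    qed
    have ap: "cmod (cnj a) \<le> 1" "cmod (cnj p) < 1" "cnj p \<noteq> cnj a"
      using r a p by auto
    obtain N Y where
      deg: "degree (blaschke_num (cnj a) (cnj p) * Y) \<le> N" "degree (blaschke_den (cnj a) (cnj p) * Y) \<le> N"
      and eq: "coeff_sqnorm N (blaschke_num (cnj a) (cnj p) * Y) = coeff_sqnorm N (blaschke_den (cnj a) (cnj p) * Y)"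
      and gap: "(\<Sum>i\<le>N. (cmod (coeff (blaschke_num (cnj a) (cnj p) * Y) i))\<^sup>2 * u i)
        < (\<Sum>i\<le>N. (cmod (coeff (blaschke_den (cnj a) (cnj p) * Y) i))\<^sup>2 * u i)"
      by (rule blaschke_weight_gap[OF ap mono zero pos lim])
    define y where "y = poly_op Y ?S (E 2)"
    have y: "y \<in> H"
      unfolding y_def by (rule S.poly_op_mem[OF basis_mem])
    have norm: "(norm (poly_op Q ?S y))\<^sup>2 = coeff_sqnorm N (Q * Y) + (\<Sum>i\<le>N. (cmod (coeff (Q * Y) i))\<^sup>2 * u i)"
      if "degree (Q * Y) \<le> N" for Q
    proof -
      have "poly_op Q ?S y = poly_op (Q * Y) ?S (E 2)"
        unfolding y_def by (rule S.poly_op_mult[OF basis_mem, symmetric])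
      then show ?thesis
        using v.norm_poly_op_weighted_shift[OF W _ that]
        by (simp add: coeff_sqnorm_def u_def right_diff_distrib sum_subtractf)
    qed
    have "(norm (poly_op (blaschke_num (cnj a) (cnj p)) ?S y))\<^sup>2 < (norm (poly_op (blaschke_den (cnj a) (cnj p)) ?S y))\<^sup>2"
      unfolding norm[OF deg(1)] norm[OF deg(2)] using eq gap by linarith
    then have less: "norm (poly_op (blaschke_num (cnj a) (cnj p)) ?S y) < norm (poly_op (blaschke_den (cnj a) (cnj p)) ?S y)"
      by (rule power_less_imp_less_base) simp
    have linear: "poly_op [:b, c:] ?T (?S x) = poly_op [:c, b:] ?S x" if "x \<in> H" for b c x
      by (simp only: T.poly_op_pCons[OF S.op_mem[OF that]] S.poly_op_pCons[OF that] poly_op_0 T.op_zero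
          S.op_zero add_0_right T.op_scaleC[OF S.op_mem[OF that]] S.op_scaleC[OF that]
          weighted_shift_inverse(1)[OF r(1) ge that]) (rule add.commute)
    have commute: "poly_op Q ?S (?S x) = ?S (poly_op Q ?S x)" if "x \<in> H" for Q x
    proof -
      have "poly_op [:0, 1:] ?S z = ?S z" if "z \<in> H" for z
        by (simp only: S.poly_op_pCons[OF that] poly_op_0 S.op_zero add_0_right add_0_left
            scaleC_0_left scaleC_one)
      then show ?thesis
        using S.poly_op_mult[OF that, of Q "[:0, 1:]"] S.poly_op_mult'[OF that, of Q "[:0, 1:]"] that
        by (simp only: S.poly_op_mem)
    qed
    \<comment> \<open>On inverses the coefficients are reversed, which exchanges numerator and denominator.\<close>
    have cubic: "poly_op ([:b1, c1:] * ([:b2, c2:] * [:b3, c3:])) ?T (?S (?S (?S y)))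
        = poly_op ([:c1, b1:] * ([:c2, b2:] * [:c3, b3:])) ?S y" for b1 b2 b3 c1 c2 c3
      using y by (simp only: T.poly_op_mult S.poly_op_mult S.op_mem linear commute T.poly_op_mem S.poly_op_mem)
    have "norm (poly_op (blaschke_den a p) ?T (?S (?S (?S y)))) < norm (poly_op (blaschke_num a p) ?T (?S (?S (?S y))))"
      using less unfolding blaschke_num_def blaschke_den_def cubic complex_cnj_cnj .
    then show ?thesis
      using S.op_mem[OF S.op_mem[OF S.op_mem[OF y]]] by blast
  qed
  show ?thesis
    using norm_weighted_shift_ge[OF _ less_imp_le[OF r(1)] ge]
    by (rule that[OF 1 invertible_on_weighted_shift[OF r(1) ge] _ bad])
qed

end

end

section \<open>Minimality\<close>

text \<open>Lifts a polynomial in z to the curve through the first coordinate alone, the factor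
  \<open>s\<close> undoing the normalisation in \<open>kappa\<close>.\<close>

lemma cpoly_first_variable:
  assumes "s \<noteq> 0"
  obtains p :: "2 cpoly" where "\<And>z. cpoly_eval p z = poly P (complex_of_real s * z $ 1)"
    and "\<And>H T x r. hilbert_operator H T \<Longrightarrow> x \<in> H \<Longrightarrow> s = sqrt (1 + r\<^sup>2) \<Longrightarrow>
      cpoly_op p (kappa_op r H T) x = poly_op P T (x :: 'h::complex_hilbert)"
proof -
  define e where "e = (\<lambda>i :: nat. (\<chi> j. if j = 1 then i else 0) :: nat ^ 2)"
  have e: "e i $ 1 = i" "e i $ 2 = 0" for i
    by (simp_all add: e_def)
  have inj: "inj e"
    by (rule injI) (metis e(1))
  define p where "p = (\<Sum>i\<le>degree P. Poly_Mapping.single (e i) (coeff P i * complex_of_real s ^ i))"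
  have lookup: "Poly_Mapping.lookup p (e i) = coeff P i * complex_of_real s ^ i" if "i \<le> degree P" for i
  proof -
    have "Poly_Mapping.lookup p (e i) = (\<Sum>j\<le>degree P. if j = i then coeff P j * complex_of_real s ^ j else 0)"
      unfolding p_def lookup_sum by (rule sum.cong) (use inj in \<open>auto simp: lookup_single when_def inj_eq\<close>)
    then show ?thesis
      using that by simp
  qed
  have keys: "Poly_Mapping.keys p \<subseteq> e ` {..degree P}"
    unfolding p_def using keys_sum[of "\<lambda>i. Poly_Mapping.single (e i) (coeff P i * complex_of_real s ^ i)" "{..degree P}"]
    by (rule order_trans) (auto simp: keys_single split: if_splits)
  \<comment> \<open>An arbitrary monoid as target serves both evaluation and operators;
    \<open>f 0 m = 0\<close> disposes of exponents outside the support.\<close>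
  have expand: "(\<Sum>m\<in>Poly_Mapping.keys p. f (Poly_Mapping.lookup p m) m)
      = (\<Sum>i\<le>degree P. f (coeff P i * complex_of_real s ^ i) (e i))"
    if "\<And>m. f 0 m = 0" for f :: "complex \<Rightarrow> nat ^ 2 \<Rightarrow> 'b::comm_monoid_add"
  proof -
    have "(\<Sum>m\<in>Poly_Mapping.keys p. f (Poly_Mapping.lookup p m) m)
        = (\<Sum>m\<in>e ` {..degree P}. f (Poly_Mapping.lookup p m) m)"
      by (rule sum.mono_neutral_left) (use keys that in \<open>auto simp: in_keys_iff\<close>)
    also have "\<dots> = (\<Sum>i\<le>degree P. f (Poly_Mapping.lookup p (e i)) (e i))"
      by (subst sum.reindex) (use inj in \<open>auto intro: inj_on_subset\<close>)
    finally show ?thesis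
      by (simp add: lookup)
  qed
  show ?thesis
  proof
    show "cpoly_eval p z = poly P (complex_of_real s * z $ 1)" for z
      unfolding cpoly_eval_def poly_altdef
      by (subst expand) (simp_all add: UNIV_2 e power_mult_distrib mult.assoc)
    fix H :: "'h set" and T x r
    assume "hilbert_operator H T" and x: "x \<in> H" and s: "s = sqrt (1 + r\<^sup>2)"
    then interpret hilbert_operator H T by simp
    have pow: "((\<lambda>x. (1 / s) *\<^sub>R T x) ^^ i) x = (1 / s) ^ i *\<^sub>R (T ^^ i) x" for i
      using x by (induction i) (simp_all add: op_scaleR)
    have "monom_op (kappa_op r H T) (e i) x = (1 / s) ^ i *\<^sub>R (T ^^ i) x" for i
      by (simp add: monom_op_def sorted_list_of_UNIV_2 e kappa_op_nth pow flip: s)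
    then have "cpoly_op p (kappa_op r H T) x
      = (\<Sum>i\<le>degree P. (coeff P i * complex_of_real s ^ i) *\<^sub>C (1 / s) ^ i *\<^sub>R (T ^^ i) x)"
      unfolding cpoly_op_def by (subst expand) simp_all
    also have "\<dots> = poly_op P T x"
      unfolding poly_op_def using assms
      by (intro sum.cong) (simp_all add: scaleR_scaleC scaleC_scaleC power_divide)
    finally show "cpoly_op p (kappa_op r H T) x = poly_op P T x" .
  qed
qed

section \<open>Comparison of Blaschke factors on the disc\<close>

lemma poly_blaschke:
  "poly (blaschke_num a p) z = (z - a) * ((z - a) * (1 - cnj p * z))"
  "poly (blaschke_den a p) z = (1 - cnj a * z) * ((1 - cnj a * z) * (z - p))"
  by (simp_all add: blaschke_num_def blaschke_den_def algebra_simps)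

text \<open>The identity for 1 - |b_a|^2 with its denominator cleared.\<close>

lemma cmod_square_blaschke:
  "(cmod (1 - cnj a * z))\<^sup>2 - (cmod (z - a))\<^sup>2 = (1 - (cmod a)\<^sup>2) * (1 - (cmod z)\<^sup>2)"
  unfolding cmod_power2 by (simp add: algebra_simps power2_eq_square)

text \<open>Writing \<open>b\<^sub>a\<close> for the Blaschke factor with zero \<open>a\<close>, the claim is
  \<open>\<bar>b\<^sub>a\<bar>\<^sup>2 \<le> \<bar>b\<^sub>p\<bar>\<close>, that is \<open>1 - \<bar>b\<^sub>p\<bar>\<^sup>2 \<le> (1 - \<bar>b\<^sub>a\<bar>\<^sup>2) (1 + \<bar>b\<^sub>a\<bar>\<^sup>2)\<close>; as \<open>p\<close> tends to \<open>a\<close> the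
  left-hand side tends to \<open>1 - \<bar>b\<^sub>a\<bar>\<^sup>2\<close>, while \<open>\<bar>b\<^sub>a\<bar>\<close> is bounded below.\<close>

lemma blaschke_num_le_den:
  assumes r: "0 < r" "r < 1" and a: "0 < cmod a" "cmod a < r" and e: "0 < e"
  obtains p where "cmod a < cmod p" "cmod p < r" "dist p a < e"
    "\<And>z. cmod z \<le> 1 \<Longrightarrow> e \<le> dist z a \<Longrightarrow> cmod (poly (blaschke_num a p) z) \<le> cmod (poly (blaschke_den a p) z)"
proof -
  \<comment> \<open>\<open>\<delta>\<close> is a lower bound for |b_a| where |z - a| >= e, since
    there |1 - cnj a z| <= 2. \<open>\<eta>\<close> is small enough for (1 + \<eta>)^2 <= 1 +
    \<delta>^2, and \<open>d\<close> for the relative error of replacing a by p in |1 - cnj a z| to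
    be at most \<open>\<eta>\<close>, as |1 - cnj p z| >= 1 - r.\<close>
  define \<delta> where "\<delta> = min e 1 / 2"
  define \<eta> where "\<eta> = \<delta>\<^sup>2 / 3"
  define d where "d = min ((1 - r) * \<eta>) (min ((r - cmod a) / 2) (e / 2))"
  \<comment> \<open>Moved outwards along the ray through \<open>a\<close>, so that 1 - |p|^2 <= 1 -
    |a|^2.\<close>
  define p where "p = complex_of_real (1 + d / cmod a) * a"
  have \<delta>: "0 < \<delta>" "\<delta> \<le> 1 / 2" "2 * \<delta> \<le> e"
    using e by (auto simp: \<delta>_def min_def)
  then have "0 < \<eta>"
    by (simp add: \<eta>_def)
  then have d: "0 < d" "d \<le> (1 - r) * \<eta>" "d < r - cmod a" "d < e"
    using r a e unfolding d_def by (auto simp: min_def)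
  have cmod_p: "cmod p = cmod a + d"
  proof -
    have "cmod p = (1 + d / cmod a) * cmod a"
      unfolding p_def norm_mult norm_of_real using d(1) a(1) by (simp add: abs_of_nonneg)
    then show ?thesis
      using a(1) by (simp add: field_simps)
  qed
  have diff: "cmod (p - a) = d"
  proof -
    have "p - a = complex_of_real (d / cmod a) * a"
      by (simp add: p_def algebra_simps)
    then show ?thesis
      unfolding norm_mult using d(1) a(1) by (simp add: norm_mult norm_divide del: of_real_divide)
  qed
  have \<eta>_sq: "(1 + \<eta>)\<^sup>2 \<le> 1 + \<delta>\<^sup>2"
  proof -
    have "\<delta>\<^sup>2 \<le> 1"
      using \<delta> by (simp add: power_le_one)
    then have "\<eta> * \<eta> \<le> 1 * \<eta>"
      using \<open>0 < \<eta>\<close> by (intro mult_right_mono) (simp_all add: \<eta>_def)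
    then show ?thesis
      by (simp add: power2_eq_square[of "1 + \<eta>"] algebra_simps) (simp add: \<eta>_def)
  qed
  have main: "cmod (poly (blaschke_num a p) z) \<le> cmod (poly (blaschke_den a p) z)"
    if z: "cmod z \<le> 1" "e \<le> dist z a" for z
  proof -
    define \<alpha> where "\<alpha> = (cmod (1 - cnj a * z))\<^sup>2"
    define \<beta> where "\<beta> = (cmod (1 - cnj p * z))\<^sup>2"
    define g where "g = (cmod (z - a))\<^sup>2"
    define h where "h = (cmod (z - p))\<^sup>2"
    define A where "A = 1 - (cmod a)\<^sup>2"
    define B where "B = 1 - (cmod p)\<^sup>2"
    define q where "q = 1 - (cmod z)\<^sup>2"
    have g: "\<alpha> - g = A * q" and h: "\<beta> - h = B * q"
      unfolding \<alpha>_def \<beta>_def g_def h_def A_def B_def q_def by (rule cmod_square_blaschke)+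
    have nonneg: "0 \<le> q" "0 \<le> \<alpha>" "0 \<le> \<beta>" "0 \<le> g" "0 \<le> h"
      using z(1) by (simp_all add: q_def \<alpha>_def \<beta>_def g_def h_def power_le_one)
    have "B \<le> A"
      using cmod_p d(1) by (simp add: A_def B_def power_mono)
    have "0 \<le> A"
      using a r by (simp add: A_def power_le_one)
    have "1 - r \<le> cmod (1 - cnj p * z)"
    proof -
      have "cmod (cnj p * z) \<le> r * 1"
        unfolding norm_mult using z(1) cmod_p d(3) r(1) by (intro mult_mono) auto
      then show ?thesis
        using norm_triangle_ineq2[of 1 "cnj p * z"] by simp
    qed
    then have "d \<le> \<eta> * cmod (1 - cnj p * z)"
      using d(2) \<open>0 < \<eta>\<close> by (intro order_trans[OF d(2)]) (simp add: mult.commute)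
    moreover have "cmod (1 - cnj a * z) \<le> cmod (1 - cnj p * z) + d"
    proof -
      have "cmod (cnj (p - a) * z) \<le> d * 1"
        unfolding norm_mult complex_mod_cnj diff using z(1) d(1) by (intro mult_left_mono) auto
      moreover have "1 - cnj a * z = (1 - cnj p * z) + cnj (p - a) * z"
        by (simp add: algebra_simps)
      then have "cmod (1 - cnj a * z) \<le> cmod (1 - cnj p * z) + cmod (cnj (p - a) * z)"
        by (simp only: norm_triangle_ineq)
      ultimately show ?thesis
        by linarith
    qed
    ultimately have "cmod (1 - cnj a * z) \<le> (1 + \<eta>) * cmod (1 - cnj p * z)"
      by (simp add: algebra_simps)
    then have "\<alpha> \<le> ((1 + \<eta>) * cmod (1 - cnj p * z))\<^sup>2"
      unfolding \<alpha>_def by (rule power_mono) simp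
    also have "\<dots> \<le> (1 + \<delta>\<^sup>2) * \<beta>"
      unfolding power_mult_distrib \<beta>_def by (intro mult_right_mono \<eta>_sq) simp
    finally have \<alpha>\<beta>: "\<alpha> \<le> (1 + \<delta>\<^sup>2) * \<beta>" .
    have "\<delta>\<^sup>2 * \<alpha> \<le> g"
    proof -
      have "cmod (cnj a * z) \<le> 1 * 1"
        unfolding norm_mult using z(1) a r by (intro mult_mono) auto
      then have "cmod (1 - cnj a * z) \<le> 2"
        using norm_triangle_ineq4[of 1 "cnj a * z"] by simp
      then have "\<delta> * cmod (1 - cnj a * z) \<le> \<delta> * 2"
        using \<delta> by (intro mult_left_mono) auto
      also have "\<dots> \<le> cmod (z - a)"
        using \<delta> z(2) by (simp add: dist_norm)
      finally have "(\<delta> * cmod (1 - cnj a * z))\<^sup>2 \<le> (cmod (z - a))\<^sup>2"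
        using \<delta> by (intro power_mono) auto
      then show ?thesis
        by (simp add: \<alpha>_def g_def power_mult_distrib)
    qed
    then have "(1 + \<delta>\<^sup>2) * \<alpha> \<le> \<alpha> + g"
      by (simp add: algebra_simps)
    \<comment> \<open>With |b_a|^2 = g/\<alpha> and |b_p|^2 = h/\<beta>, the inequality between 1 -
      |b_p|^2 and 1 - |b_a|^4 becomes, cleared of denominators and of the common factor
      \<open>q\<close>, the one derived here.\<close>
    have "\<alpha> * (\<alpha> * B) \<le> \<alpha> * (((1 + \<delta>\<^sup>2) * \<beta>) * A)"
    proof (intro mult_left_mono nonneg)
      have "\<alpha> * B \<le> \<alpha> * A"
        using \<open>B \<le> A\<close> nonneg by (intro mult_left_mono)
      also have "\<dots> \<le> ((1 + \<delta>\<^sup>2) * \<beta>) * A"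
        using \<alpha>\<beta> \<open>0 \<le> A\<close> by (rule mult_right_mono)
      finally show "\<alpha> * B \<le> ((1 + \<delta>\<^sup>2) * \<beta>) * A" .
    qed
    also have "\<dots> = ((1 + \<delta>\<^sup>2) * \<alpha>) * (\<beta> * A)"
      by (simp add: mult_ac)
    also have "\<dots> \<le> (\<alpha> + g) * (\<beta> * A)"
      using \<open>(1 + \<delta>\<^sup>2) * \<alpha> \<le> \<alpha> + g\<close> nonneg \<open>0 \<le> A\<close> by (intro mult_right_mono) auto
    finally have "q * (\<alpha> * (\<alpha> * B)) \<le> q * ((\<alpha> + g) * (\<beta> * A))"
      using nonneg(1) by (rule mult_left_mono)
    moreover have "g\<^sup>2 * \<beta> = \<alpha>\<^sup>2 * \<beta> - q * ((\<alpha> + g) * (\<beta> * A))"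
    proof -
      have "(\<alpha>\<^sup>2 - g\<^sup>2) * \<beta> = (\<alpha> + g) * (\<alpha> - g) * \<beta>"
        by (simp add: power2_eq_square algebra_simps)
      then show ?thesis
        unfolding g by (simp add: algebra_simps)
    qed
    moreover have "\<alpha>\<^sup>2 * h = \<alpha>\<^sup>2 * \<beta> - q * (\<alpha> * (\<alpha> * B))"
    proof -
      have "\<alpha>\<^sup>2 * (\<beta> - h) = q * (\<alpha> * (\<alpha> * B))"
        unfolding h by (simp add: power2_eq_square mult_ac)
      then show ?thesis
        by (simp add: algebra_simps)
    qed
    ultimately have "g\<^sup>2 * \<beta> \<le> \<alpha>\<^sup>2 * h"
      by linarith
    moreover have "(cmod (poly (blaschke_num a p) z))\<^sup>2 = g\<^sup>2 * \<beta>"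
      by (simp only: poly_blaschke norm_mult power_mult_distrib g_def \<beta>_def power2_eq_square[of "(_)\<^sup>2"] mult_ac)
    moreover have "(cmod (poly (blaschke_den a p) z))\<^sup>2 = \<alpha>\<^sup>2 * h"
      by (simp only: poly_blaschke norm_mult power_mult_distrib \<alpha>_def h_def power2_eq_square[of "(_)\<^sup>2"] mult_ac)
    ultimately have "(cmod (poly (blaschke_num a p) z))\<^sup>2 \<le> (cmod (poly (blaschke_den a p) z))\<^sup>2"
      by simp
    then show ?thesis
      by (rule power2_le_imp_le) simp
  qed
  show ?thesis
  proof (rule that)
    show "cmod a < cmod p" "cmod p < r" "dist p a < e"
      using d cmod_p diff by (auto simp: dist_norm)
  qed (rule main)
qed

section \<open>Detecting a missing point by a norm\<close>

lemma tendsto_kappa: "a \<noteq> 0 \<Longrightarrow> (kappa r \<longlongrightarrow> kappa r a) (at a)"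
proof (rule vec_tendstoI)
  fix i :: 2
  assume "a \<noteq> 0"
  then have "((\<lambda>z. kappa r z $ 1) \<longlongrightarrow> kappa r a $ 1) (at a)" "((\<lambda>z. kappa r z $ 2) \<longlongrightarrow> kappa r a $ 2) (at a)"
    unfolding kappa_nth using sqrt_1_plus_square_pos[of r] by (auto intro!: tendsto_intros)
  then show "((\<lambda>z. kappa r z $ i) \<longlongrightarrow> kappa r a $ i) (at a)"
    using exhaust_2[of i] by metis
qed

lemma kappa_avoids_closed:
  assumes "closed Y" "kappa r a \<notin> Y" "a \<noteq> 0"
  obtains e where "0 < e" "\<And>z. kappa r z \<in> Y \<Longrightarrow> e \<le> dist z a"
proof -
  have "\<forall>\<^sub>F z in at a. kappa r z \<in> - Y"
    using tendsto_kappa[OF assms(3)] assms(1,2) by (intro topological_tendstoD) auto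
  then obtain e where "0 < e" "\<And>z. z \<noteq> a \<Longrightarrow> dist z a < e \<Longrightarrow> kappa r z \<notin> Y"
    by (auto simp: eventually_at)
  then show ?thesis
    using that[of e] assms(2) by (metis not_le)
qed

text \<open>The quotient is at most 1 on \<open>Y\<close>, whose points avoid the pole since |p - a|
  < e. Injectivity of the denominator on \<open>H\<close> makes \<open>inv_into\<close> return the
  chosen vector, on which \<open>bad\<close> gives norm above 1.\<close>

lemma (in hilbert_invertible_contraction) not_von_Neumann_set:
  assumes r: "0 < r" "r < 1" and lower: "\<And>x. x \<in> H \<Longrightarrow> r * norm x \<le> norm (T x)"
    and Y: "closed Y" "Y \<subseteq> kappa r ` (cball 0 1 - {0})" "kappa r a \<notin> Y"
    and a: "0 < cmod a" "cmod a < r"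
    and bad: "\<And>p. cmod p < r \<Longrightarrow> p \<noteq> a \<Longrightarrow>
      \<exists>y\<in>H. norm (poly_op (blaschke_den a p) T y) < norm (poly_op (blaschke_num a p) T y)"
  shows "\<not> von_Neumann_set Y H (kappa_op r H T)"
proof
  assume vN: "von_Neumann_set Y H (kappa_op r H T)"
  obtain e where e: "0 < e" "\<And>z. kappa r z \<in> Y \<Longrightarrow> e \<le> dist z a"
    using kappa_avoids_closed[OF Y(1,3)] a(1) by auto
  obtain p where p: "cmod a < cmod p" "cmod p < r" "dist p a < e"
    and le: "\<And>z. cmod z \<le> 1 \<Longrightarrow> e \<le> dist z a \<Longrightarrow>
      cmod (poly (blaschke_num a p) z) \<le> cmod (poly (blaschke_den a p) z)"
    using blaschke_num_le_den[OF r a e(1)] by blast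
  define s where "s = sqrt (1 + r\<^sup>2)"
  have s: "s \<noteq> 0"
    using sqrt_1_plus_square_pos[of r] by (simp add: s_def)
  have kappa_s: "complex_of_real s * kappa r z $ 1 = z" for z
    using s by (simp add: kappa_nth s_def)
  obtain P :: "2 cpoly" where P_eval: "\<And>z. cpoly_eval P z = poly (blaschke_num a p) (complex_of_real s * z $ 1)"
    and P_op: "\<And>x. x \<in> H \<Longrightarrow> cpoly_op P (kappa_op r H T) x = poly_op (blaschke_num a p) T x"
    using cpoly_first_variable[OF s, of "blaschke_num a p", where 'h = 'a] hilbert_operator_axioms s_def by metis
  obtain G :: "2 cpoly" where G_eval: "\<And>z. cpoly_eval G z = poly (blaschke_den a p) (complex_of_real s * z $ 1)"
    and G_op: "\<And>x. x \<in> H \<Longrightarrow> cpoly_op G (kappa_op r H T) x = poly_op (blaschke_den a p) T x"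
    using cpoly_first_variable[OF s, of "blaschke_den a p", where 'h = 'a] hilbert_operator_axioms s_def by metis
  have den_nz: "poly (blaschke_den a p) z \<noteq> 0" if "cmod z \<le> 1" "z \<noteq> p" for z
  proof -
    have "cmod (cnj a * z) \<le> cmod a"
      unfolding norm_mult complex_mod_cnj by (rule mult_left_le[OF that(1) norm_ge_zero])
    then have "cmod (cnj a * z) < 1"
      using a r by linarith
    then have "1 - cnj a * z \<noteq> 0"
      by auto
    then show ?thesis
      using that(2) by (simp add: poly_blaschke)
  qed
  have G_nz: "cpoly_eval G \<xi> \<noteq> 0"
    and quot: "cmod (cpoly_eval P \<xi> / cpoly_eval G \<xi>) \<le> 1" if \<xi>: "\<xi> \<in> Y" for \<xi>
  proof -
    obtain z where "z \<in> cball 0 1 - {0}" "\<xi> = kappa r z"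
      using Y(2) \<xi> by blast
    then have z: "cmod z \<le> 1" "\<xi> = kappa r z"
      by simp_all
    have "e \<le> dist z a"
      using e(2) \<xi> z(2) by simp
    then have "z \<noteq> p"
      using p(3) by auto
    with z show "cpoly_eval G \<xi> \<noteq> 0"
      by (simp add: G_eval kappa_s den_nz)
    then show "cmod (cpoly_eval P \<xi> / cpoly_eval G \<xi>) \<le> 1"
      using le[OF z(1) \<open>e \<le> dist z a\<close>] z(2)
      by (simp add: G_eval P_eval kappa_s norm_divide divide_le_eq)
  qed
  have "G \<noteq> 0"
  proof
    assume "G = 0"
    then have "cpoly_eval G (kappa r 0) = 0"
      by (simp add: cpoly_eval_def)
    moreover have "0 \<noteq> p"
      using p(1) a(1) by auto
    ultimately show False
      using den_nz[of 0] by (simp add: G_eval kappa_s)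
  qed
  then have "op_norm H (rational_op H P G (kappa_op r H T))
      \<le> (SUP \<xi>\<in>Y. ennreal (cmod (cpoly_eval P \<xi> / cpoly_eval G \<xi>)))"
    using vN G_nz unfolding von_Neumann_set_def by blast
  also have "\<dots> \<le> 1"
    using quot by (auto intro!: SUP_least)
  finally have norm_le: "op_norm H (rational_op H P G (kappa_op r H T)) \<le> 1" .
  \<comment> \<open>The roots 1/cnj a lie outside the disc, where a contraction has no eigenvalues;
    the root p has modulus below the lower bound r of \<open>T\<close>.\<close>
  have den_inj: "v = 0" if "v \<in> H" "poly_op (blaschke_den a p) T v = 0" for v
  proof -
    have outer: "w = 0" if "w \<in> H" "poly_op [:1, - cnj a:] T w = 0" for w
    proof (rule shift_inj)
      show "1 < cmod (1 / cnj a)"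
        using a r by (simp add: norm_divide)
      have "w = cnj a *\<^sub>C T w"
        using that by (simp add: poly_op_pCons op_scaleC scaleC_minus_left op_minus scaleC_mem add_eq_0_iff2)
      then have "(1 / cnj a) *\<^sub>C w = (1 / cnj a) *\<^sub>C cnj a *\<^sub>C T w"
        by simp
      then show "T w = (1 / cnj a) *\<^sub>C w"
        using a(1) by (simp add: scaleC_scaleC)
    qed (rule that)
    have "poly_op [:1, - cnj a:] T (poly_op [:1, - cnj a:] T (poly_op [:- p, 1:] T v)) = 0"
      using that by (simp only: blaschke_den_def poly_op_mult poly_op_mem)
    then have "poly_op [:- p, 1:] T v = 0"
      using outer that(1) by simp
    then have "norm (T v) = cmod p * norm v"
      using that(1) by (simp add: poly_op_pCons scaleC_minus_left add_eq_0_iff)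
    then have "r * norm v \<le> cmod p * norm v"
      using lower[OF that(1)] by simp
    then show "v = 0"
      using p(2) by (simp add: mult_le_cancel_right)
  qed
  have inj: "inj_on (cpoly_op G (kappa_op r H T)) H"
  proof (rule inj_onI)
    fix x y assume xy: "x \<in> H" "y \<in> H" "cpoly_op G (kappa_op r H T) x = cpoly_op G (kappa_op r H T) y"
    have "poly_op (blaschke_den a p) T (x + (-1) *\<^sub>C y) = 0"
      unfolding poly_op_add_arg[OF xy(1) scaleC_mem[OF xy(2)]] poly_op_scaleC_arg[OF xy(2)]
      using xy by (simp add: G_op)
    then have "x + (-1) *\<^sub>C y = 0"
      by (rule den_inj[OF add_mem[OF xy(1) scaleC_mem[OF xy(2)]]])
    then show "x = y"
      by simp
  qed
  obtain y where y: "y \<in> H" "norm (poly_op (blaschke_den a p) T y) < norm (poly_op (blaschke_num a p) T y)"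
    using bad[OF p(2)] p(1) by auto
  define c where "c = norm (poly_op (blaschke_den a p) T y)"
  have "c \<noteq> 0"
    using den_inj[OF y(1)] y(2) by (auto simp: c_def poly_op_def)
  then have c: "0 < c"
    by (simp add: c_def)
  \<comment> \<open>Scaled so that the denominator sends it to a unit vector.\<close>
  define v where "v = complex_of_real (1 / c) *\<^sub>C y"
  have v: "v \<in> H"
    using y(1) by (simp add: v_def scaleC_mem)
  define x where "x = poly_op (blaschke_den a p) T v"
  have "norm x = 1"
    using c y(1) by (simp add: x_def v_def poly_op_scaleC_arg norm_divide c_def[symmetric])
  have "cpoly_op G (kappa_op r H T) v = x"
    by (simp add: x_def G_op v)
  then have "inv_into H (cpoly_op G (kappa_op r H T)) x = v"
    using inv_into_f_f[OF inj v] by simp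
  then have eval_x: "rational_op H P G (kappa_op r H T) x = poly_op (blaschke_num a p) T v"
    by (simp add: rational_op_def P_op v)
  have gt: "1 < norm (poly_op (blaschke_num a p) T v)"
    using c y by (simp add: v_def poly_op_scaleC_arg norm_divide c_def[symmetric])
  have "ennreal (norm (rational_op H P G (kappa_op r H T) x)) \<le> op_norm H (rational_op H P G (kappa_op r H T))"
    unfolding op_norm_def by (rule SUP_upper) (use v \<open>norm x = 1\<close> in \<open>simp add: x_def\<close>)
  also note norm_le
  finally show False
    using gt by (simp add: eval_x)
qed

lemma minimal_closed_von_Neumann_setI:
  fixes \<C> :: "('h::complex_hilbert set \<times> ('h \<Rightarrow> 'h)) set"
  assumes r: "0 < r" "r < 1" and e: "(e :: 'h) \<noteq> 0"
    and contraction: "\<And>H T. (H, T) \<in> \<C> \<Longrightarrow> hilbert_invertible_contraction H T"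
    and scalar: "\<And>a. r \<le> cmod a \<Longrightarrow> cmod a \<le> 1 \<Longrightarrow> (UNIV, \<lambda>x. a *\<^sub>C x) \<in> \<C>"
    and shift: "(H\<^sub>0, T\<^sub>0) \<in> \<C>" "\<And>x. x \<in> H\<^sub>0 \<Longrightarrow> r * norm x \<le> norm (T\<^sub>0 x)"
      "\<And>a p. cmod a < r \<Longrightarrow> cmod p < r \<Longrightarrow> p \<noteq> a \<Longrightarrow>
        \<exists>y\<in>H\<^sub>0. norm (poly_op (blaschke_den a p) T\<^sub>0 y) < norm (poly_op (blaschke_num a p) T\<^sub>0 y)"
  shows "minimal_closed_von_Neumann_set (kappa r ` (cball 0 1 - {0})) (kappa_class r \<C>)"
proof -
  let ?Y = "kappa r ` (cball 0 1 - {0})"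
  have members: "commuting_tuple H T \<and> von_Neumann_set ?Y H T" if HT: "(H, T) \<in> kappa_class r \<C>" for H T
  proof -
    obtain S where S: "(H, S) \<in> \<C>" "T = kappa_op r H S"
      using HT by (auto simp: kappa_class_def)
    then interpret hilbert_invertible_contraction H S
      by (intro contraction)
    show ?thesis
      unfolding S(2) using commuting_tuple_kappa_op von_Neumann_set_kappa[OF r(1)] by blast
  qed
  have "\<exists>(H, T)\<in>kappa_class r \<C>. \<not> von_Neumann_set Y H T" if Y: "closed Y" "Y \<subset> ?Y" for Y
  proof -
    obtain a where "a \<in> cball 0 1 - {0}" and avoid: "kappa r a \<notin> Y"
      using Y(2) by blast
    then have a: "0 < cmod a" "cmod a \<le> 1"
      by simp_all
    show ?thesis
    proof (cases "r \<le> cmod a")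
      case True
      have "\<not> von_Neumann_set Y UNIV (kappa_op r UNIV (\<lambda>x. a *\<^sub>C (x :: 'h)))"
        using kappa_mem_taylor_spectrum_scalar[OF _ e, of a r] a(1) avoid
        by (auto simp: von_Neumann_set_def)
      then show ?thesis
        using scalar[OF True a(2)] by (force simp: kappa_class_def)
    next
      case False
      interpret hilbert_invertible_contraction H\<^sub>0 T\<^sub>0
        by (rule contraction[OF shift(1)])
      have "\<not> von_Neumann_set Y H\<^sub>0 (kappa_op r H\<^sub>0 T\<^sub>0)"
        using Y False a(1) avoid by (intro not_von_Neumann_set[OF r shift(2), of Y a] shift(3)) auto
      then show ?thesis
        using shift(1) by (force simp: kappa_class_def)
    qed
  qed
  then show ?thesis
    unfolding minimal_closed_von_Neumann_set_def
    using members closed_kappa_image[OF r(1)] by blast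
qed

theorem theorem5p14:
  fixes r :: real
  assumes "0 < r" and "r < 1"
    and infinite_dimensional: "\<not> (\<exists>B :: 'h::complex_hilbert set. finite B \<and> span B = UNIV)"
  shows "minimal_closed_von_Neumann_set (kappa r ` (cball 0 1 - {0}))
           (kappa_class r (C_alpha r :: ('h set \<times> ('h \<Rightarrow> 'h)) set))
       \<and> minimal_closed_von_Neumann_set (kappa r ` (cball 0 1 - {0}))
           (kappa_class r (C_alpha_star r :: ('h set \<times> ('h \<Rightarrow> 'h)) set))
       \<and> minimal_closed_von_Neumann_set (kappa r ` (cball 0 1 - {0}))
           (kappa_class r (C_alpha r \<union> C_alpha_star r :: ('h set \<times> ('h \<Rightarrow> 'h)) set))
       \<and> minimal_closed_von_Neumann_set (kappa r ` (cball 0 1 - {0}))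
           (kappa_class r (C_1r r :: ('h set \<times> ('h \<Rightarrow> 'h)) set))
       \<and> minimal_closed_von_Neumann_set (kappa r ` (cball 0 1 - {0}))
           (kappa_class r (C_1 :: ('h set \<times> ('h \<Rightarrow> 'h)) set))"
proof -
  note r = assms(1,2)
  obtain E :: "nat \<Rightarrow> 'h" where E: "\<And>m n. cinner (E m) (E n) = (if m = n then 1 else 0)"
    using ex_orthonormal_sequence[OF infinite_dimensional] by blast
  \<comment> \<open>Bilateral shifts need indices in the integers, so the sequence is
    reindexed.\<close>
  interpret orthonormal_family "\<lambda>n. E (int_encode n)"
    by unfold_locales (simp add: E int_encode_eq)
  have e: "E 0 \<noteq> 0"
    using E[of 0 0] by auto
  obtain B where B: "(H, B) \<in> C_alpha r" "(H, B) \<in> C_1r r" "\<And>x. x \<in> H \<Longrightarrow> r * norm x \<le> norm (B x)"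
    "\<And>a p. cmod a < r \<Longrightarrow> cmod p < r \<Longrightarrow> p \<noteq> a \<Longrightarrow>
      \<exists>y\<in>H. norm (poly_op (blaschke_den a p) B y) < norm (poly_op (blaschke_num a p) B y)"
    using C_alpha_shift[OF r] by metis
  obtain M where M: "(H, M) \<in> C_alpha_star r" "\<And>x. x \<in> H \<Longrightarrow> r * norm x \<le> norm (M x)"
    "\<And>a p. cmod a < r \<Longrightarrow> cmod p < r \<Longrightarrow> p \<noteq> a \<Longrightarrow>
      \<exists>y\<in>H. norm (poly_op (blaschke_den a p) M y) < norm (poly_op (blaschke_num a p) M y)"
    using C_alpha_star_shift[OF r] by metis
  \<comment> \<open>The shift \<open>B\<close> lies in four of the five classes; only
    \<open>C_alpha_star\<close> requires \<open>M\<close>.\<close>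
  have minimal_if: "minimal_closed_von_Neumann_set (kappa r ` (cball 0 1 - {0})) (kappa_class r \<C>)"
    if "\<And>H T. (H, T) \<in> \<C> \<Longrightarrow> hilbert_invertible_contraction H T"
      "\<And>a. r \<le> cmod a \<Longrightarrow> cmod a \<le> 1 \<Longrightarrow> (UNIV, \<lambda>x. a *\<^sub>C x) \<in> \<C>" "(H, B) \<in> \<C>"
    for \<C> :: "('h set \<times> ('h \<Rightarrow> 'h)) set"
    using that B(3,4) by (rule minimal_closed_von_Neumann_setI[OF r e])
  show ?thesis
  proof (intro conjI)
    show "minimal_closed_von_Neumann_set (kappa r ` (cball 0 1 - {0})) (kappa_class r (C_alpha r :: ('h set \<times> ('h \<Rightarrow> 'h)) set))"
      using C_alpha_invertible_contraction[OF r] scalar_mem_classes(1)[OF r(1)] B(1)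
      by (rule minimal_if)
    show "minimal_closed_von_Neumann_set (kappa r ` (cball 0 1 - {0})) (kappa_class r (C_alpha_star r :: ('h set \<times> ('h \<Rightarrow> 'h)) set))"
      using C_alpha_star_invertible_contraction[OF r] scalar_mem_classes(2)[OF r(1)] M
      by (rule minimal_closed_von_Neumann_setI[OF r e])
    show "minimal_closed_von_Neumann_set (kappa r ` (cball 0 1 - {0}))
      (kappa_class r (C_alpha r \<union> C_alpha_star r :: ('h set \<times> ('h \<Rightarrow> 'h)) set))"
      using C_alpha_invertible_contraction[OF r] C_alpha_star_invertible_contraction[OF r]
        scalar_mem_classes(1)[OF r(1)] B(1) by (intro minimal_if) blast+
    show "minimal_closed_von_Neumann_set (kappa r ` (cball 0 1 - {0})) (kappa_class r (C_1r r :: ('h set \<times> ('h \<Rightarrow> 'h)) set))"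
      using C_1_invertible_contraction C_1r_subset_C_1 scalar_mem_classes(3)[OF r(1)] B(2)
      by (intro minimal_if) blast+
    show "minimal_closed_von_Neumann_set (kappa r ` (cball 0 1 - {0})) (kappa_class r (C_1 :: ('h set \<times> ('h \<Rightarrow> 'h)) set))"
      using C_1_invertible_contraction C_1r_subset_C_1 scalar_mem_classes(3)[OF r(1)] B(2)
      by (intro minimal_if) blast+
  qed
qed

end
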